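(* Let $S(t)(f,\mathbf g)=(S_1(t)(f,\mathbf g),S_2(t)(f,\mathbf g)):=(\theta(t),\mathbf m(t))$ denote the solution operator of the linear Cauchy problem $$\partial_t\theta+\operatorname{div}\mathbf m=0,\qquad \partial_t\mathbf m-\alpha_*\Delta\mathbf m-\beta_*\nabla\operatorname{div}\mathbf m-\kappa_*\rho_*\nabla\Delta\theta=0\quad\text{in }\mathbb R^N\times(0,\infty),\qquad (\theta,\mathbf m)|_{t=0}=(f,\mathbf g),$$ given explicitly by solving the Fourier-transformed system in $t$. Let $S^0(t)=S(t)\Phi_0$ and $S^\infty(t)=S(t)\Phi_\infty$. Then for every $j\in\mathbb N_0$ and $t>0$: (i) If $\mathbf g=\operatorname{Div}\mathbf G$ with $f\in L_q(\mathbb R^N)$ and $\mathbf G\in L_q(\mathbb R^N)^{N\times N}$, then $$\|\partial_x^jS^0(t)(f,\mathbf g)\|_{L_p(\mathbb R^N)}\le C\,t^{-\frac N2(\frac1q-\frac1p)-\frac j2}\|(f,\mathbf G)\|_{L_q(\mathbb R^N)},$$ provided $1<q\le p\le\infty$, $(p,q)\ne(\infty,\infty)$ when $0<t\le1$, and provided $1<q\le2\le p\le\infty$, $(p,q)\ne(\infty,\infty)$ when $t\ge1$. (ii) If $(f,\mathbf g)\in W^{1,0}_q(\mathbb R^N)$ and $1<q\le p\le\infty$, $(p,q)\ne(\infty,\infty)$, then $$\|\partial_x^jS^\infty(t)(f,\mathbf g)\|_{W^{1,0}_p(\mathbb R^N)}\le C\,t^{-\frac N2(\frac1q-\frac1p)-\frac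 j2}\|(f,\mathbf g)\|_{W^{1,0}_q(\mathbb R^N)}.$$ In both cases $C$ is a constant depending on $j,p,q,\alpha_*,\beta_*$ (and the fixed parameters of the problem and cutoff), independent of $t$ and of the data.
   Context: $\rho_*>0$, $\mu_*>0$, $\mu_*+\nu_*>0$, $\kappa_*>0$ are constants, $\alpha_*=\mu_*/\rho_*$, $\beta_*=\nu_*/\rho_*$. $\operatorname{Div}$ of a matrix field $(G_{jk})$ is the vector with components $\sum_k\partial_kG_{jk}$. $W^{1,0}_q(\mathbb R^N)=W^1_q(\mathbb R^N)\times L_q(\mathbb R^N)^N$ with norm $\|f\|_{W^1_q}+\|\mathbf g\|_{L_q}$. Fourier transform $\hat f(\xi)=\int e^{-ix\cdot\xi}f(x)\,dx$. Let $\varphi\in C^\infty(\mathbb R^N)$ with $\varphi(\xi)=1$ for $|\xi|\le\varepsilon$ and $\varphi(\xi)=0$ for $|\xi|\ge2\varepsilon$, where $\varepsilon>0$ is a suitably small fixed constant; $\Phi_0(f,\mathbf g)=\mathcal F^{-1}[\varphi(\hat f,\hat{\mathbf g})]$ and $\Phi_\infty(f,\mathbf g)=\mathcal F^{-1}[(1-\varphi)(\hat f,\hat{\mathbf g})]$. *)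

theory Defs
  imports "HOL-Probability.Probability"
begin

definition partial :: "'n::finite \<Rightarrow> (real^'n \<Rightarrow> 'a::real_normed_vector) \<Rightarrow> real^'n \<Rightarrow> 'a" where
  "partial k u x = vector_derivative (\<lambda>s. u (x + s *\<^sub>R axis k 1)) (at 0)"

fun partials :: "'n::finite list \<Rightarrow> (real^'n \<Rightarrow> 'a::real_normed_vector) \<Rightarrow> real^'n \<Rightarrow> 'a" where
  "partials [] u = u"
| "partials (k # ks) u = partial k (partials ks u)"

definition smooth_fn :: "(real^'n::finite \<Rightarrow> 'a::real_normed_vector) \<Rightarrow> bool" where
  "smooth_fn u \<longleftrightarrow> (\<forall>ks. continuous_on UNIV (partials ks u)) \<and>
     (\<forall>ks k x. (\<lambda>s. partials ks u (x + s *\<^sub>R axis k 1)) differentiable (at 0))"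

definition cutoff :: "real \<Rightarrow> (real^'n::finite \<Rightarrow> real) \<Rightarrow> bool" where
  "cutoff \<epsilon> \<phi> \<longleftrightarrow> smooth_fn \<phi> \<and> (\<forall>\<xi>. norm \<xi> \<le> \<epsilon> \<longrightarrow> \<phi> \<xi> = 1) \<and> (\<forall>\<xi>. norm \<xi> \<ge> 2 * \<epsilon> \<longrightarrow> \<phi> \<xi> = 0)"

definition test_fn :: "(real^'n::finite \<Rightarrow> real) \<Rightarrow> bool" where
  "test_fn \<psi> \<longleftrightarrow> smooth_fn \<psi> \<and> bounded {x. \<psi> x \<noteq> 0}"

definition weak_partial :: "'n::finite \<Rightarrow> (real^'n \<Rightarrow> real) \<Rightarrow> (real^'n \<Rightarrow> real) \<Rightarrow> bool" where
  "weak_partial k f h \<longleftrightarrow> (\<forall>\<psi>. test_fn \<psi> \<longrightarrow>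
      (LINT x|lborel. f x * partial k \<psi> x) = - (LINT x|lborel. h x * \<psi> x))"

definition Lp_norm :: "ennreal \<Rightarrow> (real^'n::finite \<Rightarrow> 'a::real_normed_vector) \<Rightarrow> ennreal" where
  "Lp_norm p u = (if p = \<top> then e2ennreal (esssup lborel (\<lambda>x. ereal (norm (u x))))
     else (let I = (\<integral>\<^sup>+ x. ennreal (norm (u x) powr enn2real p) \<partial>lborel)
           in if I = \<top> then \<top> else ennreal (enn2real I powr (1 / enn2real p))))"

definition deriv_Lp :: "ennreal \<Rightarrow> nat \<Rightarrow> (real^'n::finite \<Rightarrow> 'a::real_normed_vector) \<Rightarrow> ennreal" where
  "deriv_Lp p j u = (\<Sum>ks\<in>{ks::'n list. length ks = j}. Lp_norm p (partials ks u))"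

text \<open>Fourier symbol of the linear system. State index: None = theta, Some k = m_k.
  Fourier side: d/dt U = symb xi U.\<close>
definition symb :: "real \<Rightarrow> real \<Rightarrow> real \<Rightarrow> real \<Rightarrow> real^'n::finite \<Rightarrow> complex^('n option) \<Rightarrow> complex^('n option)" where
  "symb \<alpha> \<beta> \<kappa> \<rho> \<xi> U = (\<chi> a. case a of
       None \<Rightarrow> - \<i> * (\<Sum>k\<in>UNIV. complex_of_real (\<xi>$k) * U$(Some k))
     | Some k \<Rightarrow> - complex_of_real (\<alpha> * (norm \<xi>)\<^sup>2) * U$(Some k)
                 - complex_of_real (\<beta> * \<xi>$k) * (\<Sum>l\<in>UNIV. complex_of_real (\<xi>$l) * U$(Some l))
                 - \<i> * complex_of_real (\<kappa> * \<rho> * (norm \<xi>)\<^sup>2 * \<xi>$k) * U$None)"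

definition sol_hat :: "real \<Rightarrow> real \<Rightarrow> real \<Rightarrow> real \<Rightarrow> real^'n::finite \<Rightarrow> real \<Rightarrow> complex^('n option) \<Rightarrow> complex^('n option)" where
  "sol_hat \<alpha> \<beta> \<kappa> \<rho> \<xi> t U0 = (THE u. u 0 = U0 \<and>
       (\<forall>s. (u has_vector_derivative symb \<alpha> \<beta> \<kappa> \<rho> \<xi> (u s)) (at s))) t"

text \<open>Inverse Fourier transform (convention hat f(xi) = int e^{-i x xi} f(x) dx).\<close>
definition ift :: "(real^'n::finite \<Rightarrow> complex) \<Rightarrow> real^'n \<Rightarrow> complex" where
  "ift m x = complex_of_real (1 / (2 * pi) ^ CARD('n)) * (LINT \<xi>|lborel. cis (x \<bullet> \<xi>) * m \<xi>)"

text \<open>Fourier multiplier operator F^{-1}[m F u], realised as convolution with F^{-1} m.\<close>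
definition conv_op :: "(real^'n::finite \<Rightarrow> complex) \<Rightarrow> (real^'n \<Rightarrow> complex) \<Rightarrow> real^'n \<Rightarrow> complex" where
  "conv_op m u x = (LINT y|lborel. ift m (x - y) * u y)"

text \<open>S(t) composed with the frequency cutoff psi (psi = phi gives S^0, psi = 1 - phi gives S^infty),
  applied to data (f, g); component a of the result (None: theta, Some k: m_k).\<close>
definition S_cut :: "real \<Rightarrow> real \<Rightarrow> real \<Rightarrow> real \<Rightarrow> (real^'n::finite \<Rightarrow> real) \<Rightarrow> real \<Rightarrow>
    (real^'n \<Rightarrow> real) \<Rightarrow> (real^'n \<Rightarrow> real^'n) \<Rightarrow> 'n option \<Rightarrow> real^'n \<Rightarrow> complex" where
  "S_cut \<alpha> \<beta> \<kappa> \<rho> \<psi> t f g a x =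
     conv_op (\<lambda>\<xi>. complex_of_real (\<psi> \<xi>) * sol_hat \<alpha> \<beta> \<kappa> \<rho> \<xi> t (axis None 1) $ a) (\<lambda>y. complex_of_real (f y)) x
   + (\<Sum>k\<in>UNIV. conv_op (\<lambda>\<xi>. complex_of_real (\<psi> \<xi>) * sol_hat \<alpha> \<beta> \<kappa> \<rho> \<xi> t (axis (Some k) 1) $ a)
                        (\<lambda>y. complex_of_real (g y $ k)) x)"

text \<open>Same, with data (f, Div G): the Fourier transform of (Div G)_k is sum_l i xi_l hat G_kl.\<close>
definition S_cut_Div :: "real \<Rightarrow> real \<Rightarrow> real \<Rightarrow> real \<Rightarrow> (real^'n::finite \<Rightarrow> real) \<Rightarrow> real \<Rightarrow>
    (real^'n \<Rightarrow> real) \<Rightarrow> (real^'n \<Rightarrow> real^'n^'n) \<Rightarrow> 'n option \<Rightarrow> real^'n \<Rightarrow> complex" where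
  "S_cut_Div \<alpha> \<beta> \<kappa> \<rho> \<psi> t f G a x =
     conv_op (\<lambda>\<xi>. complex_of_real (\<psi> \<xi>) * sol_hat \<alpha> \<beta> \<kappa> \<rho> \<xi> t (axis None 1) $ a) (\<lambda>y. complex_of_real (f y)) x
   + (\<Sum>k\<in>UNIV. \<Sum>l\<in>UNIV. conv_op (\<lambda>\<xi>. complex_of_real (\<psi> \<xi>) * \<i> * complex_of_real (\<xi> $ l)
                                   * sol_hat \<alpha> \<beta> \<kappa> \<rho> \<xi> t (axis (Some k) 1) $ a)
                        (\<lambda>y. complex_of_real (G y $ k $ l)) x)"

end

(*
  In Fourier variables the system only involves s = t |xi|^2: with r = |xi|^2 and the divergence part
  d = xi . m, the pair (theta, d / r) solves a constant coefficient 2x2 system in s, whose characteristic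
  roots a, b (of z^2 + (alpha + beta) z + kappa rho) have negative real part. Hence every entry of the
  solution operator is, up to powers of t and xi, a Schwartz function of sqrt t xi: singular factors
  1 / |xi|^2 only occur in divided differences of exponentials. The kernel of such a multiplier has
  L^1 norm O(1) and sup norm O(t^(-N/2)), each derivative costs t^(-1/2), and interpolating
  between the two bounds in Young's inequality gives the decay rate for all 1 < q <= p.
  Where a power of t is off, the cutoff repairs it: for low frequencies a surplus factor xi_k is put on phi;
  for high frequencies the surplus sqrt t (theta from g) is absorbed because phi(0) = 1, so that the kernel
  of (1 - phi) M(sqrt t xi) is an average of differences k(x) - k(x - y). A factor xi_k next to f is
  moved onto f as a weak derivative.
*)
theory Submission
  imports Defs
begin

section \<open>Weights and differentiation under the integral\<close>

text \<open>The derivatives in the statement are classical derivatives of an explicit convolution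
  integral, so the kernels must allow differentiation under the integral for arbitrary data in
  \<open>L_q\<close>. This works because for fixed t > 0 the symbols decay exponentially at all
  frequencies: multiplied by \<open>1 - \<phi>\<close> they remain Schwartz functions, although
  \<open>1 - \<phi>\<close> itself is not one. The main obstacle is degeneracy: the usual solution
  formula divides by the difference of the roots, by the difference of a root and
  \<open>-\<alpha>\<close>, and by |\<xi>|^2, each of which may vanish. A divided difference written
  as an integral over the segment between two exponents treats all these cases, real, complex or
  coinciding, in the same way, and its decay is visible from the real parts on that segment. Two
  definitions also shape the argument. \<open>sol_hat\<close> is a definite description, so an
  explicit formula is of use only together with uniqueness for the linear system. Norms take values
  in the extended reals, so data of infinite norm are set apart before any integral of them is
  used.\<close>

definition weight :: "real^'n::finite \<Rightarrow> real" where
  "weight x = (\<Prod>k\<in>UNIV. 1 + (x$k)\<^sup>2)"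

lemma weight_ge_1: "1 \<le> weight x"
  unfolding weight_def by (intro prod_ge_1) auto

lemma weight_pos [simp]: "0 < weight x"
  using weight_ge_1[of x] by linarith

lemma weight_nonneg [simp]: "0 \<le> weight x"
  using weight_pos[of x] by linarith

lemma weight_uminus [simp]: "weight (- x) = weight x"
  by (simp add: weight_def)

lemma weight_axis: "weight (s *\<^sub>R axis k 1) = 1 + s\<^sup>2"
proof -
  have "weight (s *\<^sub>R axis k 1 :: real^'a) = (\<Prod>j\<in>UNIV. if j = k then 1 + s\<^sup>2 else 1)"
    unfolding weight_def by (intro prod.cong) (auto simp: axis_def)
  then show ?thesis by simp
qed

text \<open>A Peetre-type inequality with one factor 2 per coordinate. It moves a majorant centred
  at one point to another point at the price of the weight of the shift.\<close>

lemma weight_add: "weight (x + y :: real^'n::finite) \<le> 2 ^ CARD('n) * weight x * weight y"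
proof -
  have "1 + (a + b)\<^sup>2 \<le> 2 * (1 + a\<^sup>2) * (1 + b\<^sup>2)" for a b :: real
  proof -
    \<comment> \<open>The right-hand side is the difference of the two sides of the claim.\<close>
    have "0 \<le> (a - b)\<^sup>2 + 1 + 2 * a\<^sup>2 * b\<^sup>2" by simp
    then show ?thesis by (simp add: power2_eq_square algebra_simps)
  qed
  then have "weight (x + y) \<le> (\<Prod>k\<in>(UNIV::'n set). 2 * (1 + (x$k)\<^sup>2) * (1 + (y$k)\<^sup>2))"
    unfolding weight_def by (intro prod_mono) auto
  also have "\<dots> = 2 ^ CARD('n) * weight x * weight y"
    by (simp only: prod.distrib weight_def prod_constant)
  finally show ?thesis .
qed

lemma continuous_on_weight [continuous_intros]: "continuous_on A weight"
  unfolding weight_def[abs_def] by (intro continuous_intros)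

lemma borel_measurable_weight [measurable]: "weight \<in> borel_measurable borel"
  by (intro borel_measurable_continuous_onI continuous_on_weight)

lemma weight_le_norm: "weight (x::real^'n::finite) \<le> (1 + (norm x)\<^sup>2) ^ CARD('n)"
proof -
  have "1 + (x$k)\<^sup>2 \<le> 1 + (norm x)\<^sup>2" for k
    using component_le_norm_cart[of x k] by (simp add: abs_le_square_iff[symmetric])
  then have "weight x \<le> (\<Prod>k\<in>(UNIV::'n set). 1 + (norm x)\<^sup>2)"
    unfolding weight_def by (intro prod_mono) auto
  then show ?thesis by simp
qed

section \<open>Products over the coordinates and an integrable weight\<close>

lemma prod_Basis_cart:
  "(\<Prod>b\<in>(Basis::(real^'n::finite) set). f b) = (\<Prod>k\<in>UNIV. f (axis k 1))"
proof -
  have B: "(Basis::(real^'n) set) = (\<lambda>k. axis k 1) ` UNIV"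
    by (auto simp: Basis_vec_def)
  have "inj (\<lambda>k::'n. axis k (1::real))"
    by (auto simp: inj_on_def axis_eq_axis)
  then show ?thesis unfolding B by (subst prod.reindex) auto
qed

lemma nn_integral_prod_cart:
  fixes f :: "real \<Rightarrow> ennreal"
  assumes [measurable]: "f \<in> borel_measurable borel"
  shows "(\<integral>\<^sup>+x. (\<Prod>k\<in>UNIV. f ((x::real^'n::finite)$k)) \<partial>lborel) = (\<integral>\<^sup>+x. f x \<partial>lborel) ^ CARD('n)"
proof -
  have "(\<integral>\<^sup>+x. (\<Prod>b\<in>Basis. f ((x::real^'n) \<bullet> b)) \<partial>lborel) = (\<Prod>b\<in>(Basis::(real^'n) set). (\<integral>\<^sup>+x. f x \<partial>lborel))"
    by (rule nn_integral_lborel_prod) auto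
  then show ?thesis
    by (simp add: prod_Basis_cart cart_eq_inner_axis[symmetric] prod.If_cases)
qed

text \<open>The reciprocal of \<open>weight\<close> is the common integrable majorant of the
  development. The product form is chosen because the integral then factorises into integrals of 1 /
  (1 + s^2) over the line.\<close>

lemma integrable_inv_weight: "integrable lborel (\<lambda>x::real^'n::finite. 1 / weight x)"
proof (rule integrableI_bounded)
  have "set_integrable lborel (einterval (-\<infinity>) \<infinity>) (\<lambda>x. inverse (1 + x^2))"
    by (rule integrable_inverse_1_plus_square)
  then have i: "integrable lborel (\<lambda>x::real. 1 / (1 + x\<^sup>2))"
    by (simp add: set_integrable_def inverse_eq_divide)
  then have fin: "(\<integral>\<^sup>+(x::real). ennreal (1 / (1 + x\<^sup>2)) \<partial>lborel) < \<infinity>"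
    by (subst nn_integral_eq_integral) auto
  have "(\<integral>\<^sup>+(x::real^'n). ennreal (norm (1 / weight x)) \<partial>lborel)
      = (\<integral>\<^sup>+(x::real^'n). (\<Prod>k\<in>UNIV. ennreal (1 / (1 + (x$k)\<^sup>2))) \<partial>lborel)"
    by (intro nn_integral_cong) (simp add: weight_def prod_ennreal prod_dividef prod_nonneg)
  also have "\<dots> = (\<integral>\<^sup>+(x::real). ennreal (1 / (1 + x\<^sup>2)) \<partial>lborel) ^ CARD('n)"
    by (rule nn_integral_prod_cart) simp
  also have "\<dots> < \<infinity>" using fin by (simp add: power_less_top_ennreal)
  finally show "(\<integral>\<^sup>+(x::real^'n). ennreal (norm (1 / weight x)) \<partial>lborel) < \<infinity>" .
qed simp

text \<open>This is \<open>weight_add\<close> for y = (y - x) + x. For fixed x it replaces a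
  majorant in x - y by one in y, which is what convolution integrals need.\<close>

lemma inv_weight_shift:
  "1 / weight (x - y :: real^'n::finite) \<le> 2 ^ CARD('n) * weight x / weight y"
proof -
  have "weight (y - x + x) \<le> 2 ^ CARD('n) * weight (y - x) * weight x" by (rule weight_add)
  then have "weight y \<le> 2 ^ CARD('n) * weight (x - y) * weight x"
    using weight_uminus[of "x - y"] by simp
  then show ?thesis by (simp add: divide_simps) (simp add: mult_ac)
qed

text \<open>Steps of length at most 1 along an axis cost a fixed factor, so one majorant serves all
  difference quotients.\<close>

lemma inv_weight_axis:
  assumes "\<bar>s\<bar> \<le> 1"
  shows "1 / weight (z + s *\<^sub>R axis k 1 :: real^'n::finite) \<le> 2 * 2 ^ CARD('n) / weight z"
proof -
  have "1 / weight (s *\<^sub>R axis k 1 - (- z)) \<le> 2 ^ CARD('n) * weight (s *\<^sub>R axis k 1 :: real^'n) / weight (- z)"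
    by (rule inv_weight_shift)
  also have "\<dots> = 2 ^ CARD('n) * (1 + s\<^sup>2) / weight z" by (simp add: weight_axis)
  also have "\<dots> \<le> 2 ^ CARD('n) * 2 / weight z"
    using assms by (intro divide_right_mono mult_left_mono) (auto simp: abs_square_le_1)
  finally show ?thesis by (simp add: add.commute mult.commute)
qed

section \<open>Affine changes of variables\<close>

lemma nn_integral_affine:
  fixes f :: "'a::euclidean_space \<Rightarrow> ennreal"
  assumes [measurable]: "f \<in> borel_measurable borel" and "c \<noteq> 0"
  shows "(\<integral>\<^sup>+x. f x \<partial>lborel) = ennreal (\<bar>c\<bar> ^ DIM('a)) * (\<integral>\<^sup>+x. f (t + c *\<^sub>R x) \<partial>lborel)"
  by (subst lborel_affine[OF \<open>c \<noteq> 0\<close>, of t])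
     (simp add: nn_integral_density nn_integral_distr nn_integral_cmult)

lemma nn_integral_reflect:
  fixes f :: "'a::euclidean_space \<Rightarrow> ennreal"
  assumes [measurable]: "f \<in> borel_measurable borel"
  shows "(\<integral>\<^sup>+x. f (t - x) \<partial>lborel) = (\<integral>\<^sup>+x. f x \<partial>lborel)"
  using nn_integral_affine[of f "-1" t] by simp

lemma nn_integral_shift:
  fixes f :: "'a::euclidean_space \<Rightarrow> ennreal"
  assumes [measurable]: "f \<in> borel_measurable borel"
  shows "(\<integral>\<^sup>+x. f (x - t) \<partial>lborel) = (\<integral>\<^sup>+x. f x \<partial>lborel)"
  using nn_integral_affine[of f 1 "-t"] by simp

lemma integral_affine:
  fixes f :: "'a::euclidean_space \<Rightarrow> 'b::{banach,second_countable_topology}"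
  assumes [measurable]: "f \<in> borel_measurable borel" and "c \<noteq> 0"
  shows "(LINT x|lborel. f x) = (\<bar>c\<bar> ^ DIM('a)) *\<^sub>R (LINT x|lborel. f (t + c *\<^sub>R x))"
  by (subst lborel_affine[OF \<open>c \<noteq> 0\<close>, of t])
     (simp add: integral_density integral_distr)

lemma integrable_affine:
  fixes f :: "'a::euclidean_space \<Rightarrow> 'b::{banach,second_countable_topology}"
  assumes f: "integrable lborel f" and "c \<noteq> 0"
  shows "integrable lborel (\<lambda>x. f (t + c *\<^sub>R x))"
proof (rule integrableI_bounded)
  have [measurable]: "f \<in> borel_measurable borel" using f by auto
  show "(\<lambda>x. f (t + c *\<^sub>R x)) \<in> borel_measurable lborel" by simp
  have "ennreal (\<bar>c\<bar> ^ DIM('a)) * (\<integral>\<^sup>+x. norm (f (t + c *\<^sub>R x)) \<partial>lborel) = (\<integral>\<^sup>+x. norm (f x) \<partial>lborel)"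
    by (subst nn_integral_affine[of "\<lambda>x. norm (f x)" c t]) (use assms in auto)
  also have "\<dots> < \<infinity>" using f by (simp add: integrable_iff_bounded)
  finally show "(\<integral>\<^sup>+x. norm (f (t + c *\<^sub>R x)) \<partial>lborel) < \<infinity>"
    using \<open>c \<noteq> 0\<close> by (auto simp: ennreal_mult_less_top)
qed

text \<open>Dominated convergence along sequences. The majorant may depend on the point
  \<open>x0\<close> and has to hold only near it.\<close>

lemma continuous_integral:
  fixes F :: "'a::metric_space \<Rightarrow> 'b::euclidean_space \<Rightarrow> complex"
  assumes "\<And>x. F x \<in> borel_measurable lborel"
    and "\<And>y. continuous_on UNIV (\<lambda>x. F x y)"
    and "\<And>x0. \<exists>w d. d > 0 \<and> integrable lborel w \<and> (\<forall>x y. dist x x0 < d \<longrightarrow> norm (F x y) \<le> w y)"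
  shows "continuous_on UNIV (\<lambda>x. LINT y|lborel. F x y)"
proof -
  have "isCont (\<lambda>x. LINT y|lborel. F x y) x0" for x0
    unfolding continuous_at_sequentially comp_def
  proof (intro allI impI)
    fix X :: "nat \<Rightarrow> 'a" assume X: "X \<longlonglongrightarrow> x0"
    obtain w d where wd: "d > 0" "integrable lborel w" "\<And>x y. dist x x0 < d \<Longrightarrow> norm (F x y) \<le> w y"
      using assms(3)[of x0] by blast
    from X \<open>d > 0\<close> obtain N where N: "\<And>n. n \<ge> N \<Longrightarrow> dist (X n) x0 < d"
      unfolding lim_sequentially by blast
    \<comment> \<open>Shifting by N discards the terms that still lie outside the ball on which
      \<open>w\<close> dominates.\<close>
    have "(\<lambda>n. LINT y|lborel. F (X (n + N)) y) \<longlonglongrightarrow> (LINT y|lborel. F x0 y)"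
    proof (rule integral_dominated_convergence[OF _ _ wd(2)])
      show "AE y in lborel. (\<lambda>n. F (X (n + N)) y) \<longlonglongrightarrow> F x0 y"
      proof (rule AE_I2)
        fix y
        have "isCont (\<lambda>x. F x y) x0"
          using assms(2)[of y] by (simp add: continuous_on_eq_continuous_at)
        then show "(\<lambda>n. F (X (n + N)) y) \<longlonglongrightarrow> F x0 y"
          by (rule isCont_tendsto_compose) (rule LIMSEQ_ignore_initial_segment[OF X])
      qed
      show "AE y in lborel. norm (F (X (n + N)) y) \<le> w y" for n
        using wd(3) N by auto
    qed (use assms(1) in auto)
    then show "(\<lambda>n. LINT y|lborel. F (X n) y) \<longlonglongrightarrow> (LINT y|lborel. F x0 y)"
      by (rule LIMSEQ_offset)
  qed
  then show ?thesis by (simp add: continuous_on_eq_continuous_at)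
qed

lemma vector_derivative_bound:
  fixes f :: "real \<Rightarrow> 'b::real_normed_vector"
  assumes "\<And>s. (f has_vector_derivative f' s) (at s)"
    and "\<And>s. s \<in> closed_segment a b \<Longrightarrow> norm (f' s) \<le> B"
  shows "norm (f b - f a) \<le> B * \<bar>b - a\<bar>"
proof -
  have "norm (f b - f a) \<le> B * norm (b - a)"
  proof (rule differentiable_bound[where S = "closed_segment a b" and f' = "\<lambda>s h. h *\<^sub>R f' s"])
    show "(f has_derivative (\<lambda>h. h *\<^sub>R f' s)) (at s within closed_segment a b)" for s
      using assms(1)[of s] has_derivative_at_withinI unfolding has_vector_derivative_def by blast
    show "onorm (\<lambda>h. h *\<^sub>R f' s) \<le> B" if "s \<in> closed_segment a b" for s
      using assms(2)[OF that] by (intro onorm_le) (metis abs_ge_zero mult.commute mult_right_mono norm_scaleR real_norm_def)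
  qed auto
  then show ?thesis by simp
qed

lemma has_vector_derivative_at_0_iff:
  fixes f :: "real \<Rightarrow> 'b::real_normed_vector"
  shows "(f has_vector_derivative d) (at 0) \<longleftrightarrow> ((\<lambda>h. (1 / h) *\<^sub>R (f h - f 0)) \<longlongrightarrow> d) (at 0)"
proof -
  have "(f has_vector_derivative d) (at 0) \<longleftrightarrow> ((\<lambda>h. norm (f h - f 0 - h *\<^sub>R d) / norm h) \<longlongrightarrow> 0) (at 0)"
    unfolding has_vector_derivative_def has_derivative_iff_norm
    by (simp add: bounded_linear_scaleR_left)
  also have "\<dots> \<longleftrightarrow> ((\<lambda>h. norm ((1 / h) *\<^sub>R (f h - f 0) - d)) \<longlongrightarrow> 0) (at 0)"
  proof (rule filterlim_cong[OF refl refl], unfold eventually_at_filter, rule always_eventually, intro allI impI)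
    fix h :: real assume "h \<noteq> 0"
    then have "(1 / h) *\<^sub>R (f h - f 0) - d = (1 / h) *\<^sub>R (f h - f 0 - h *\<^sub>R d)"
      by (simp add: scaleR_diff_right)
    then show "norm (f h - f 0 - h *\<^sub>R d) / norm h = norm ((1 / h) *\<^sub>R (f h - f 0) - d)"
      by (simp add: divide_inverse mult.commute)
  qed
  also have "\<dots> \<longleftrightarrow> ((\<lambda>h. (1 / h) *\<^sub>R (f h - f 0)) \<longlongrightarrow> d) (at 0)"
    by (simp only: tendsto_norm_zero_iff LIM_zero_iff)
  finally show ?thesis .
qed

text \<open>The mean value inequality bounds the difference quotients, so a majorant of the
  derivative for |s| <= 1 suffices for dominated convergence. A conclusion at 0 is enough, since
  \<open>has_partial\<close> asks for nothing else at each base point.\<close>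

lemma has_vector_derivative_integral:
  fixes F :: "real \<Rightarrow> 'b::euclidean_space \<Rightarrow> complex"
  assumes F: "\<And>s. F s \<in> borel_measurable lborel" and F': "F' 0 \<in> borel_measurable lborel"
    and int: "\<And>s. integrable lborel (F s)"
    and D: "\<And>s y. ((\<lambda>s. F s y) has_vector_derivative F' s y) (at s)"
    and w: "integrable lborel w" and bd: "\<And>s y. \<bar>s\<bar> \<le> 1 \<Longrightarrow> norm (F' s y) \<le> w y"
  shows "((\<lambda>s. LINT y|lborel. F s y) has_vector_derivative (LINT y|lborel. F' 0 y)) (at 0)"
proof -
  have "((\<lambda>h. (1 / h) *\<^sub>R ((LINT y|lborel. F h y) - (LINT y|lborel. F 0 y))) \<longlongrightarrow> (LINT y|lborel. F' 0 y)) (at 0)"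
    unfolding tendsto_at_iff_sequentially comp_def
  proof (intro allI impI)
    fix X :: "nat \<Rightarrow> real" assume X0: "\<forall>i. X i \<in> UNIV - {0}" and X: "X \<longlonglongrightarrow> 0"
    from X obtain N where N: "\<And>n. n \<ge> N \<Longrightarrow> dist (X n) 0 < 1"
      unfolding lim_sequentially using zero_less_one by blast
    have "(\<lambda>n. LINT y|lborel. (1 / X (n + N)) *\<^sub>R (F (X (n + N)) y - F 0 y)) \<longlonglongrightarrow> (LINT y|lborel. F' 0 y)"
    proof (rule integral_dominated_convergence[OF _ _ w])
      show "AE y in lborel. (\<lambda>n. (1 / X (n + N)) *\<^sub>R (F (X (n + N)) y - F 0 y)) \<longlonglongrightarrow> F' 0 y"
      proof (rule AE_I2)
        fix y
        have "((\<lambda>h. (1 / h) *\<^sub>R (F h y - F 0 y)) \<longlongrightarrow> F' 0 y) (at 0)"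
          using D[of y 0] by (simp add: has_vector_derivative_at_0_iff)
        then show "(\<lambda>n. (1 / X (n + N)) *\<^sub>R (F (X (n + N)) y - F 0 y)) \<longlonglongrightarrow> F' 0 y"
          unfolding tendsto_at_iff_sequentially comp_def
          by (rule spec[where x="\<lambda>n. X (n + N)", THEN mp, THEN mp])
             (use X0 LIMSEQ_ignore_initial_segment[OF X, of N] in auto)
      qed
      show "AE y in lborel. norm ((1 / X (n + N)) *\<^sub>R (F (X (n + N)) y - F 0 y)) \<le> w y" for n
      proof (rule AE_I2)
        fix y
        have n: "\<bar>X (n + N)\<bar> < 1" using N[of "n + N"] by simp
        have "norm (F (X (n + N)) y - F 0 y) \<le> w y * \<bar>X (n + N) - 0\<bar>"
          by (rule vector_derivative_bound[OF D])
             (use n in \<open>auto intro!: bd simp: closed_segment_eq_real_ivl split: if_splits\<close>)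
        then show "norm ((1 / X (n + N)) *\<^sub>R (F (X (n + N)) y - F 0 y)) \<le> w y"
          using X0 by (simp add: divide_simps mult_ac)
      qed
    qed (use F F' in auto)
    then have "(\<lambda>n. LINT y|lborel. (1 / X n) *\<^sub>R (F (X n) y - F 0 y)) \<longlonglongrightarrow> (LINT y|lborel. F' 0 y)"
      by (rule LIMSEQ_offset)
    then show "(\<lambda>n. (1 / X n) *\<^sub>R ((LINT y|lborel. F (X n) y) - (LINT y|lborel. F 0 y))) \<longlonglongrightarrow> (LINT y|lborel. F' 0 y)"
      by (simp add: int)
  qed
  then show ?thesis by (simp add: has_vector_derivative_at_0_iff)
qed

section \<open>Schwartz functions and their inverse Fourier transforms\<close>

text \<open>The relational form of \<open>partial\<close>. It asserts that the derivative exists,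
  whereas \<open>vector_derivative\<close> has some value even where it does not.\<close>

definition has_partial :: "'n::finite \<Rightarrow> (real^'n \<Rightarrow> 'a::real_normed_vector) \<Rightarrow> (real^'n \<Rightarrow> 'a) \<Rightarrow> bool" where
  "has_partial k u v \<longleftrightarrow> (\<forall>x. ((\<lambda>s. u (x + s *\<^sub>R axis k 1)) has_vector_derivative v x) (at 0))"

lemma has_partial_at:
  assumes "has_partial k u v"
  shows "((\<lambda>s. u (x + s *\<^sub>R axis k 1)) has_vector_derivative v (x + s *\<^sub>R axis k 1)) (at s)"
proof -
  have "((\<lambda>r. u ((x + s *\<^sub>R axis k 1) + r *\<^sub>R axis k 1)) has_vector_derivative v (x + s *\<^sub>R axis k 1)) (at (s - s))"
    using assms unfolding has_partial_def by simp
  then have "(((\<lambda>r. u ((x + s *\<^sub>R axis k 1) + r *\<^sub>R axis k 1)) \<circ> (\<lambda>r. r - s)) has_vector_derivative (1 *\<^sub>R v (x + s *\<^sub>R axis k 1))) (at s)"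
    by (intro vector_diff_chain_at) (auto intro!: derivative_eq_intros)
  then show ?thesis by (simp add: comp_def algebra_simps)
qed

lemma has_partial_imp_partial: "has_partial k u v \<Longrightarrow> partial k u = v"
  unfolding has_partial_def partial_def by (intro ext) (auto intro: vector_derivative_at)

lemma has_partial_add: "has_partial k u v \<Longrightarrow> has_partial k u' v' \<Longrightarrow> has_partial k (\<lambda>x. u x + u' x) (\<lambda>x. v x + v' x)"
  unfolding has_partial_def by (auto intro!: has_vector_derivative_add)

lemma has_partial_mult:
  fixes u :: "real^'n::finite \<Rightarrow> 'a::real_normed_algebra"
  assumes "has_partial k u v" "has_partial k u' v'"
  shows "has_partial k (\<lambda>x. u x * u' x) (\<lambda>x. u x * v' x + v x * u' x)"
  unfolding has_partial_def
proof
  fix x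
  show "((\<lambda>s. u (x + s *\<^sub>R axis k 1) * u' (x + s *\<^sub>R axis k 1)) has_vector_derivative u x * v' x + v x * u' x) (at 0)"
    using has_vector_derivative_mult[of "\<lambda>s. u (x + s *\<^sub>R axis k 1)" "v x" 0 UNIV "\<lambda>s. u' (x + s *\<^sub>R axis k 1)" "v' x"]
      assms unfolding has_partial_def by auto
qed

lemma has_partial_const: "has_partial k (\<lambda>x. c) (\<lambda>x. 0)"
  unfolding has_partial_def by auto

lemma has_partial_cmult:
  fixes u :: "real^'n::finite \<Rightarrow> 'a::real_normed_algebra"
  shows "has_partial k u v \<Longrightarrow> has_partial k (\<lambda>x. c * u x) (\<lambda>x. c * v x)"
  using has_partial_mult[OF has_partial_const, of k u v c] by simp

lemma has_partial_sum: "(\<And>i. i \<in> I \<Longrightarrow> has_partial k (u i) (v i)) \<Longrightarrow>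
    has_partial k (\<lambda>x. \<Sum>i\<in>I. u i x) (\<lambda>x. \<Sum>i\<in>I. v i x)"
  unfolding has_partial_def by (auto intro!: has_vector_derivative_sum)

lemma has_partial_linear:
  "bounded_linear L \<Longrightarrow> has_partial k u v \<Longrightarrow> has_partial k (\<lambda>x. L (u x)) (\<lambda>x. L (v x))"
  unfolding has_partial_def by (auto intro: bounded_linear.has_vector_derivative)

lemma has_partial_coord: "has_partial l (\<lambda>x. complex_of_real (x$k)) (\<lambda>x. if k = l then 1 else 0)"
proof -
  have "((\<lambda>s. complex_of_real ((x + s *\<^sub>R axis l 1)$k)) has_vector_derivative of_real (0 + 1 * axis l 1 $ k)) (at 0)" for x
    by (intro bounded_linear.has_vector_derivative[OF bounded_linear_of_real])
       (auto intro!: derivative_eq_intros simp: has_real_derivative_iff_has_vector_derivative[symmetric])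
  then show ?thesis unfolding has_partial_def by (auto simp: axis_def)
qed

lemma has_partial_affine:
  assumes "has_partial k u v"
  shows "has_partial k (\<lambda>y. u (x + r *\<^sub>R y)) (\<lambda>y. r *\<^sub>R v (x + r *\<^sub>R y))"
  unfolding has_partial_def
proof
  fix y
  have "((\<lambda>s. u ((x + r *\<^sub>R y) + s *\<^sub>R axis k 1)) has_vector_derivative v (x + r *\<^sub>R y)) (at (r * 0))"
    using assms unfolding has_partial_def by simp
  then have "(((\<lambda>s. u ((x + r *\<^sub>R y) + s *\<^sub>R axis k 1)) \<circ> (\<lambda>s. r * s)) has_vector_derivative (r *\<^sub>R v (x + r *\<^sub>R y))) (at 0)"
    by (intro vector_diff_chain_at) (auto intro!: derivative_eq_intros simp: has_real_derivative_iff_has_vector_derivative[symmetric])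
  then show "((\<lambda>s. u (x + r *\<^sub>R (y + s *\<^sub>R axis k 1))) has_vector_derivative r *\<^sub>R v (x + r *\<^sub>R y)) (at 0)"
    by (simp add: comp_def scaleR_add_right add.assoc)
qed

text \<open>Decay of the function alone; \<open>schwartz\<close> adds the derivatives by
  coinduction.\<close>

definition rapid :: "(real^'n::finite \<Rightarrow> complex) \<Rightarrow> bool" where
  "rapid u \<longleftrightarrow> continuous_on UNIV u \<and> (\<forall>n. \<exists>C. \<forall>x. norm x ^ n * norm (u x) \<le> C)"

lemma rapid_continuous: "rapid u \<Longrightarrow> continuous_on A u"
  unfolding rapid_def using continuous_on_subset by blast

lemma rapid_measurable: "rapid u \<Longrightarrow> u \<in> borel_measurable borel"
  by (intro borel_measurable_continuous_onI rapid_continuous)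

lemma rapid_bound: "rapid u \<Longrightarrow> \<exists>C>0. \<forall>x. norm x ^ n * norm (u x) \<le> C"
  unfolding rapid_def by (meson dual_order.trans gt_ex less_imp_le max.cobounded1 max_less_iff_conj linorder_le_less_linear)

lemma rapid_cmult: assumes "rapid u" shows "rapid (\<lambda>x. c * u x)"
  unfolding rapid_def
proof safe
  show "continuous_on UNIV (\<lambda>x. c * u x)" using assms by (intro continuous_intros rapid_continuous)
  fix n
  obtain C where C: "\<And>x. norm x ^ n * norm (u x) \<le> C" using assms unfolding rapid_def by blast
  have "norm x ^ n * norm (c * u x) \<le> norm c * C" for x
    using mult_left_mono[OF C[of x], of "norm c"] by (simp add: norm_mult mult_ac)
  then show "\<exists>C. \<forall>x. norm x ^ n * norm (c * u x) \<le> C" by blast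
qed

lemma rapid_add: assumes "rapid u" "rapid v" shows "rapid (\<lambda>x. u x + v x)"
  unfolding rapid_def
proof safe
  show "continuous_on UNIV (\<lambda>x. u x + v x)" using assms by (intro continuous_intros rapid_continuous)
  fix n
  obtain C where C: "\<And>x. norm x ^ n * norm (u x) \<le> C" using assms unfolding rapid_def by blast
  obtain D where D: "\<And>x. norm x ^ n * norm (v x) \<le> D" using assms unfolding rapid_def by blast
  have "norm x ^ n * norm (u x + v x) \<le> C + D" for x
  proof -
    have "norm x ^ n * norm (u x + v x) \<le> norm x ^ n * (norm (u x) + norm (v x))"
      by (intro mult_left_mono norm_triangle_ineq) auto
    then show ?thesis using C[of x] D[of x] by (simp add: distrib_left)
  qed
  then show "\<exists>C. \<forall>x. norm x ^ n * norm (u x + v x) \<le> C" by blast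
qed

lemma rapid_mult: assumes "rapid u" "rapid v" shows "rapid (\<lambda>x. u x * v x)"
  unfolding rapid_def
proof safe
  show "continuous_on UNIV (\<lambda>x. u x * v x)" using assms by (intro continuous_intros rapid_continuous)
  fix n
  obtain C where C: "\<And>x. norm x ^ n * norm (u x) \<le> C" using assms unfolding rapid_def by blast
  obtain D where D: "\<And>x. norm x ^ 0 * norm (v x) \<le> D" using assms unfolding rapid_def by blast
  have "norm x ^ n * norm (u x * v x) \<le> C * D" for x
  proof -
    have "norm x ^ n * norm (u x * v x) = (norm x ^ n * norm (u x)) * norm (v x)"
      by (simp add: norm_mult)
    also have "\<dots> \<le> C * D"
      using C[of x] D[of x] order_trans[OF _ C[of x], of 0] by (intro mult_mono) auto
    finally show ?thesis .
  qed
  then show "\<exists>C. \<forall>x. norm x ^ n * norm (u x * v x) \<le> C" by blast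
qed

lemma rapid_coord: assumes "rapid u" shows "rapid (\<lambda>x. complex_of_real (x$k) * u x)"
  unfolding rapid_def
proof safe
  show "continuous_on UNIV (\<lambda>x. complex_of_real (x$k) * u x)"
    using assms by (intro continuous_intros rapid_continuous)
  fix n
  obtain C where C: "\<And>x. norm x ^ Suc n * norm (u x) \<le> C" using assms unfolding rapid_def by blast
  have "norm x ^ n * norm (complex_of_real (x$k) * u x) \<le> C" for x
  proof -
    have "norm x ^ n * norm (complex_of_real (x$k) * u x) = norm x ^ n * (\<bar>x$k\<bar> * norm (u x))"
      by (simp add: norm_mult)
    also have "\<dots> \<le> norm x ^ n * (norm x * norm (u x))"
      by (intro mult_left_mono mult_right_mono component_le_norm_cart) auto
    also have "\<dots> \<le> C" using C[of x] by (simp add: mult_ac)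
    finally show ?thesis .
  qed
  then show "\<exists>C. \<forall>x. norm x ^ n * norm (complex_of_real (x$k) * u x) \<le> C" by blast
qed

lemma power_add_le: "0 \<le> a \<Longrightarrow> 0 \<le> b \<Longrightarrow> (a + b) ^ n \<le> 2 ^ n * (a ^ n + b ^ n)" for a b :: real
proof -
  assume ab: "0 \<le> a" "0 \<le> b"
  have "(a + b) ^ n \<le> (2 * max a b) ^ n" using ab by (intro power_mono) auto
  also have "\<dots> = 2 ^ n * max a b ^ n" by (simp add: power_mult_distrib)
  also have "max a b ^ n \<le> a ^ n + b ^ n" using ab by (auto simp: max_def)
  finally show ?thesis by simp
qed

lemma rapid_affine: assumes "rapid u" "r \<noteq> 0" shows "rapid (\<lambda>y. u (x + r *\<^sub>R y))"
  unfolding rapid_def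
proof safe
  show "continuous_on UNIV (\<lambda>y. u (x + r *\<^sub>R y))"
    using assms by (intro continuous_on_compose2[OF rapid_continuous[of u UNIV]] continuous_intros) auto
  fix n
  obtain C where C: "\<And>x. norm x ^ n * norm (u x) \<le> C" using assms unfolding rapid_def by blast
  obtain D where D: "\<And>x. norm x ^ 0 * norm (u x) \<le> D" using assms unfolding rapid_def by blast
  have "norm y ^ n * norm (u (x + r *\<^sub>R y)) \<le> (2 / \<bar>r\<bar>) ^ n * (C + norm x ^ n * D)" for y
  proof -
    let ?z = "x + r *\<^sub>R y"
    have "norm (r *\<^sub>R y) \<le> norm ?z + norm x" using norm_triangle_ineq4[of ?z x] by simp
    then have "norm y \<le> (norm ?z + norm x) / \<bar>r\<bar>" using \<open>r \<noteq> 0\<close> by (simp add: field_simps)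
    then have "norm y ^ n \<le> ((norm ?z + norm x) / \<bar>r\<bar>) ^ n" by (intro power_mono) auto
    also have "\<dots> \<le> (2 / \<bar>r\<bar>) ^ n * (norm ?z ^ n + norm x ^ n)"
      using power_add_le[of "norm ?z" "norm x" n] by (simp add: power_divide divide_right_mono)
    finally have "norm y ^ n * norm (u ?z) \<le> (2 / \<bar>r\<bar>) ^ n * (norm ?z ^ n + norm x ^ n) * norm (u ?z)"
      by (intro mult_right_mono) auto
    also have "\<dots> = (2 / \<bar>r\<bar>) ^ n * (norm ?z ^ n * norm (u ?z) + norm x ^ n * norm (u ?z))"
      by (simp add: algebra_simps)
    also have "\<dots> \<le> (2 / \<bar>r\<bar>) ^ n * (C + norm x ^ n * D)"
      using C[of ?z] D[of ?z] by (intro mult_left_mono add_mono) auto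
    finally show ?thesis .
  qed
  then show "\<exists>C. \<forall>y. norm y ^ n * norm (u (x + r *\<^sub>R y)) \<le> C" by blast
qed

text \<open>\<open>weight\<close> grows at most like 1 + |x|^(2 N) with N the dimension, so the
  decay estimates of orders 0 and 2 N together give the bound.\<close>

lemma rapid_le_weight:
  fixes u :: "real^'n::finite \<Rightarrow> complex"
  assumes "rapid u" shows "\<exists>C>0. \<forall>x. norm (u x) \<le> C / weight x"
proof -
  let ?N = "CARD('n)"
  obtain C where C: "C > 0" "\<And>x. norm x ^ (2 * ?N) * norm (u x) \<le> C" using rapid_bound[OF assms] by blast
  obtain D where D: "D > 0" "\<And>x. norm x ^ 0 * norm (u x) \<le> D" using rapid_bound[OF assms] by blast
  have "norm (u x) \<le> (2 ^ ?N * (D + C)) / weight x" for x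
  proof -
    have "weight x \<le> (1 + (norm x)\<^sup>2) ^ ?N" by (rule weight_le_norm)
    also have "\<dots> \<le> 2 ^ ?N * (1 ^ ?N + ((norm x)\<^sup>2) ^ ?N)" by (rule power_add_le) auto
    finally have "weight x * norm (u x) \<le> 2 ^ ?N * (1 ^ ?N + ((norm x)\<^sup>2) ^ ?N) * norm (u x)"
      by (intro mult_right_mono) auto
    also have "\<dots> = 2 ^ ?N * (norm (u x) + norm x ^ (2 * ?N) * norm (u x))"
      by (simp add: power_mult[symmetric] algebra_simps)
    also have "\<dots> \<le> 2 ^ ?N * (D + C)"
      using C(2)[of x] D(2)[of x] by (intro mult_left_mono add_mono) auto
    finally show ?thesis by (simp add: pos_le_divide_eq mult.commute)
  qed
  moreover have "2 ^ ?N * (D + C) > 0" using C D by simp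
  ultimately show ?thesis by blast
qed

lemma integrable_weight_bound:
  fixes u :: "real^'n::finite \<Rightarrow> 'a::{banach,second_countable_topology}"
  assumes "u \<in> borel_measurable borel" "\<And>x. norm (u x) \<le> C / weight x"
  shows "integrable lborel u"
proof (rule Bochner_Integration.integrable_bound)
  show "integrable lborel (\<lambda>x::real^'n. C * (1 / weight x))" by (intro integrable_mult_right integrable_inv_weight)
  show "AE x in lborel. norm (u x) \<le> norm (C * (1 / weight x))"
    using assms(2) by (auto intro!: AE_I2 order_trans[OF assms(2)] divide_right_mono)
qed (use assms in auto)

lemma rapid_integrable: "rapid u \<Longrightarrow> integrable lborel u"
  using rapid_le_weight[of u] integrable_weight_bound[of u] rapid_measurable[of u] by blast

text \<open>The Schwartz class as the largest class of rapidly decreasing functions closed under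
  partial derivatives. As a greatest fixed point it needs neither multi-indices nor a rule for mixed
  derivatives: membership is shown by exhibiting an invariant family.\<close>

coinductive schwartz :: "(real^'n::finite \<Rightarrow> complex) \<Rightarrow> bool" where
  schwartzI: "rapid u \<Longrightarrow> (\<And>k. \<exists>v. has_partial k u v \<and> schwartz v) \<Longrightarrow> schwartz u"

lemma schwartz_rapid: "schwartz u \<Longrightarrow> rapid u"
  by (erule schwartz.cases) auto

lemma schwartz_has_partial: "schwartz u \<Longrightarrow> has_partial k u (partial k u)"
  by (erule schwartz.cases) (metis has_partial_imp_partial)

lemma schwartz_partial: "schwartz u \<Longrightarrow> schwartz (partial k u)"
  by (erule schwartz.cases) (metis has_partial_imp_partial)

lemma schwartz_closedI:
  assumes "X u" "\<And>u. X u \<Longrightarrow> rapid u" "\<And>u k. X u \<Longrightarrow> \<exists>v. has_partial k u v \<and> X v"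
  shows "schwartz u"
  by (rule schwartz.coinduct[where X = X]) (use assms in blast)+

lemmas schwartz_integrable = rapid_integrable[OF schwartz_rapid]
  and schwartz_le_weight = rapid_le_weight[OF schwartz_rapid]
  and schwartz_continuous = rapid_continuous[OF schwartz_rapid]
  and schwartz_measurable = rapid_measurable[OF schwartz_rapid]

text \<open>Coinduction up to sums of products: such sums are closed under partial derivatives.\<close>

inductive schwartz_alg :: "(real^'n::finite \<Rightarrow> complex) \<Rightarrow> bool" where
  base: "schwartz u \<Longrightarrow> schwartz_alg u"
| mult: "schwartz u \<Longrightarrow> schwartz v \<Longrightarrow> schwartz_alg (\<lambda>x. u x * v x)"
| cmult: "schwartz_alg u \<Longrightarrow> schwartz_alg (\<lambda>x. c * u x)"
| coord: "schwartz_alg u \<Longrightarrow> schwartz_alg (\<lambda>x. complex_of_real (x$k) * u x)"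
| add: "schwartz_alg u \<Longrightarrow> schwartz_alg v \<Longrightarrow> schwartz_alg (\<lambda>x. u x + v x)"

lemma schwartz_alg_schwartz: "schwartz_alg u \<Longrightarrow> schwartz u"
proof (erule schwartz_closedI)
  show "rapid u" if "schwartz_alg u" for u :: "real^'a \<Rightarrow> complex" using that
    by induction (auto intro: schwartz_rapid rapid_mult rapid_cmult rapid_coord rapid_add)
  show "\<exists>v. has_partial k u v \<and> schwartz_alg v" if "schwartz_alg u" for u :: "real^'a \<Rightarrow> complex" and k using that
  proof induction
      case (base u)
      then show ?case using schwartz_has_partial schwartz_partial schwartz_alg.base by blast
    next
      case (mult u v)
      have "schwartz_alg (\<lambda>x. u x * partial k v x + partial k u x * v x)"
        by (intro schwartz_alg.intros schwartz_partial mult)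
      then show ?case using has_partial_mult[OF mult[THEN schwartz_has_partial]] by blast
    next
      case (cmult u c)
      then show ?case using has_partial_cmult schwartz_alg.cmult by blast
    next
      case (add u v)
      then show ?case using has_partial_add schwartz_alg.add by blast
    next
      case (coord u l)
      then obtain v where v: "has_partial k u v" "schwartz_alg v" by blast
      have "schwartz_alg (\<lambda>x. complex_of_real (x$l) * v x + (if l = k then 1 else 0) * u x)"
        by (intro schwartz_alg.intros v coord)
      then show ?case using has_partial_mult[OF has_partial_coord v(1)] by blast
  qed
qed

lemma schwartz_mult: "schwartz u \<Longrightarrow> schwartz v \<Longrightarrow> schwartz (\<lambda>x. u x * v x)"
  by (rule schwartz_alg_schwartz[OF schwartz_alg.mult])

lemma schwartz_cmult: "schwartz u \<Longrightarrow> schwartz (\<lambda>x. c * u x)"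
  by (rule schwartz_alg_schwartz[OF schwartz_alg.cmult[OF schwartz_alg.base]])

lemma schwartz_coord: "schwartz u \<Longrightarrow> schwartz (\<lambda>x. complex_of_real (x$k) * u x)"
  by (rule schwartz_alg_schwartz[OF schwartz_alg.coord[OF schwartz_alg.base]])

lemma schwartz_add: "schwartz u \<Longrightarrow> schwartz v \<Longrightarrow> schwartz (\<lambda>x. u x + v x)"
  by (rule schwartz_alg_schwartz[OF schwartz_alg.add[OF schwartz_alg.base schwartz_alg.base]])

lemma schwartz_diff: "schwartz u \<Longrightarrow> schwartz v \<Longrightarrow> schwartz (\<lambda>x. u x - v x)"
  using schwartz_add[OF _ schwartz_cmult[of v "-1"], of u] by simp

lemma rapid_zero: "rapid (\<lambda>x. 0)"
  by (auto simp: rapid_def)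

lemma schwartz_zero: "schwartz (\<lambda>x. 0)"
  by (rule schwartz_closedI[where X = "\<lambda>u. u = (\<lambda>x. 0)"]) (auto intro: rapid_zero has_partial_const)

lemma schwartz_sum: "(\<And>i. i \<in> I \<Longrightarrow> schwartz (u i)) \<Longrightarrow> schwartz (\<lambda>x. \<Sum>i\<in>I. u i x)"
  by (induction I rule: infinite_finite_induct) (auto intro: schwartz_zero schwartz_add)

lemma schwartz_affine:
  assumes "schwartz u" "r \<noteq> 0"
  shows "schwartz (\<lambda>y. u (x + r *\<^sub>R y))"
\<comment> \<open>The scalar c belongs to the invariant because every derivative in y produces a
  factor r.\<close>
proof (rule schwartz_closedI[where X = "\<lambda>w. \<exists>c v. w = (\<lambda>y. c * v (x + r *\<^sub>R y)) \<and> schwartz v"])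
  show "\<exists>c v. (\<lambda>y. u (x + r *\<^sub>R y)) = (\<lambda>y. c * v (x + r *\<^sub>R y)) \<and> schwartz v"
    using assms(1) by (intro exI[of _ 1] exI[of _ u]) auto
  fix w assume "\<exists>c v. w = (\<lambda>y. c * v (x + r *\<^sub>R y)) \<and> schwartz v"
  then obtain c v where v: "w = (\<lambda>y. c * v (x + r *\<^sub>R y))" "schwartz v" by blast
  show "rapid w" unfolding v(1) by (intro rapid_cmult rapid_affine schwartz_rapid v assms)
  fix k
  have "has_partial k w (\<lambda>y. (c * r) * partial k v (x + r *\<^sub>R y))"
    using has_partial_cmult[OF has_partial_affine[OF schwartz_has_partial[OF v(2)]], where c=c]
    unfolding v(1) by (simp add: scaleR_conv_of_real mult.assoc)
  then show "\<exists>v. has_partial k w v \<and> (\<exists>c u. v = (\<lambda>y. c * u (x + r *\<^sub>R y)) \<and> schwartz u)"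
    using schwartz_partial[OF v(2)] by blast
qed

lemma schwartz_scale: "schwartz u \<Longrightarrow> r \<noteq> 0 \<Longrightarrow> schwartz (\<lambda>y. u (r *\<^sub>R y))"
  using schwartz_affine[of u r 0] by simp

section \<open>The inverse Fourier transform on the Schwartz class\<close>

lemma has_partial_cis:
  fixes x :: "real^'n::finite"
  shows "has_partial k (\<lambda>\<xi>. cis (x \<bullet> \<xi>)) (\<lambda>\<xi>. \<i> * of_real (x$k) * cis (x \<bullet> \<xi>))"
  unfolding has_partial_def
proof
  fix \<xi> :: "real^'n"
  have "((\<lambda>s. exp (\<i> * of_real (x \<bullet> \<xi> + s * x$k))) has_vector_derivative \<i> * of_real (x$k) * exp (\<i> * of_real (x \<bullet> \<xi> + 0 * x$k))) (at 0)"
  proof -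
    have "((\<lambda>z. exp (\<i> * (of_real (x \<bullet> \<xi>) + z * of_real (x$k)))) has_field_derivative
         \<i> * of_real (x$k) * exp (\<i> * (of_real (x \<bullet> \<xi>) + of_real 0 * of_real (x$k)))) (at (of_real 0))"
      by (auto intro!: derivative_eq_intros)
    from has_vector_derivative_real_field[OF this] show ?thesis by simp
  qed
  moreover have "x \<bullet> (\<xi> + s *\<^sub>R axis k 1) = x \<bullet> \<xi> + s * x$k" for s
    by (simp add: inner_add_right inner_axis)
  ultimately show "((\<lambda>s. cis (x \<bullet> (\<xi> + s *\<^sub>R axis k 1))) has_vector_derivative \<i> * of_real (x$k) * cis (x \<bullet> \<xi>)) (at 0)"
    by (simp add: cis_conv_exp)
qed

lemma continuous_on_cis_inner [continuous_intros]:
  "continuous_on A f \<Longrightarrow> continuous_on A (\<lambda>y. cis (f y))"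
  unfolding cis_conv_exp by (intro continuous_intros)

lemma rapid_cis: "rapid u \<Longrightarrow> rapid (\<lambda>\<xi>. cis (x \<bullet> \<xi>) * u \<xi>)"
  unfolding rapid_def by (auto intro!: continuous_intros simp: norm_mult)

text \<open>The character \<open>cis\<close> is not a Schwartz function, so
  \<open>schwartz_mult\<close> does not apply. Products with one fixed character form an invariant
  family: a derivative replaces the factor u by \<partial>u + i x$k u.\<close>

lemma schwartz_cis:
  assumes "schwartz u" shows "schwartz (\<lambda>\<xi>. cis (x \<bullet> \<xi>) * u \<xi>)"
proof (rule schwartz_closedI[where X = "\<lambda>v. \<exists>u. v = (\<lambda>\<xi>. cis (x \<bullet> \<xi>) * u \<xi>) \<and> schwartz u"])
  show "\<exists>v. (\<lambda>\<xi>. cis (x \<bullet> \<xi>) * u \<xi>) = (\<lambda>\<xi>. cis (x \<bullet> \<xi>) * v \<xi>) \<and> schwartz v"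
    using assms by (intro exI[of _ u]) auto
  fix v assume "\<exists>u. v = (\<lambda>\<xi>. cis (x \<bullet> \<xi>) * u \<xi>) \<and> schwartz u"
  then obtain u where u: "v = (\<lambda>\<xi>. cis (x \<bullet> \<xi>) * u \<xi>)" "schwartz u" by blast
  show "rapid v" unfolding u(1) by (intro rapid_cis schwartz_rapid u)
  fix k
  have "has_partial k v (\<lambda>\<xi>. cis (x \<bullet> \<xi>) * (partial k u \<xi> + (\<i> * of_real (x$k)) * u \<xi>))"
    using has_partial_mult[OF has_partial_cis schwartz_has_partial[OF u(2)], of k x]
    unfolding u(1) by (simp add: algebra_simps)
  moreover have "schwartz (\<lambda>\<xi>. partial k u \<xi> + (\<i> * of_real (x$k)) * u \<xi>)"
    by (intro schwartz_add schwartz_cmult schwartz_partial u)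
  moreover define w where "w = (\<lambda>\<xi>. partial k u \<xi> + (\<i> * of_real (x$k)) * u \<xi>)"
  ultimately have "has_partial k v (\<lambda>\<xi>. cis (x \<bullet> \<xi>) * w \<xi>)" "schwartz w" by simp_all
  then show "\<exists>w. has_partial k v w \<and> (\<exists>u. w = (\<lambda>\<xi>. cis (x \<bullet> \<xi>) * u \<xi>) \<and> schwartz u)"
    by (intro exI[of _ "\<lambda>\<xi>. cis (x \<bullet> \<xi>) * w \<xi>"] conjI exI[of _ w] refl)
qed

lemma weight_bound_shift_axis:
  assumes "\<And>x. norm (u x) \<le> C / weight x" "C \<ge> 0" "\<bar>s\<bar> \<le> 1"
  shows "norm (u (x + s *\<^sub>R axis k 1 :: real^'n::finite)) \<le> C * (2 * 2 ^ CARD('n)) * (1 / weight x)"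
proof -
  have "norm (u (x + s *\<^sub>R axis k 1)) \<le> C * (1 / weight (x + s *\<^sub>R axis k 1))" using assms(1) by simp
  also have "\<dots> \<le> C * (2 * 2 ^ CARD('n) / weight x)"
    using assms by (intro mult_left_mono inv_weight_axis) auto
  finally show ?thesis by simp
qed

text \<open>By translation invariance the integral of u(x + s e) does not depend on s;
  differentiating it at s = 0 under the integral gives the claim.\<close>

lemma integral_partial_eq_0:
  fixes u :: "real^'n::finite \<Rightarrow> complex"
  assumes "schwartz u" shows "(LINT x|lborel. partial k u x) = 0"
proof -
  obtain C where C: "C > 0" "\<And>x. norm (partial k u x) \<le> C / weight x"
    using schwartz_le_weight[OF schwartz_partial[OF assms]] by blast
  have [measurable]: "u \<in> borel_measurable borel" "partial k u \<in> borel_measurable borel"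
    using assms by (auto intro: schwartz_measurable schwartz_partial)
  have "((\<lambda>s. LINT x|lborel. u (x + s *\<^sub>R axis k 1)) has_vector_derivative
      (LINT x|lborel. partial k u (x + 0 *\<^sub>R axis k 1))) (at 0)"
  proof (rule has_vector_derivative_integral[where w = "\<lambda>x. C * (2 * 2 ^ CARD('n)) * (1 / weight x)"])
    show "integrable lborel (\<lambda>x. u (x + s *\<^sub>R axis k 1))" for s
      using integrable_affine[OF schwartz_integrable[OF assms], of 1 "s *\<^sub>R axis k 1"] by (simp add: add.commute)
    show "integrable lborel (\<lambda>x::real^'n. C * (2 * 2 ^ CARD('n)) * (1 / weight x))"
      by (intro integrable_mult_right integrable_inv_weight)
    show "norm (partial k u (x + s *\<^sub>R axis k 1)) \<le> C * (2 * 2 ^ CARD('n)) * (1 / weight x)" if "\<bar>s\<bar> \<le> 1" for s x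
      by (rule weight_bound_shift_axis[OF C(2)]) (use that C in auto)
    show "((\<lambda>s. u (x + s *\<^sub>R axis k 1)) has_vector_derivative partial k u (x + s *\<^sub>R axis k 1)) (at s)" for s x
      by (rule has_partial_at[OF schwartz_has_partial[OF assms]])
  qed auto
  moreover have "(LINT x|lborel. u (x + s *\<^sub>R axis k 1)) = (LINT x|lborel. u x)" for s
    using integral_affine[of u 1 "s *\<^sub>R axis k 1"] by (simp add: add.commute)
  ultimately have "((\<lambda>s. LINT x|lborel. u x) has_vector_derivative (LINT x|lborel. partial k u x)) (at 0)"
    by simp
  then show ?thesis
    using vector_derivative_unique_at[OF _ has_vector_derivative_const] by blast
qed

text \<open>Integration by parts: the partial derivative of
  \<open>cis (x \<bullet> \<xi>) * m \<xi>\<close> has integral zero.\<close>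

lemma ift_partial:
  assumes "schwartz m" shows "ift (partial k m) x = - \<i> * of_real (x$k) * ift m x"
proof -
  let ?u = "\<lambda>\<xi>. cis (x \<bullet> \<xi>) * m \<xi>"
  have "has_partial k ?u (\<lambda>\<xi>. cis (x \<bullet> \<xi>) * partial k m \<xi> + \<i> * of_real (x$k) * (cis (x \<bullet> \<xi>) * m \<xi>))"
    using has_partial_mult[OF has_partial_cis[of k x] schwartz_has_partial[OF assms]] by (simp add: mult.assoc)
  from has_partial_imp_partial[OF this] integral_partial_eq_0[OF schwartz_cis[OF assms, of x], of k]
  have "(LINT \<xi>|lborel. cis (x \<bullet> \<xi>) * partial k m \<xi> + \<i> * of_real (x$k) * (cis (x \<bullet> \<xi>) * m \<xi>)) = 0"
    by simp
  also have "(LINT \<xi>|lborel. cis (x \<bullet> \<xi>) * partial k m \<xi> + \<i> * of_real (x$k) * (cis (x \<bullet> \<xi>) * m \<xi>))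
     = (LINT \<xi>|lborel. cis (x \<bullet> \<xi>) * partial k m \<xi>) + \<i> * of_real (x$k) * (LINT \<xi>|lborel. cis (x \<bullet> \<xi>) * m \<xi>)"
    by (subst Bochner_Integration.integral_add)
       (auto intro!: schwartz_integrable schwartz_cmult schwartz_cis schwartz_partial assms)
  finally show ?thesis unfolding ift_def by (simp add: algebra_simps add_eq_0_iff)
qed

lemma has_partial_ift:
  fixes m :: "real^'n::finite \<Rightarrow> complex"
  assumes "schwartz m" shows "has_partial k (ift m) (ift (\<lambda>\<xi>. \<i> * of_real (\<xi>$k) * m \<xi>))"
proof -
  have sm: "schwartz (\<lambda>\<xi>. \<i> * of_real (\<xi>$k) * m \<xi>)"
    unfolding mult.assoc by (intro schwartz_cmult schwartz_coord assms)
  then obtain C where C: "C > 0" "\<And>\<xi>. norm (\<i> * of_real (\<xi>$k) * m \<xi>) \<le> C / weight \<xi>"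
    using schwartz_le_weight by blast
  have [measurable]: "m \<in> borel_measurable borel" using assms by (rule schwartz_measurable)
  have "has_partial k (\<lambda>x. LINT \<xi>|lborel. cis (x \<bullet> \<xi>) * m \<xi>)
     (\<lambda>x. LINT \<xi>|lborel. cis (x \<bullet> \<xi>) * (\<i> * of_real (\<xi>$k) * m \<xi>))"
    unfolding has_partial_def
  proof
    fix x
    have "((\<lambda>s. LINT \<xi>|lborel. cis ((x + s *\<^sub>R axis k 1) \<bullet> \<xi>) * m \<xi>) has_vector_derivative
       (LINT \<xi>|lborel. cis ((x + 0 *\<^sub>R axis k 1) \<bullet> \<xi>) * (\<i> * of_real (\<xi>$k) * m \<xi>))) (at 0)"
    proof (rule has_vector_derivative_integral[where w = "\<lambda>\<xi>. C * (1 / weight \<xi>)"])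
      show "integrable lborel (\<lambda>\<xi>. cis ((x + s *\<^sub>R axis k 1) \<bullet> \<xi>) * m \<xi>)" for s
        by (intro schwartz_integrable schwartz_cis assms)
      show "(\<lambda>\<xi>. cis ((x + s *\<^sub>R axis k 1) \<bullet> \<xi>) * m \<xi>) \<in> borel_measurable lborel"
        "(\<lambda>\<xi>. cis ((x + 0 *\<^sub>R axis k 1) \<bullet> \<xi>) * (\<i> * of_real (\<xi>$k) * m \<xi>)) \<in> borel_measurable lborel" for s
        using schwartz_measurable[OF schwartz_cis[OF assms]] schwartz_measurable[OF schwartz_cis[OF sm], of "x + 0 *\<^sub>R axis k 1"]
        by simp_all
      show "integrable lborel (\<lambda>\<xi>::real^'n. C * (1 / weight \<xi>))"
        by (intro integrable_mult_right integrable_inv_weight)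
      show "norm (cis ((x + s *\<^sub>R axis k 1) \<bullet> \<xi>) * (\<i> * of_real (\<xi>$k) * m \<xi>)) \<le> C * (1 / weight \<xi>)" for s \<xi>
        using C(2)[of \<xi>] by (simp add: norm_mult)
      show "((\<lambda>s. cis ((x + s *\<^sub>R axis k 1) \<bullet> \<xi>) * m \<xi>) has_vector_derivative
          cis ((x + s *\<^sub>R axis k 1) \<bullet> \<xi>) * (\<i> * of_real (\<xi>$k) * m \<xi>)) (at s)" for s \<xi>
        using has_vector_derivative_mult_left[OF has_partial_at[OF has_partial_cis[of k \<xi>], of x s], of "m \<xi>"]
        by (simp add: inner_commute mult_ac)
    qed
    then show "((\<lambda>s. LINT \<xi>|lborel. cis ((x + s *\<^sub>R axis k 1) \<bullet> \<xi>) * m \<xi>) has_vector_derivative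
       (LINT \<xi>|lborel. cis (x \<bullet> \<xi>) * (\<i> * of_real (\<xi>$k) * m \<xi>))) (at 0)" by simp
  qed
  then show ?thesis unfolding ift_def[abs_def] by (rule has_partial_cmult)
qed

lemma norm_ift_le:
  fixes m :: "real^'n::finite \<Rightarrow> complex"
  assumes "integrable lborel m"
  shows "norm (ift m x) \<le> (LINT \<xi>|lborel. norm (m \<xi>))"
proof -
  have 1: "norm (LINT \<xi>|lborel. cis (x \<bullet> \<xi>) * m \<xi>) \<le> (LINT \<xi>|lborel. norm (m \<xi>))"
    using integral_norm_bound[of lborel "\<lambda>\<xi>. cis (x \<bullet> \<xi>) * m \<xi>"] by (simp add: norm_mult)
  have "(1::real) \<le> (2 * pi) ^ CARD('n)" using pi_ge_two by (intro one_le_power) auto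
  then have "1 / (2 * pi) ^ CARD('n) * norm (LINT \<xi>|lborel. cis (x \<bullet> \<xi>) * m \<xi>) \<le> 1 * norm (LINT \<xi>|lborel. cis (x \<bullet> \<xi>) * m \<xi>)"
    by (intro mult_right_mono) auto
  with 1 show ?thesis unfolding ift_def by (simp add: norm_mult norm_divide norm_power)
qed

text \<open>The transforms of Schwartz functions form an invariant family. Derivatives of
  \<open>ift m\<close> correspond to coordinate factors on m, and powers of x to derivatives of m,
  so both stay inside the family.\<close>

lemma schwartz_ift:
  fixes m :: "real^'n::finite \<Rightarrow> complex"
  assumes "schwartz m" shows "schwartz (ift m)"
proof (rule schwartz_closedI[where X = "\<lambda>u. \<exists>m. u = ift m \<and> schwartz m"])
  show "\<exists>m'. ift m = ift m' \<and> schwartz m'" using assms by blast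
  fix u :: "real^'n \<Rightarrow> complex" assume "\<exists>m. u = ift m \<and> schwartz m"
  then obtain m where m: "u = ift m" "schwartz m" by blast
  obtain C where C: "C > 0" "\<And>\<xi>. norm (m \<xi>) \<le> C / weight \<xi>"
    using schwartz_le_weight[OF m(2)] by blast
  have "continuous_on UNIV (\<lambda>x. LINT \<xi>|lborel. cis (x \<bullet> \<xi>) * m \<xi>)"
  proof (rule continuous_integral)
    show "(\<lambda>\<xi>. cis (x \<bullet> \<xi>) * m \<xi>) \<in> borel_measurable lborel" for x
      using schwartz_measurable[OF schwartz_cis[OF m(2)]] by simp
    show "continuous_on UNIV (\<lambda>x. cis (x \<bullet> \<xi>) * m \<xi>)" for \<xi> by (intro continuous_intros)
    have "integrable lborel (\<lambda>\<xi>::real^'n. C * (1 / weight \<xi>))"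
      by (intro integrable_mult_right integrable_inv_weight)
    moreover have "norm (cis (x \<bullet> \<xi>) * m \<xi>) \<le> C * (1 / weight \<xi>)" for x \<xi> using C(2)[of \<xi>] by (simp add: norm_mult)
    ultimately show "\<exists>w d. d > 0 \<and> integrable lborel w \<and> (\<forall>x \<xi>. dist x x0 < d \<longrightarrow> norm (cis (x \<bullet> \<xi>) * m \<xi>) \<le> w \<xi>)" for x0
      using zero_less_one by blast
  qed
  then have cont: "continuous_on UNIV u" unfolding m(1) ift_def[abs_def] by (intro continuous_intros)
  have "\<exists>C. \<forall>x. norm x ^ n * norm (ift m x) \<le> C" if "schwartz m" for n and m :: "real^'n::finite \<Rightarrow> complex" using that
  proof (induction n arbitrary: m)
    case 0
    then show ?case using norm_ift_le[OF schwartz_integrable] by auto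
  next
    case (Suc n)
    have "\<forall>k. \<exists>C. \<forall>x. norm x ^ n * norm (ift (partial k m) x) \<le> C"
      using Suc.IH schwartz_partial[OF Suc.prems] by blast
    then obtain C where C: "\<And>k x. norm x ^ n * norm (ift (partial k m) x) \<le> C k" by metis
    have "norm x ^ Suc n * norm (ift m x) \<le> (\<Sum>k\<in>UNIV. C k)" for x
    proof -
      have "norm x ^ Suc n * norm (ift m x) = norm x * (norm x ^ n * norm (ift m x))" by simp
      \<comment> \<open>One power of the norm is spread over the coordinates, and each coordinate is
        traded for a partial derivative of m.\<close>
      also have "\<dots> \<le> (\<Sum>k\<in>UNIV. \<bar>x$k\<bar>) * (norm x ^ n * norm (ift m x))"
        by (intro mult_right_mono norm_le_l1_cart) auto
      also have "\<dots> = (\<Sum>k\<in>UNIV. norm x ^ n * norm (ift (partial k m) x))"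
        unfolding sum_distrib_right by (simp add: ift_partial[OF Suc.prems] norm_mult mult_ac)
      also have "\<dots> \<le> (\<Sum>k\<in>UNIV. C k)" by (intro sum_mono C)
      finally show ?thesis .
    qed
    then show ?case by blast
  qed
  with cont show "rapid u" unfolding rapid_def m(1) using m(2) by blast
  fix k
  have "schwartz (\<lambda>\<xi>. \<i> * of_real (\<xi>$k) * m \<xi>)"
    unfolding mult.assoc by (intro schwartz_cmult schwartz_coord m)
  then show "\<exists>v. has_partial k u v \<and> (\<exists>m. v = ift m \<and> schwartz m)"
    using has_partial_ift[OF m(2), of k] unfolding m(1) by blast
qed

text \<open>Partial derivatives of a smooth function stay smooth and vanish outside the same ball,
  so a fixed radius R can be part of the invariant. Decay of all orders is compactness of that
  ball.\<close>

lemma schwartz_test_fn: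
  fixes \<phi> :: "real^'n::finite \<Rightarrow> real"
  assumes "smooth_fn \<phi>" "\<And>x. R < norm x \<Longrightarrow> \<phi> x = 0"
  shows "schwartz (\<lambda>x. complex_of_real (\<phi> x))"
proof (rule schwartz_closedI[where X = "\<lambda>u. \<exists>\<phi>. u = (\<lambda>x. complex_of_real (\<phi> x)) \<and> smooth_fn \<phi> \<and> (\<forall>x. R < norm x \<longrightarrow> \<phi> x = 0)"])
  show "\<exists>\<psi>. (\<lambda>x. complex_of_real (\<phi> x)) = (\<lambda>x. complex_of_real (\<psi> x)) \<and> smooth_fn \<psi> \<and> (\<forall>x. R < norm x \<longrightarrow> \<psi> x = 0)"
    using assms by (intro exI[of _ \<phi>]) auto
  fix u :: "real^'n \<Rightarrow> complex"
  assume "\<exists>\<phi>. u = (\<lambda>x. complex_of_real (\<phi> x)) \<and> smooth_fn \<phi> \<and> (\<forall>x. R < norm x \<longrightarrow> \<phi> x = 0)"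
  then obtain \<phi> where \<phi>: "u = (\<lambda>x. complex_of_real (\<phi> x))" "smooth_fn \<phi>" "\<And>x. R < norm x \<Longrightarrow> \<phi> x = 0" by blast
  have c: "continuous_on UNIV (partials ks \<phi>)"
    and d: "(\<lambda>s. partials ks \<phi> (x + s *\<^sub>R axis k 1)) differentiable (at 0)" for ks k x
    using \<phi>(2) unfolding smooth_fn_def by blast+
  have cont: "continuous_on UNIV \<phi>" using c[of "[]"] by simp
  show "rapid u" unfolding rapid_def
  proof safe
    show "continuous_on UNIV u" unfolding \<phi>(1) using cont by (intro continuous_intros)
    fix n
    have "compact ((\<lambda>x. norm x ^ n * norm (u x)) ` cball 0 R)"
      unfolding \<phi>(1)
      by (intro compact_continuous_image compact_cball continuous_intros continuous_on_subset[OF cont]) auto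
    then have "bounded ((\<lambda>x. norm x ^ n * norm (u x)) ` cball 0 R)" by (rule compact_imp_bounded)
    then obtain B where B: "\<And>x. x \<in> cball 0 R \<Longrightarrow> norm (norm x ^ n * norm (u x)) \<le> B"
      unfolding bounded_iff by blast
    have "norm x ^ n * norm (u x) \<le> max B 0" for x
      using B[of x] \<phi>(3)[of x] unfolding \<phi>(1) by (cases "norm x \<le> R") auto
    then show "\<exists>C. \<forall>x. norm x ^ n * norm (u x) \<le> C" by blast
  qed
  fix k
  have "has_partial k u (\<lambda>x. complex_of_real (partial k \<phi> x))"
    unfolding \<phi>(1)
  proof (rule has_partial_linear[OF bounded_linear_of_real])
    show "has_partial k \<phi> (partial k \<phi>)"
      using d[of "[]"] unfolding has_partial_def partial_def by (simp add: vector_derivative_works)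
  qed
  moreover have "smooth_fn (partial k \<phi>)"
  proof -
    \<comment> \<open>\<open>partials\<close> applies the last entry of its list first, so the inner
      derivative is appended at the end.\<close>
    have "partials ks (partial k \<phi>) = partials (ks @ [k]) \<phi>" for ks by (induction ks) auto
    then show ?thesis unfolding smooth_fn_def using c d by simp
  qed
  moreover have "partial k \<phi> x = 0" if "R < norm x" for x
  proof -
    \<comment> \<open>The points outside the ball form an open set, so \<phi> vanishes near x along
      the axis and the derivative there is zero.\<close>
    have "open {s::real. R < norm (x + s *\<^sub>R axis k 1)}"
      by (intro open_Collect_less continuous_intros)
    moreover have "((\<lambda>s. 0) has_vector_derivative (0::real)) (at 0)" by simp
    ultimately have "((\<lambda>s. \<phi> (x + s *\<^sub>R axis k 1)) has_vector_derivative (0::real)) (at 0)"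
      using has_vector_derivative_transform_within_open[of "\<lambda>s. 0" 0 "0" "{s::real. R < norm (x + s *\<^sub>R axis k 1)}" "\<lambda>s. \<phi> (x + s *\<^sub>R axis k 1)"] that \<phi>(3) by auto
    then show ?thesis unfolding partial_def by (rule vector_derivative_at)
  qed
  ultimately show "\<exists>v. has_partial k u v \<and> (\<exists>\<phi>. v = (\<lambda>x. complex_of_real (\<phi> x)) \<and> smooth_fn \<phi> \<and> (\<forall>x. R < norm x \<longrightarrow> \<phi> x = 0))"
    by blast
qed

section \<open>Fourier inversion and the convolution theorem\<close>

text \<open>Decay is asked for s >= 0 only, the range of |\<xi>|^2, because damped exponentials grow
  for negative s. Differentiability is asked on the whole line, which avoids one-sided derivatives
  at 0.\<close>

coinductive radial_profile :: "(real \<Rightarrow> complex) \<Rightarrow> bool" where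
  "(\<And>n. \<exists>C. \<forall>s\<ge>0. s ^ n * norm (h s) \<le> C) \<Longrightarrow>
   (\<exists>h'. (\<forall>s. (h has_vector_derivative h' s) (at s)) \<and> radial_profile h') \<Longrightarrow> radial_profile h"

lemma radial_profile_bound: "radial_profile h \<Longrightarrow> \<exists>C. \<forall>s\<ge>0. s ^ n * norm (h s) \<le> C"
  by (erule radial_profile.cases) auto

lemma radial_profile_deriv: "radial_profile h \<Longrightarrow> \<exists>h'. (\<forall>s. (h has_vector_derivative h' s) (at s)) \<and> radial_profile h'"
  by (erule radial_profile.cases) auto

lemma radial_profile_continuous: "radial_profile h \<Longrightarrow> continuous_on A h"
  using radial_profile_deriv[of h] by (meson continuous_at_imp_continuous_on has_vector_derivative_continuous)

lemma radial_profile_closedI: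
  assumes "X h" "\<And>h n. X h \<Longrightarrow> \<exists>C. \<forall>s\<ge>0. s ^ n * norm (h s) \<le> C"
    and "\<And>h. X h \<Longrightarrow> \<exists>h'. (\<forall>s. (h has_vector_derivative h' s) (at s)) \<and> X h'"
  shows "radial_profile h"
  by (rule radial_profile.coinduct[where X = X]) (use assms in blast)+

lemma rapid_radial_profile:
  assumes "radial_profile h" shows "rapid (\<lambda>\<xi>. h ((norm \<xi>)\<^sup>2))"
  unfolding rapid_def
proof safe
  show "continuous_on UNIV (\<lambda>\<xi>::real^'n::finite. h ((norm \<xi>)\<^sup>2))"
    by (intro continuous_on_compose2[OF radial_profile_continuous[OF assms, of UNIV]] continuous_intros) auto
  fix n
  obtain C where C: "\<And>s. s \<ge> 0 \<Longrightarrow> s ^ 0 * norm (h s) \<le> C" using radial_profile_bound[OF assms] by blast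
  obtain D where D: "\<And>s. s \<ge> 0 \<Longrightarrow> s ^ n * norm (h s) \<le> D" using radial_profile_bound[OF assms] by blast
  have "norm \<xi> ^ n * norm (h ((norm \<xi>)\<^sup>2)) \<le> C + D" for \<xi> :: "real^'n"
  proof -
    have "norm \<xi> ^ n \<le> 1 + ((norm \<xi>)\<^sup>2) ^ n"
    proof (cases "norm \<xi> \<le> 1")
      case True
      then show ?thesis using power_le_one[of "norm \<xi>" n] by (simp add: add_increasing2)
    next
      case False
      then have "norm \<xi> ^ n \<le> norm \<xi> ^ (2 * n)" by (intro power_increasing) auto
      then show ?thesis unfolding power_mult by linarith
    qed
    then have "norm \<xi> ^ n * norm (h ((norm \<xi>)\<^sup>2)) \<le> (1 + ((norm \<xi>)\<^sup>2) ^ n) * norm (h ((norm \<xi>)\<^sup>2))"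
      by (intro mult_right_mono) auto
    also have "\<dots> \<le> C + D" using C[of "(norm \<xi>)\<^sup>2"] D[of "(norm \<xi>)\<^sup>2"] by (simp add: distrib_right)
    finally show ?thesis .
  qed
  then show "\<exists>C. \<forall>\<xi>::real^'n. norm \<xi> ^ n * norm (h ((norm \<xi>)\<^sup>2)) \<le> C" by blast
qed

lemma has_partial_radial:
  assumes "\<And>s. (h has_vector_derivative h' s) (at s)"
  shows "has_partial k (\<lambda>\<xi>. h ((norm \<xi>)\<^sup>2)) (\<lambda>\<xi>::real^'n::finite. complex_of_real (\<xi>$k) * (2 * h' ((norm \<xi>)\<^sup>2)))"
  unfolding has_partial_def
proof
  fix \<xi> :: "real^'n"
  let ?g = "\<lambda>s. (norm (\<xi> + s *\<^sub>R axis k 1))\<^sup>2"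
  have g: "?g s = (norm \<xi>)\<^sup>2 + 2 * s * \<xi>$k + s\<^sup>2" for s
    unfolding power2_norm_eq_inner
    by (simp add: inner_add_left inner_add_right inner_axis inner_axis' power2_eq_square algebra_simps)
  have "(?g has_vector_derivative 2 * \<xi>$k) (at 0)"
    unfolding g by (auto intro!: derivative_eq_intros simp: has_real_derivative_iff_has_vector_derivative[symmetric])
  moreover have "(h has_vector_derivative h' ((norm \<xi>)\<^sup>2)) (at (?g 0))" using assms by simp
  ultimately have "((h \<circ> ?g) has_vector_derivative (2 * \<xi>$k) *\<^sub>R h' ((norm \<xi>)\<^sup>2)) (at 0)"
    by (rule vector_diff_chain_at)
  then show "((\<lambda>s. h (?g s)) has_vector_derivative complex_of_real (\<xi>$k) * (2 * h' ((norm \<xi>)\<^sup>2))) (at 0)"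
    by (simp add: comp_def scaleR_conv_of_real mult_ac)
qed

text \<open>A derivative of h(|\<xi>|^2) is 2 \<xi>$k h'(|\<xi>|^2), hence the closure under
  coordinate factors. Profiles take the square of the norm as argument, so that the functions are
  smooth at the origin too.\<close>

inductive radial_profile_alg :: "(real^'n::finite \<Rightarrow> complex) \<Rightarrow> bool" where
  base: "radial_profile h \<Longrightarrow> radial_profile_alg (\<lambda>\<xi>. h ((norm \<xi>)\<^sup>2))"
| cmult: "radial_profile_alg u \<Longrightarrow> radial_profile_alg (\<lambda>x. c * u x)"
| coord: "radial_profile_alg u \<Longrightarrow> radial_profile_alg (\<lambda>x. complex_of_real (x$k) * u x)"
| add: "radial_profile_alg u \<Longrightarrow> radial_profile_alg v \<Longrightarrow> radial_profile_alg (\<lambda>x. u x + v x)"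

lemma radial_profile_alg_schwartz: "radial_profile_alg u \<Longrightarrow> schwartz u"
proof (erule schwartz_closedI)
  show "rapid u" if "radial_profile_alg u" for u :: "real^'a \<Rightarrow> complex" using that
    by induction (auto intro: rapid_radial_profile rapid_cmult rapid_coord rapid_add)
  show "\<exists>v. has_partial k u v \<and> radial_profile_alg v" if "radial_profile_alg u" for u :: "real^'a \<Rightarrow> complex" and k using that
  proof induction
    case (base h)
    then obtain h' where h': "\<And>s. (h has_vector_derivative h' s) (at s)" "radial_profile h'" using radial_profile_deriv by blast
    have "radial_profile_alg (\<lambda>\<xi>::real^'a. complex_of_real (\<xi>$k) * (2 * h' ((norm \<xi>)\<^sup>2)))"
      by (intro radial_profile_alg.coord radial_profile_alg.cmult radial_profile_alg.base h')
    then show ?case using has_partial_radial[OF h'(1), of k] by blast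
  next
    case (cmult u c)
    then show ?case using has_partial_cmult radial_profile_alg.cmult by blast
  next
    case (add u v)
    then show ?case using has_partial_add radial_profile_alg.add by blast
  next
    case (coord u l)
    then obtain v where v: "has_partial k u v" "radial_profile_alg v" by blast
    have "radial_profile_alg (\<lambda>x. complex_of_real (x$l) * v x + (if l = k then 1 else 0) * u x)"
      by (intro radial_profile_alg.intros v coord)
    then show ?case using has_partial_mult[OF has_partial_coord v(1)] by blast
  qed
qed

lemma schwartz_radial_profile: "radial_profile h \<Longrightarrow> schwartz (\<lambda>\<xi>. h ((norm \<xi>)\<^sup>2))"
  by (intro radial_profile_alg_schwartz radial_profile_alg.base)

text \<open>A single term of the exponential series of c * s is at most the whole sum.\<close>

lemma power_exp_bound:
  assumes "c > (0::real)" "s \<ge> 0" shows "s ^ n * exp (- c * s) \<le> fact n / c ^ n"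
proof -
  have "(c * s) ^ n / fact n \<le> exp (c * s)"
  proof -
    have "(\<Sum>k\<in>{n}. (c * s) ^ k / fact k) \<le> (\<Sum>k. (c * s) ^ k / fact k)"
      using assms summable_exp_generic[of "c * s"]
      by (intro sum_le_suminf) (auto simp: divide_inverse mult.commute scaleR_conv_of_real)
    then show ?thesis by (simp add: exp_def divide_inverse mult.commute)
  qed
  then have "(c * s) ^ n \<le> exp (c * s) * fact n" by (simp add: divide_simps)
  then have "c ^ n * s ^ n * exp (- (c * s)) \<le> exp (c * s) * fact n * exp (- (c * s))"
    by (intro mult_right_mono) (auto simp: power_mult_distrib)
  also have "\<dots> = fact n" by (simp add: exp_minus)
  finally have "c ^ n * (s ^ n * exp (- c * s)) \<le> fact n" by (simp add: mult_ac)
  then show ?thesis using assms by (simp add: pos_le_divide_eq mult.commute)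
qed

lemma radial_profile_bound_exp:
  assumes "c > 0" "\<And>s. s \<ge> 0 \<Longrightarrow> norm (h s) \<le> B * exp (- c * s)"
  shows "\<exists>C. \<forall>s\<ge>0. s ^ n * norm (h s) \<le> C"
proof -
  have "s ^ n * norm (h s) \<le> \<bar>B\<bar> * (fact n / c ^ n)" if "s \<ge> 0" for s
  proof -
    have "norm (h s) \<le> \<bar>B\<bar> * exp (- c * s)"
      using assms(2)[OF that] by (rule order_trans) (auto intro!: mult_right_mono)
    then have "s ^ n * norm (h s) \<le> s ^ n * (\<bar>B\<bar> * exp (- c * s))"
      using that by (intro mult_left_mono) auto
    also have "\<dots> = \<bar>B\<bar> * (s ^ n * exp (- c * s))" by simp
    also have "\<dots> \<le> \<bar>B\<bar> * (fact n / c ^ n)"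
      using assms(1) that by (intro mult_left_mono power_exp_bound) auto
    finally show ?thesis .
  qed
  then show ?thesis by blast
qed

lemma has_vector_derivative_exp_of_real:
  fixes z :: complex
  shows "((\<lambda>s. exp (of_real s * z)) has_vector_derivative z * exp (of_real s * z)) (at s)"
proof -
  have "((\<lambda>w. exp (w * z)) has_field_derivative z * exp (of_real s * z)) (at (of_real s))"
    by (auto intro!: derivative_eq_intros)
  from has_vector_derivative_real_field[OF this] show ?thesis .
qed

lemma radial_profile_exp:
  assumes "Re z < 0" shows "radial_profile (\<lambda>s. exp (of_real s * z))"
proof (rule radial_profile_closedI[where X = "\<lambda>h. \<exists>c. h = (\<lambda>s. c * exp (of_real s * z))"])
  show "\<exists>c. (\<lambda>s. exp (of_real s * z)) = (\<lambda>s. c * exp (of_real s * z))"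
    by (intro exI[of _ 1]) auto
  fix h assume "\<exists>c. h = (\<lambda>s. c * exp (of_real s * z))"
  then obtain c where h: "h = (\<lambda>s. c * exp (of_real s * z))" by blast
  show "\<exists>C. \<forall>s\<ge>0. s ^ n * norm (h s) \<le> C" for n
    by (rule radial_profile_bound_exp[where c = "- Re z" and B = "norm c"])
       (use assms in \<open>auto simp: h norm_mult mult.commute\<close>)
  have "(h has_vector_derivative (c * z) * exp (of_real s * z)) (at s)" for s
    unfolding h mult.assoc
    by (intro has_vector_derivative_mult_right has_vector_derivative_exp_of_real)
  then show "\<exists>h'. (\<forall>s. (h has_vector_derivative h' s) (at s)) \<and> (\<exists>c. h' = (\<lambda>s. c * exp (of_real s * z)))"
    by (intro exI[of _ "\<lambda>s. (c * z) * exp (of_real s * z)"] conjI exI[of _ "c * z"] allI refl)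
qed

text \<open>The exponent is normalised so that \<open>gauss\<close> is, up to a constant, its own
  inverse Fourier transform.\<close>

definition gauss :: "real^'n::finite \<Rightarrow> complex" where
  "gauss \<xi> = exp (of_real ((norm \<xi>)\<^sup>2) * (- 1 / 2))"

lemma gauss_of_real: "gauss \<xi> = of_real (exp (- (norm \<xi>)\<^sup>2 / 2))"
  unfolding gauss_def by (simp flip: exp_of_real)

lemma schwartz_gauss: "schwartz gauss"
  unfolding gauss_def[abs_def] by (rule schwartz_radial_profile[OF radial_profile_exp]) simp

lemma partial_gauss: "partial k gauss = (\<lambda>\<xi>. - (complex_of_real (\<xi>$k) * gauss \<xi>))"
  using has_partial_imp_partial[OF has_partial_radial[OF has_vector_derivative_exp_of_real], of k "- 1/2"]
  unfolding gauss_def[abs_def] by (simp add: fun_eq_iff)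

lemma gauss_0 [simp]: "gauss 0 = 1"
  by (simp add: gauss_def)

lemma norm_gauss_le: "norm (gauss x) \<le> 1"
  by (simp add: gauss_of_real)

lemma nn_integral_gauss_real: "(\<integral>\<^sup>+x. ennreal (exp (- x\<^sup>2 / 2)) \<partial>lborel) = ennreal (sqrt (2 * pi))"
proof -
  have h: "has_bochner_integral lborel std_normal_density 1"
    using std_normal_moment_even[of 0] by simp
  have "(\<integral>\<^sup>+x. ennreal (exp (- x\<^sup>2 / 2)) \<partial>lborel) = (\<integral>\<^sup>+x. ennreal (sqrt (2 * pi) * std_normal_density x) \<partial>lborel)"
    by (intro nn_integral_cong) (simp add: std_normal_density_def)
  also have "\<dots> = ennreal (sqrt (2 * pi) * 1)"
    using has_bochner_integral_mult_right[OF h, of "sqrt (2 * pi)"]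
    by (subst nn_integral_eq_integral) (auto simp: has_bochner_integral_iff)
  finally show ?thesis by simp
qed

lemma integral_gauss: "(LINT \<xi>|lborel. gauss (\<xi>::real^'n::finite)) = of_real (sqrt (2 * pi) ^ CARD('n))"
proof -
  have "(\<integral>\<^sup>+\<xi>. ennreal (exp (- (norm (\<xi>::real^'n))\<^sup>2 / 2)) \<partial>lborel)
      = (\<integral>\<^sup>+\<xi>. (\<Prod>k\<in>UNIV. ennreal (exp (- ((\<xi>::real^'n)$k)\<^sup>2 / 2))) \<partial>lborel)"
    by (intro nn_integral_cong)
       (simp add: prod_ennreal exp_sum[symmetric] sum_divide_distrib[symmetric] sum_negf norm_vec_def L2_set_def sum_nonneg)
  also have "\<dots> = ennreal (sqrt (2 * pi) ^ CARD('n))"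
    by (subst nn_integral_prod_cart[of "\<lambda>x. ennreal (exp (- x\<^sup>2 / 2))"])
       (auto simp only: nn_integral_gauss_real, auto simp: ennreal_power)
  finally have "(LINT \<xi>|lborel. exp (- (norm (\<xi>::real^'n))\<^sup>2 / 2)) = sqrt (2 * pi) ^ CARD('n)"
    by (subst integral_eq_nn_integral) auto
  then show ?thesis unfolding gauss_of_real integral_complex_of_real by simp
qed

text \<open>Derivatives are known along the axes only, so the point is moved to the origin one
  coordinate at a time, by induction on the set of coordinates already set to zero.\<close>

lemma has_partial_zero_constant:
  fixes g :: "real^'n::finite \<Rightarrow> complex"
  assumes "\<And>k. has_partial k g (\<lambda>x. 0)"
  shows "g x = g 0"
proof -
  have step: "g (y + s *\<^sub>R axis k 1) = g y" for y s k
  proof -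
    have "((\<lambda>s. g (y + s *\<^sub>R axis k 1)) has_vector_derivative 0) (at s within UNIV)" for s
      using has_partial_at[OF assms] by simp
    then obtain c where "\<And>s. g (y + s *\<^sub>R axis k 1) = c"
      using has_vector_derivative_zero_constant[of UNIV "\<lambda>s. g (y + s *\<^sub>R axis k 1)"] by auto
    from this[of s] this[of 0] show ?thesis by simp
  qed
  have "g (\<chi> k. if k \<in> S then 0 else x$k) = g x" if "finite S" for S using that
  proof induction
    case empty
    then show ?case by simp
  next
    case (insert l S)
    let ?y = "(\<chi> k. if k \<in> S then 0 else x$k) :: real^'n"
    have eq: "(\<chi> k. if k \<in> insert l S then 0 else x$k) = ?y + (- (?y$l)) *\<^sub>R axis l 1"
      by (auto simp: vec_eq_iff axis_def)
    show ?case unfolding eq step by (rule insert.IH)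
  qed
  from this[of UNIV] show ?thesis by (simp add: zero_vec_def)
qed

text \<open>Both sides satisfy the system \<partial>_k v = - x$k v: for the transform this is
  \<open>ift_partial\<close> combined with \<open>partial_gauss\<close>. Hence the product with
  exp(|x|^2 / 2) has vanishing partial derivatives and is constant.\<close>

lemma ift_gauss: "ift gauss x = ift gauss (0::real^'a) * gauss (x::real^'a::finite)"
proof -
  have e: "has_partial k (\<lambda>x. exp (complex_of_real ((norm x)\<^sup>2) * (1 / 2))) (\<lambda>x::real^'a. complex_of_real (x$k) * exp (of_real ((norm x)\<^sup>2) * (1 / 2)))" for k
    using has_partial_radial[OF has_vector_derivative_exp_of_real, of k "1/2"] by simp
  have i: "has_partial k (ift gauss) (\<lambda>x::real^'a. - (of_real (x$k) * ift gauss x))" for k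
  proof -
    have "ift (\<lambda>\<xi>. \<i> * complex_of_real (\<xi>$k) * gauss \<xi>) x = - \<i> * ift (partial k gauss) x" for x :: "real^'a"
    proof -
      have "(LINT \<xi>|lborel. cis (x \<bullet> \<xi>) * (\<i> * complex_of_real (\<xi>$k) * gauss \<xi>))
        = (LINT \<xi>|lborel. (- \<i>) * (cis (x \<bullet> \<xi>) * - (complex_of_real (\<xi>$k) * gauss \<xi>)))"
        by (intro Bochner_Integration.integral_cong refl) algebra
      also have "\<dots> = (- \<i>) * (LINT \<xi>|lborel. cis (x \<bullet> \<xi>) * - (complex_of_real (\<xi>$k) * gauss \<xi>))"
        by (rule integral_mult_right_zero)
      finally show ?thesis unfolding ift_def partial_gauss by (simp only: mult.left_commute)
    qed
    then have "ift (\<lambda>\<xi>. \<i> * complex_of_real (\<xi>$k) * gauss \<xi>) = (\<lambda>x::real^'a. - (of_real (x$k) * ift gauss x))"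
      by (simp add: ift_partial[OF schwartz_gauss] fun_eq_iff mult.assoc[symmetric])
    then show ?thesis using has_partial_ift[OF schwartz_gauss, of k] by simp
  qed
  define g where "g = (\<lambda>x::real^'a. ift gauss x * exp (complex_of_real ((norm x)\<^sup>2) * (1 / 2)))"
  have "has_partial k g (\<lambda>x. 0)" for k
    using has_partial_mult[OF i e, of k] unfolding g_def by (simp add: algebra_simps)
  then have "g x = g 0" by (rule has_partial_zero_constant)
  then have "ift gauss x * exp (of_real ((norm x)\<^sup>2) * (1 / 2)) = ift gauss (0::real^'a)"
    unfolding g_def by simp
  then have "ift gauss x * (exp (of_real ((norm x)\<^sup>2) * (1 / 2)) * gauss x) = ift gauss (0::real^'a) * gauss x"
    by (simp add: mult.assoc[symmetric])
  then show ?thesis by (simp add: gauss_def flip: exp_add)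
qed

lemma ift_gauss_0: "ift gauss (0::real^'n::finite) = of_real (1 / sqrt (2 * pi) ^ CARD('n))"
proof -
  have "ift gauss (0::real^'n) = of_real (1 / (2 * pi) ^ CARD('n) * sqrt (2 * pi) ^ CARD('n))"
    unfolding ift_def by (simp add: integral_gauss)
  also have "1 / (2 * pi) ^ CARD('n) * sqrt (2 * pi) ^ CARD('n) = 1 / sqrt (2 * pi) ^ CARD('n)"
  proof -
    have "(2 * pi) ^ CARD('n) = sqrt (2 * pi) ^ CARD('n) * sqrt (2 * pi) ^ CARD('n)"
      by (subst power_mult_distrib[symmetric]) simp
    then show ?thesis by simp
  qed
  finally show ?thesis .
qed

section \<open>Dilations, Fubini and the inversion formula\<close>

lemma ift_scale:
  fixes m :: "real^'n::finite \<Rightarrow> complex"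
  assumes [measurable]: "m \<in> borel_measurable borel" and "r > 0"
  shows "ift (\<lambda>\<xi>. m (r *\<^sub>R \<xi>)) x = of_real (1 / r ^ CARD('n)) * ift m ((1 / r) *\<^sub>R x)"
proof -
  have [measurable]: "(\<lambda>\<xi>. cis (x \<bullet> \<xi>)) \<in> borel_measurable borel"
    by (intro borel_measurable_continuous_onI continuous_intros)
  have "(LINT \<xi>|lborel. cis (x \<bullet> \<xi>) * m (r *\<^sub>R \<xi>))
    = (1 / r ^ CARD('n)) *\<^sub>R (LINT \<xi>|lborel. cis (((1 / r) *\<^sub>R x) \<bullet> \<xi>) * m \<xi>)"
    using \<open>r > 0\<close> by (subst integral_affine[where c = "1 / r" and t = 0]) (auto simp: power_divide)
  then show ?thesis unfolding ift_def by (simp add: scaleR_conv_of_real)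
qed

text \<open>A product majorant u x * v y is available at every interchange of Bochner integrals
  below and gives integrability on the product space.\<close>

lemma integrable_prod_bound:
  fixes f :: "'a::euclidean_space \<Rightarrow> 'b::euclidean_space \<Rightarrow> complex"
  assumes f [measurable]: "case_prod f \<in> borel_measurable (lborel \<Otimes>\<^sub>M lborel)"
    and u: "integrable lborel u" and v: "integrable lborel v"
    and bd: "\<And>x y. norm (f x y) \<le> u x * v y"
  shows "integrable (lborel \<Otimes>\<^sub>M lborel) (case_prod f)"
proof (rule lborel_pair.Fubini_integrable)
  have m: "(\<lambda>y. f x y) \<in> borel_measurable lborel" for x
    by (rule measurable_compose_Pair1[OF _ f, unfolded split]) simp
  have int: "integrable lborel (f x)" for x
    by (rule Bochner_Integration.integrable_bound[of _ "\<lambda>y. u x * v y"])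
       (use m bd v in \<open>auto intro!: AE_I2 order_trans[OF bd]\<close>)
  then show "AE x in lborel. integrable lborel (\<lambda>y. case_prod f (x, y))" by simp
  show "integrable lborel (\<lambda>x. LINT y|lborel. norm (case_prod f (x, y)))"
  proof (rule Bochner_Integration.integrable_bound[of _ "\<lambda>x. u x * (LINT y|lborel. v y)"])
    show "integrable lborel (\<lambda>x. u x * (LINT y|lborel. v y))" using u by simp
    show "(\<lambda>x. LINT y|lborel. norm (case_prod f (x, y))) \<in> borel_measurable lborel" by measurable
    have "norm (LINT y|lborel. norm (f x y)) \<le> norm (u x * (LINT y|lborel. v y))" for x
    proof -
      have "(LINT y|lborel. norm (f x y)) \<le> (LINT y|lborel. u x * v y)"
        by (intro integral_mono) (use int v bd in auto)
      then show ?thesis by simp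
    qed
    then show "AE x in lborel. norm (LINT y|lborel. norm (case_prod f (x, y))) \<le> norm (u x * (LINT y|lborel. v y))"
      by simp
  qed
qed (rule f)

lemma Fubini_bound:
  fixes f :: "'a::euclidean_space \<Rightarrow> 'b::euclidean_space \<Rightarrow> complex"
  assumes "case_prod f \<in> borel_measurable (lborel \<Otimes>\<^sub>M lborel)"
    and "integrable lborel u" "integrable lborel v" "\<And>x y. norm (f x y) \<le> u x * v y"
  shows "(LINT y|lborel. LINT x|lborel. f x y) = (LINT x|lborel. LINT y|lborel. f x y)"
  by (rule lborel_pair.Fubini_integral[OF integrable_prod_bound[OF assms]])

lemma measurable_pair_continuous:
  fixes f :: "'a::euclidean_space \<Rightarrow> 'b::euclidean_space \<Rightarrow> complex"
  assumes "continuous_on UNIV (\<lambda>p. f (fst p) (snd p))"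
  shows "case_prod f \<in> borel_measurable (lborel \<Otimes>\<^sub>M lborel)"
  unfolding lborel_prod case_prod_beta' using borel_measurable_continuous_onI[OF assms] by simp

lemma schwartz_cont_compose:
  "schwartz u \<Longrightarrow> continuous_on A f \<Longrightarrow> continuous_on A (\<lambda>x. u (f x))"
  by (rule continuous_on_compose2[OF schwartz_continuous[of u UNIV]]) auto

text \<open>The plain double integral does not converge absolutely. A factor
  \<open>gauss (\<delta> n *\<^sub>R y)\<close> repairs this; Fubini then yields the average of a
  around \<xi> against a Gaussian of width \<delta> n, and n tends to infinity.\<close>

lemma fourier_inversion:
  fixes a :: "real^'n::finite \<Rightarrow> complex"
  assumes a: "schwartz a"
  shows "(LINT y|lborel. cis (- (y \<bullet> \<xi>)) * ift a y) = a \<xi>"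
proof -
  let ?c = "1 / (2 * pi) ^ CARD('n)"
  let ?d = "1 / sqrt (2 * pi) ^ CARD('n)"
  define \<delta> :: "nat \<Rightarrow> real" where "\<delta> n = 1 / (real n + 1)" for n
  have \<delta>: "\<delta> n > 0" for n by (simp add: \<delta>_def)
  have \<delta>0: "\<delta> \<longlonglongrightarrow> 0" using LIMSEQ_inverse_real_of_nat by (simp add: \<delta>_def[abs_def] divide_inverse add.commute)
  define I where "I n = (LINT y|lborel. cis (- (y \<bullet> \<xi>)) * ift a y * gauss (\<delta> n *\<^sub>R y))" for n
  have ia: "schwartz (ift a)" using a by (rule schwartz_ift)
  note cont = continuous_intros schwartz_cont_compose[OF ia] schwartz_cont_compose[OF a] schwartz_cont_compose[OF schwartz_gauss]
  have lim1: "I \<longlonglongrightarrow> (LINT y|lborel. cis (- (y \<bullet> \<xi>)) * ift a y)"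
    unfolding I_def
  proof (rule integral_dominated_convergence[where w = "\<lambda>y. norm (ift a y)"])
    show "(\<lambda>y. cis (- (y \<bullet> \<xi>)) * ift a y) \<in> borel_measurable lborel"
      "(\<lambda>y. cis (- (y \<bullet> \<xi>)) * ift a y * gauss (\<delta> n *\<^sub>R y)) \<in> borel_measurable lborel" for n
      unfolding measurable_lborel2 by (intro borel_measurable_continuous_onI cont)+
    show "integrable lborel (\<lambda>y. norm (ift a y))" using schwartz_integrable[OF ia] by simp
    show "AE y in lborel. norm (cis (- (y \<bullet> \<xi>)) * ift a y * gauss (\<delta> n *\<^sub>R y)) \<le> norm (ift a y)" for n
      by (auto simp: norm_mult intro!: mult_left_le norm_gauss_le)
    have "(\<lambda>n. gauss (\<delta> n *\<^sub>R y)) \<longlonglongrightarrow> gauss (0 *\<^sub>R y)" for y :: "real^'n"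
      by (rule continuous_on_tendsto_compose[OF schwartz_continuous[OF schwartz_gauss, of UNIV]])
         (intro tendsto_intros \<delta>0, auto)
    then show "AE y in lborel. (\<lambda>n. cis (- (y \<bullet> \<xi>)) * ift a y * gauss (\<delta> n *\<^sub>R y)) \<longlonglongrightarrow> cis (- (y \<bullet> \<xi>)) * ift a y"
      using tendsto_mult_left[where l = 1] by fastforce
  qed
  have I: "I n = of_real ?d * (LINT w|lborel. a (\<xi> + \<delta> n *\<^sub>R w) * gauss w)" for n
  proof -
    have sg: "schwartz (\<lambda>y::real^'n. gauss (\<delta> n *\<^sub>R y))"
      by (rule schwartz_scale[OF schwartz_gauss]) (use \<delta>[of n] in simp)
    have "I n = (LINT y|lborel. LINT \<eta>|lborel. of_real ?c * (cis (y \<bullet> (\<eta> - \<xi>)) * gauss (\<delta> n *\<^sub>R y)) * a \<eta>)"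
      unfolding I_def
    proof (rule Bochner_Integration.integral_cong[OF refl])
      fix y
      have "(LINT \<eta>|lborel. of_real ?c * (cis (y \<bullet> (\<eta> - \<xi>)) * gauss (\<delta> n *\<^sub>R y)) * a \<eta>)
        = (LINT \<eta>|lborel. (of_real ?c * cis (- (y \<bullet> \<xi>)) * gauss (\<delta> n *\<^sub>R y)) * (cis (y \<bullet> \<eta>) * a \<eta>))"
        by (intro Bochner_Integration.integral_cong refl)
           (simp add: inner_diff_right cis_divide[symmetric] cis_mult[symmetric] divide_inverse mult_ac cis_inverse flip: cis_cnj)
      also have "\<dots> = (of_real ?c * cis (- (y \<bullet> \<xi>)) * gauss (\<delta> n *\<^sub>R y)) * (LINT \<eta>|lborel. cis (y \<bullet> \<eta>) * a \<eta>)"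
        by (rule integral_mult_right_zero)
      finally show "cis (- (y \<bullet> \<xi>)) * ift a y * gauss (\<delta> n *\<^sub>R y) = (LINT \<eta>|lborel. of_real ?c * (cis (y \<bullet> (\<eta> - \<xi>)) * gauss (\<delta> n *\<^sub>R y)) * a \<eta>)"
        unfolding ift_def by (simp only: mult_ac)
    qed
    also have "\<dots> = (LINT \<eta>|lborel. LINT y|lborel. of_real ?c * (cis (y \<bullet> (\<eta> - \<xi>)) * gauss (\<delta> n *\<^sub>R y)) * a \<eta>)"
    proof (rule Fubini_bound[where u = "\<lambda>\<eta>. ?c * norm (a \<eta>)" and v = "\<lambda>y. norm (gauss (\<delta> n *\<^sub>R y))"])
      show "(\<lambda>(\<eta>, y). of_real ?c * (cis (y \<bullet> (\<eta> - \<xi>)) * gauss (\<delta> n *\<^sub>R y)) * a \<eta>) \<in> borel_measurable (lborel \<Otimes>\<^sub>M lborel)"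
        by (intro measurable_pair_continuous cont)
      show "integrable lborel (\<lambda>\<eta>. ?c * norm (a \<eta>))" using schwartz_integrable[OF a] by simp
      show "integrable lborel (\<lambda>y::real^'n. norm (gauss (\<delta> n *\<^sub>R y)))" using schwartz_integrable[OF sg] by simp
    qed (simp add: norm_mult norm_divide norm_power mult.commute)
    also have "\<dots> = (LINT \<eta>|lborel. a \<eta> * ift (\<lambda>y. gauss (\<delta> n *\<^sub>R y)) (\<eta> - \<xi>))"
      unfolding ift_def by (intro Bochner_Integration.integral_cong refl) (simp add: inner_commute mult_ac)
    also have "\<dots> = (LINT \<eta>|lborel. a \<eta> * (of_real (1 / \<delta> n ^ CARD('n)) * (of_real ?d * gauss ((1 / \<delta> n) *\<^sub>R (\<eta> - \<xi>)))))"
      by (subst ift_scale[OF schwartz_measurable[OF schwartz_gauss] \<delta>]) (subst ift_gauss, simp add: ift_gauss_0)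
    \<comment> \<open>The substitution \<eta> = \<xi> + \<delta> n w turns the narrowing Gaussian
      into a fixed one, so that the limit can be taken in the argument of a.\<close>
    also have "\<dots> = \<bar>\<delta> n\<bar> ^ DIM(real^'n) *\<^sub>R (LINT w|lborel. a (\<xi> + \<delta> n *\<^sub>R w) * (of_real (1 / \<delta> n ^ CARD('n)) * (of_real ?d * gauss ((1 / \<delta> n) *\<^sub>R ((\<xi> + \<delta> n *\<^sub>R w) - \<xi>)))))"
      by (rule integral_affine) (use \<delta>[of n] in \<open>auto intro!: borel_measurable_continuous_onI cont\<close>)
    also have "\<dots> = of_real ?d * (LINT w|lborel. a (\<xi> + \<delta> n *\<^sub>R w) * gauss w)"
    proof -
      have "(LINT w|lborel. a (\<xi> + \<delta> n *\<^sub>R w) * (of_real (1 / \<delta> n ^ CARD('n)) * (of_real ?d * gauss ((1 / \<delta> n) *\<^sub>R ((\<xi> + \<delta> n *\<^sub>R w) - \<xi>)))))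
        = (LINT w|lborel. (of_real (1 / \<delta> n ^ CARD('n)) * of_real ?d) * (a (\<xi> + \<delta> n *\<^sub>R w) * gauss w))"
        using \<delta>[of n] by (intro Bochner_Integration.integral_cong refl) (simp add: mult_ac)
      also have "\<dots> = (of_real (1 / \<delta> n ^ CARD('n)) * of_real ?d) * (LINT w|lborel. a (\<xi> + \<delta> n *\<^sub>R w) * gauss w)"
        by simp
      finally show ?thesis using \<delta>[of n] by (simp add: scaleR_conv_of_real)
    qed
    finally show ?thesis .
  qed
  obtain B where B: "\<And>x. norm (a x) \<le> B"
    using rapid_bound[OF schwartz_rapid[OF a], of 0] by auto
  have "(\<lambda>n. LINT w|lborel. a (\<xi> + \<delta> n *\<^sub>R w) * gauss w) \<longlonglongrightarrow> (LINT w|lborel. a \<xi> * gauss (w::real^'n))"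
  proof (rule integral_dominated_convergence[where w = "\<lambda>w::real^'n. B * norm (gauss w)"])
    show "(\<lambda>w::real^'n. a \<xi> * gauss w) \<in> borel_measurable lborel"
      "(\<lambda>w. a (\<xi> + \<delta> n *\<^sub>R w) * gauss w) \<in> borel_measurable lborel" for n
      unfolding measurable_lborel2 by (intro borel_measurable_continuous_onI cont)+
    show "integrable lborel (\<lambda>w::real^'n. B * norm (gauss w))"
      by (intro integrable_mult_right integrable_norm schwartz_integrable schwartz_gauss)
    show "AE w in lborel. norm (a (\<xi> + \<delta> n *\<^sub>R w) * gauss w) \<le> B * norm (gauss w)" for n
      by (auto simp: norm_mult intro!: mult_right_mono B)
    have "(\<lambda>n. a (\<xi> + \<delta> n *\<^sub>R w)) \<longlonglongrightarrow> a (\<xi> + 0 *\<^sub>R w)" for w :: "real^'n"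
      by (rule continuous_on_tendsto_compose[OF schwartz_continuous[OF a, of UNIV]])
         (intro tendsto_intros \<delta>0, auto)
    then show "AE w in lborel. (\<lambda>n. a (\<xi> + \<delta> n *\<^sub>R w) * gauss w) \<longlonglongrightarrow> a \<xi> * gauss w"
      by (auto intro!: AE_I2 tendsto_mult_right)
  qed
  then have "I \<longlonglongrightarrow> of_real ?d * (LINT w|lborel. a \<xi> * gauss (w::real^'n))"
    unfolding I[abs_def] by (rule tendsto_mult_left)
  \<comment> \<open>The powers of sqrt (2 * pi) cancel: the averaging Gaussian has mass one.\<close>
  also have "of_real ?d * (LINT w|lborel. a \<xi> * gauss (w::real^'n)) = a \<xi>"
    by (simp add: integral_gauss)
  finally show ?thesis using LIMSEQ_unique[OF lim1] by blast
qed

text \<open>After writing \<open>ift m\<close> as an integral and exchanging the order, the inner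
  integral over y is the forward transform of \<open>ift a\<close>, which is a by
  \<open>fourier_inversion\<close>.\<close>

lemma ift_mult:
  fixes a m :: "real^'n::finite \<Rightarrow> complex"
  assumes a: "schwartz a" and m: "schwartz m"
  shows "ift (\<lambda>\<xi>. a \<xi> * m \<xi>) x = (LINT y|lborel. ift a y * ift m (x - y))"
proof -
  let ?c = "complex_of_real (1 / (2 * pi) ^ CARD('n))"
  have ia: "schwartz (ift a)" using a by (rule schwartz_ift)
  note cont = continuous_intros schwartz_cont_compose[OF ia] schwartz_cont_compose[OF m]
  have "(LINT y|lborel. ift a y * ift m (x - y)) = (LINT y|lborel. LINT \<xi>|lborel. (?c * ift a y) * (cis ((x - y) \<bullet> \<xi>) * m \<xi>))"
    unfolding ift_def[of m] by (intro Bochner_Integration.integral_cong refl) (subst integral_mult_right_zero, simp only: mult_ac)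
  also have "\<dots> = (LINT \<xi>|lborel. LINT y|lborel. (?c * ift a y) * (cis ((x - y) \<bullet> \<xi>) * m \<xi>))"
  proof (rule Fubini_bound[where u = "\<lambda>\<xi>. norm ?c * norm (m \<xi>)" and v = "\<lambda>y. norm (ift a y)"])
    show "(\<lambda>(\<xi>, y). (?c * ift a y) * (cis ((x - y) \<bullet> \<xi>) * m \<xi>)) \<in> borel_measurable (lborel \<Otimes>\<^sub>M lborel)"
      by (intro measurable_pair_continuous cont)
    show "integrable lborel (\<lambda>\<xi>. norm ?c * norm (m \<xi>))" using schwartz_integrable[OF m] by simp
    show "integrable lborel (\<lambda>y. norm (ift a y))" using schwartz_integrable[OF ia] by simp
  qed (simp only: norm_mult norm_cis mult_1_left mult_ac order_refl)
  also have "\<dots> = (LINT \<xi>|lborel. ?c * (cis (x \<bullet> \<xi>) * (a \<xi> * m \<xi>)))"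
  proof (rule Bochner_Integration.integral_cong[OF refl])
    fix \<xi>
    have "(LINT y|lborel. (?c * ift a y) * (cis ((x - y) \<bullet> \<xi>) * m \<xi>))
        = (LINT y|lborel. (?c * cis (x \<bullet> \<xi>) * m \<xi>) * (cis (- (y \<bullet> \<xi>)) * ift a y))"
      by (intro Bochner_Integration.integral_cong refl)
         (simp add: inner_diff_left cis_divide[symmetric] divide_inverse mult_ac cis_inverse flip: cis_cnj)
    also have "\<dots> = (?c * cis (x \<bullet> \<xi>) * m \<xi>) * (LINT y|lborel. cis (- (y \<bullet> \<xi>)) * ift a y)"
      by (rule integral_mult_right_zero)
    finally show "(LINT y|lborel. (?c * ift a y) * (cis ((x - y) \<bullet> \<xi>) * m \<xi>)) = ?c * (cis (x \<bullet> \<xi>) * (a \<xi> * m \<xi>))"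
      unfolding fourier_inversion[OF a] by (simp only: mult_ac)
  qed
  finally show ?thesis unfolding ift_def by simp
qed

section \<open>Convolution estimates between Lebesgue spaces\<close>

text \<open>Young's inequality with a free parameter l, with equality at l = a. The right-hand side
  is affine in \<open>a powr q\<close>, so it can be integrated first and l chosen
  afterwards.\<close>

lemma young_powr_le:
  fixes a l q :: real
  assumes "a \<ge> 0" "l > 0" "q > 1"
  shows "a \<le> (1 / q) * l powr (1 - q) * a powr q + (1 - 1 / q) * l"
proof (cases "a = 0")
  case False
  then have a: "a > 0" using assms by simp
  have "(a powr q * l powr (1 - q)) powr (1 / q) * l powr (1 - 1 / q) \<le> (1 / q) * (a powr q * l powr (1 - q)) + (1 - 1 / q) * l"
    using assms a by (intro Youngs_inequality_0) auto
  also have "(a powr q * l powr (1 - q)) powr (1 / q) * l powr (1 - 1 / q) = a * l powr ((1 - q) / q + (1 - 1 / q))"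
    using assms a by (simp add: powr_mult powr_powr powr_add)
  also have "(1 - q) / q + (1 - 1 / q) = 0" using assms by (simp add: field_simps)
  finally show ?thesis using assms by (simp add: mult_ac)
qed (use assms in auto)

lemma norm_integral_le_nn_integral:
  fixes f :: "'a \<Rightarrow> 'b::{banach,second_countable_topology}"
  shows "ennreal (norm (LINT x|M. f x)) \<le> (\<integral>\<^sup>+x. norm (f x) \<partial>M)"
  by (cases "integrable M f") (auto simp: not_integrable_integral_eq intro: integral_norm_bound_ennreal)

text \<open>Jensen's inequality for the measure k dx of mass at most A. It follows from integrating
  \<open>young_powr_le\<close> with a constant l against k, so no Hoelder inequality for extended
  nonnegative integrals is involved.\<close>

lemma jensen_powr:
  fixes k a :: "'a::euclidean_space \<Rightarrow> real" and q A :: real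
  assumes [measurable]: "k \<in> borel_measurable borel" "a \<in> borel_measurable borel"
    and k: "\<And>x. k x \<ge> 0" and a: "\<And>x. a x \<ge> 0"
    and A: "A > 0" "(\<integral>\<^sup>+x. ennreal (k x) \<partial>lborel) \<le> ennreal A" and q: "q > 1"
    and c: "c \<ge> 0" "ennreal c \<le> (\<integral>\<^sup>+x. ennreal (k x * a x) \<partial>lborel)"
  shows "ennreal (c powr q) \<le> ennreal (A powr (q - 1)) * (\<integral>\<^sup>+x. ennreal (k x * a x powr q) \<partial>lborel)"
proof -
  let ?J = "\<integral>\<^sup>+x. ennreal (k x * a x powr q) \<partial>lborel"
  \<comment> \<open>The positive bound j replaces the integral itself, which may be zero and then
    would leave no admissible l.\<close>
  have *: "c powr q \<le> A powr (q - 1) * j" if j: "j > 0" "?J \<le> ennreal j" for j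
  proof -
    \<comment> \<open>This choice balances the two terms of Young's inequality: they become l A / q
      and (1 - 1/q) l A, which add up to l A.\<close>
    define l where "l = (j / A) powr (1 / q)"
    have l: "l > 0" using j A by (simp add: l_def)
    have lq: "l powr q = j / A" using j A q by (simp add: l_def powr_powr)
    have "ennreal c \<le> (\<integral>\<^sup>+x. ennreal (k x * a x) \<partial>lborel)" by (rule c)
    also have "\<dots> \<le> (\<integral>\<^sup>+x. ennreal ((1 / q) * l powr (1 - q)) * ennreal (k x * a x powr q) + ennreal ((1 - 1 / q) * l) * ennreal (k x) \<partial>lborel)"
    proof (intro nn_integral_mono)
      fix x
      have "k x * a x \<le> k x * ((1 / q) * l powr (1 - q) * a x powr q + (1 - 1 / q) * l)"
        by (intro mult_left_mono young_powr_le k a l q)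
      also have "\<dots> = ((1 / q) * l powr (1 - q)) * (k x * a x powr q) + ((1 - 1 / q) * l) * k x"
        by (simp add: algebra_simps)
      finally show "ennreal (k x * a x) \<le> ennreal ((1 / q) * l powr (1 - q)) * ennreal (k x * a x powr q) + ennreal ((1 - 1 / q) * l) * ennreal (k x)"
        using k[of x] q l by (simp flip: ennreal_mult ennreal_plus)
    qed
    also have "\<dots> = ennreal ((1 / q) * l powr (1 - q)) * ?J + ennreal ((1 - 1 / q) * l) * (\<integral>\<^sup>+x. ennreal (k x) \<partial>lborel)"
      by (subst nn_integral_add) (auto simp: nn_integral_cmult)
    also have "\<dots> \<le> ennreal ((1 / q) * l powr (1 - q)) * ennreal j + ennreal ((1 - 1 / q) * l) * ennreal A"
      by (intro add_mono mult_left_mono j A) auto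
    also have "\<dots> = ennreal ((1 / q) * l powr (1 - q) * j + (1 - 1 / q) * l * A)"
      using q l j A by (simp flip: ennreal_mult ennreal_plus)
    also have "(1 / q) * l powr (1 - q) * j + (1 - 1 / q) * l * A = l * A"
    proof -
      have "l powr (1 - q) = l / l powr q" using l by (simp add: powr_diff)
      also have "\<dots> = l * A / j" using lq j A by simp
      finally have "(1 / q) * l powr (1 - q) * j = (1 / q) * l * A" using j by simp
      then show ?thesis by (simp add: algebra_simps)
    qed
    finally have "c \<le> l * A" using l A by (simp add: ennreal_le_iff)
    then have "c powr q \<le> (l * A) powr q" using c q by (intro powr_mono2) auto
    also have "\<dots> = (j / A) * A powr q" using l A lq by (simp add: powr_mult)
    also have "\<dots> = A powr (q - 1) * j" using A by (simp add: powr_diff)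
    finally show ?thesis .
  qed
  show ?thesis
  \<comment> \<open>The slack e pays for taking j strictly larger than the integral.\<close>
  proof (rule ennreal_le_epsilon)
    fix e :: real assume fin: "ennreal (A powr (q - 1)) * ?J < top" and e: "0 < e"
    then have "?J < top" using A by (auto simp: ennreal_mult_less_top)
    then obtain j0 where j0: "?J = ennreal j0" "j0 \<ge> 0" by (cases ?J) auto
    define d where "d = e / A powr (q - 1)"
    have d: "d > 0" using e A by (simp add: d_def)
    have "c powr q \<le> A powr (q - 1) * (j0 + d)"
      using d j0 by (intro *) (auto intro!: ennreal_leI)
    also have "\<dots> = A powr (q - 1) * j0 + e" using A by (simp add: d_def distrib_left)
    finally have "ennreal (c powr q) \<le> ennreal (A powr (q - 1) * j0 + e)" by (rule ennreal_leI)
    also have "\<dots> = ennreal (A powr (q - 1)) * ?J + ennreal e"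
      using j0 e by (simp add: ennreal_mult ennreal_plus)
    finally show "ennreal (c powr q) \<le> ennreal (A powr (q - 1)) * ?J + ennreal e" .
  qed
qed

text \<open>Comparing r-th powers keeps the estimates at the level of nonnegative integrals, where
  the infinite case of \<open>Lp_norm\<close> needs no separate treatment.\<close>

lemma Lp_norm_le_iff:
  fixes u :: "real^'n::finite \<Rightarrow> 'a::real_normed_vector"
  assumes "r > 0" "M \<ge> 0"
  shows "Lp_norm (ennreal r) u \<le> ennreal M \<longleftrightarrow> (\<integral>\<^sup>+x. ennreal (norm (u x) powr r) \<partial>lborel) \<le> ennreal (M powr r)"
proof (cases "(\<integral>\<^sup>+x. ennreal (norm (u x) powr r) \<partial>lborel) = \<top>")
  case True
  then show ?thesis using assms by (simp add: Lp_norm_def top_unique)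
next
  case False
  then obtain I where I: "(\<integral>\<^sup>+x. ennreal (norm (u x) powr r) \<partial>lborel) = ennreal I" "I \<ge> 0"
    by (cases "(\<integral>\<^sup>+x. ennreal (norm (u x) powr r) \<partial>lborel)") auto
  have "I powr (1 / r) \<le> M \<longleftrightarrow> I \<le> M powr r"
  proof
    assume "I powr (1 / r) \<le> M"
    then have "(I powr (1 / r)) powr r \<le> M powr r" using assms by (intro powr_mono2) auto
    then show "I \<le> M powr r" using I assms by (simp add: powr_powr)
  next
    assume "I \<le> M powr r"
    then have "I powr (1 / r) \<le> (M powr r) powr (1 / r)" using I assms by (intro powr_mono2) auto
    then show "I powr (1 / r) \<le> M" using assms by (simp add: powr_powr)
  qed
  then show ?thesis using assms I by (simp add: Lp_norm_def ennreal_le_iff)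
qed

lemma Lp_norm_top_le:
  fixes u :: "real^'n::finite \<Rightarrow> 'a::real_normed_vector"
  assumes "(\<lambda>x. norm (u x)) \<in> borel_measurable lborel" "AE x in lborel. norm (u x) \<le> M"
  shows "Lp_norm \<top> u \<le> ennreal M"
proof -
  have "esssup lborel (\<lambda>x. ereal (norm (u x))) \<le> ereal M"
    using assms by (intro esssup_I) auto
  then have "e2ennreal (esssup lborel (\<lambda>x. ereal (norm (u x)))) \<le> e2ennreal (ereal M)"
    by (rule e2ennreal_mono)
  then show ?thesis by (simp add: Lp_norm_def)
qed

lemma AE_le_Lp_norm_top:
  fixes u :: "real^'n::finite \<Rightarrow> 'a::real_normed_vector"
  shows "AE x in lborel. ennreal (norm (u x)) \<le> Lp_norm \<top> u"
  using esssup_AE[of "\<lambda>x. ereal (norm (u x))" lborel]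
proof eventually_elim
  case (elim x)
  from e2ennreal_mono[OF this] show ?case by (simp add: Lp_norm_def)
qed

lemma Lp_norm_of_real [simp]: "Lp_norm p (\<lambda>x. complex_of_real (f x)) = Lp_norm p f"
  by (simp add: Lp_norm_def)

lemma Lp_norm_zero [simp]: "Lp_norm p (\<lambda>x. 0) = 0"
proof (cases "p = \<top>")
  case True
  then show ?thesis using Lp_norm_top_le[of "\<lambda>x::real^'a. 0::'b" 0] by simp
qed (simp add: Lp_norm_def)

text \<open>Each of the two terms satisfies x^r <= x (x + y)^(r - 1), as r - 1 >= 0.\<close>

lemma powr_superadd: "a powr r + b powr r \<le> (a + b) powr r" if "a \<ge> 0" "b \<ge> 0" "r \<ge> 1" for a b r :: real
proof -
  have *: "x powr r \<le> x * (x + y) powr (r - 1)" if "x \<ge> 0" "y \<ge> 0" for x y :: real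
  proof (cases "x = 0")
    case False
    then have "x powr r = x * x powr (r - 1)" using that by (simp add: powr_diff)
    also have "\<dots> \<le> x * (x + y) powr (r - 1)"
      using that \<open>r \<ge> 1\<close> by (intro mult_left_mono powr_mono2) auto
    finally show ?thesis .
  qed simp
  have "a powr r + b powr r \<le> a * (a + b) powr (r - 1) + b * (a + b) powr (r - 1)"
    using *[of a b] *[of b a] that by (simp add: add.commute)
  also have "\<dots> = (a + b) * (a + b) powr (r - 1)" by (simp add: algebra_simps)
  also have "\<dots> = (a + b) powr r"
    using that by (cases "a + b = 0") (auto simp: powr_diff)
  finally show ?thesis .
qed

text \<open>If a or b is infinite, so is the right-hand side, because c > 0; otherwise real bounds
  are available.\<close>

lemma ennreal_le_by_real_bounds:
  fixes x :: ennreal and a b c :: ennreal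
  assumes "\<And>M N. a \<le> ennreal M \<Longrightarrow> b \<le> ennreal N \<Longrightarrow> M \<ge> 0 \<Longrightarrow> N \<ge> 0 \<Longrightarrow> x \<le> c * (ennreal M + ennreal N)" "c > 0"
  shows "x \<le> c * (a + b)"
proof (cases "a = \<top> \<or> b = \<top>")
  case True
  then show ?thesis using \<open>c > 0\<close> by (auto simp: ennreal_mult_top)
next
  case False
  then obtain M N where "a = ennreal M" "b = ennreal N" "M \<ge> 0" "N \<ge> 0" by (cases a; cases b) auto
  then show ?thesis using assms(1)[of M N] by simp
qed

text \<open>A triangle inequality with factor 2 suffices, since constants are free. It comes from |u
  + v| <= 2 max(|u|, |v|) pointwise, and \<open>powr_superadd\<close> recombines the two norms;
  Minkowski's inequality is avoided.\<close>

lemma Lp_norm_add: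
  fixes u v :: "real^'n::finite \<Rightarrow> complex"
  assumes [measurable]: "u \<in> borel_measurable borel" "v \<in> borel_measurable borel" and p: "p \<ge> 1"
  shows "Lp_norm p (\<lambda>x. u x + v x) \<le> 2 * (Lp_norm p u + Lp_norm p v)"
proof (rule ennreal_le_by_real_bounds)
  fix M N assume M: "Lp_norm p u \<le> ennreal M" "M \<ge> 0" and N: "Lp_norm p v \<le> ennreal N" "N \<ge> 0"
  have eq: "2 * (ennreal M + ennreal N) = ennreal (2 * (M + N))"
    using M N by (simp add: ennreal_mult ennreal_plus)
  show "Lp_norm p (\<lambda>x. u x + v x) \<le> 2 * (ennreal M + ennreal N)"
  proof (cases "p = \<top>")
    case True
    have bd: "AE x in lborel. norm (w x) \<le> L" if "Lp_norm \<top> w \<le> ennreal L" "L \<ge> 0"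
      for w :: "real^'n \<Rightarrow> complex" and L
      using AE_le_Lp_norm_top[of w]
      by eventually_elim (use that in \<open>metis ennreal_le_iff order_trans\<close>)
    have u: "AE x in lborel. norm (u x) \<le> M" and v: "AE x in lborel. norm (v x) \<le> N"
      using M N True by (auto intro: bd)
    have "AE x in lborel. norm (u x + v x) \<le> 2 * (M + N)"
      using u v
    proof eventually_elim
      case (elim x)
      then have "norm (u x + v x) \<le> M + N"
        using norm_triangle_ineq[of "u x" "v x"] by (meson add_mono order_trans)
      also have "\<dots> \<le> 2 * (M + N)" using M(2) N(2) by simp
      finally show ?case .
    qed
    then show ?thesis unfolding eq True by (intro Lp_norm_top_le) auto
  next
    case False
    then obtain r where r: "p = ennreal r" "r \<ge> 1" using p by (cases p) auto
    have iu: "(\<integral>\<^sup>+x. ennreal (norm (u x) powr r) \<partial>lborel) \<le> ennreal (M powr r)"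
      and iv: "(\<integral>\<^sup>+x. ennreal (norm (v x) powr r) \<partial>lborel) \<le> ennreal (N powr r)"
      using Lp_norm_le_iff[of r M u] Lp_norm_le_iff[of r N v] M N r by auto
    have "(\<integral>\<^sup>+x. ennreal (norm (u x + v x) powr r) \<partial>lborel)
      \<le> (\<integral>\<^sup>+x. ennreal (2 powr r) * (ennreal (norm (u x) powr r) + ennreal (norm (v x) powr r)) \<partial>lborel)"
    proof (intro nn_integral_mono)
      fix x
      have "norm (u x + v x) powr r \<le> (2 * max (norm (u x)) (norm (v x))) powr r"
        using r norm_triangle_ineq[of "u x" "v x"] by (intro powr_mono2) auto
      also have "\<dots> = 2 powr r * max (norm (u x)) (norm (v x)) powr r"
        by (simp add: powr_mult max_def)
      also have "max (norm (u x)) (norm (v x)) powr r \<le> norm (u x) powr r + norm (v x) powr r"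
        by (auto simp: max_def)
      finally have "norm (u x + v x) powr r \<le> 2 powr r * (norm (u x) powr r + norm (v x) powr r)" by simp
      from ennreal_leI[OF this]
      show "ennreal (norm (u x + v x) powr r) \<le> ennreal (2 powr r) * (ennreal (norm (u x) powr r) + ennreal (norm (v x) powr r))"
        by (simp add: ennreal_mult ennreal_plus)
    qed
    also have "\<dots> = ennreal (2 powr r) * ((\<integral>\<^sup>+x. ennreal (norm (u x) powr r) \<partial>lborel) + (\<integral>\<^sup>+x. ennreal (norm (v x) powr r) \<partial>lborel))"
      by (simp add: nn_integral_cmult nn_integral_add)
    also have "\<dots> \<le> ennreal (2 powr r) * (ennreal (M powr r) + ennreal (N powr r))"
      by (intro mult_left_mono add_mono iu iv) auto
    also have "\<dots> = ennreal (2 powr r * (M powr r + N powr r))" by (simp add: ennreal_mult ennreal_plus)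
    also have "\<dots> \<le> ennreal ((2 * (M + N)) powr r)"
    proof (rule ennreal_leI)
      have "2 powr r * (M powr r + N powr r) \<le> 2 powr r * (M + N) powr r"
        using M(2) N(2) r(2) by (intro mult_left_mono powr_superadd) auto
      also have "\<dots> = (2 * (M + N)) powr r" using M(2) N(2) by (subst powr_mult) auto
      finally show "2 powr r * (M powr r + N powr r) \<le> (2 * (M + N)) powr r" .
    qed
    finally show ?thesis unfolding eq r(1) using M N r by (subst Lp_norm_le_iff) auto
  qed
qed simp

lemma Lp_norm_sum:
  fixes u :: "'i \<Rightarrow> real^'n::finite \<Rightarrow> complex"
  assumes "finite I" "\<And>i. i \<in> I \<Longrightarrow> u i \<in> borel_measurable borel" and p: "p \<ge> 1"
  shows "Lp_norm p (\<lambda>x. \<Sum>i\<in>I. u i x) \<le> 2 ^ card I * (\<Sum>i\<in>I. Lp_norm p (u i))"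
  using assms(1,2)
proof (induction I rule: finite_induct)
  case empty
  then show ?case by simp
next
  case (insert i I)
  have "Lp_norm p (\<lambda>x. u i x + (\<Sum>i\<in>I. u i x)) \<le> 2 * (Lp_norm p (u i) + Lp_norm p (\<lambda>x. \<Sum>i\<in>I. u i x))"
    by (intro Lp_norm_add p) (use insert in auto)
  also have "\<dots> \<le> 2 * (2 ^ card I * Lp_norm p (u i) + 2 ^ card I * (\<Sum>i\<in>I. Lp_norm p (u i)))"
  proof (intro mult_left_mono add_mono)
    have "1 * Lp_norm p (u i) \<le> 2 ^ card I * Lp_norm p (u i)"
      by (intro mult_right_mono one_le_power) (auto simp: one_le_numeral)
    then show "Lp_norm p (u i) \<le> 2 ^ card I * Lp_norm p (u i)" by simp
    show "Lp_norm p (\<lambda>x. \<Sum>i\<in>I. u i x) \<le> 2 ^ card I * (\<Sum>i\<in>I. Lp_norm p (u i))"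
      by (rule insert.IH) (use insert in auto)
  qed auto
  also have "\<dots> = 2 ^ card (insert i I) * (\<Sum>i\<in>insert i I. Lp_norm p (u i))"
    using insert by (simp add: distrib_left mult.assoc)
  finally show ?case using insert by simp
qed

section \<open>Convolution in Lebesgue spaces\<close>

lemma nn_integral_convolution:
  fixes K :: "'a::euclidean_space \<Rightarrow> ennreal"
  assumes [measurable]: "K \<in> borel_measurable borel" "w \<in> borel_measurable borel"
  shows "(\<integral>\<^sup>+x. (\<integral>\<^sup>+y. K (x - y) * w y \<partial>lborel) \<partial>lborel) = (\<integral>\<^sup>+x. K x \<partial>lborel) * (\<integral>\<^sup>+y. w y \<partial>lborel)"
proof -
  have "(\<integral>\<^sup>+x. (\<integral>\<^sup>+y. K (x - y) * w y \<partial>lborel) \<partial>lborel) = (\<integral>\<^sup>+y. (\<integral>\<^sup>+x. K (x - y) * w y \<partial>lborel) \<partial>lborel)"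
    using lborel_pair.Fubini[of "\<lambda>(x, y). K (x - y) * w y"] by simp
  also have "\<dots> = (\<integral>\<^sup>+y. (\<integral>\<^sup>+x. K x \<partial>lborel) * w y \<partial>lborel)"
    by (intro nn_integral_cong) (simp add: nn_integral_multc nn_integral_shift)
  also have "\<dots> = (\<integral>\<^sup>+x. K x \<partial>lborel) * (\<integral>\<^sup>+y. w y \<partial>lborel)" by (simp add: nn_integral_cmult)
  finally show ?thesis .
qed

lemma measurable_convolution [measurable]:
  fixes K u :: "'a::euclidean_space \<Rightarrow> complex"
  assumes [measurable]: "K \<in> borel_measurable borel" "u \<in> borel_measurable borel"
  shows "(\<lambda>x. LINT y|lborel. K (x - y) * u y) \<in> borel_measurable borel"
proof -
  have "(\<lambda>x. LINT y|lborel. K (x - y) * u y) \<in> borel_measurable lborel"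
    by (intro lborel.borel_measurable_lebesgue_integral) simp
  then show ?thesis by simp
qed

text \<open>Young's convolution inequality, with the L^r norm of the kernel (1/r = 1 - \<theta>) replaced by
  the interpolation of its L^1 and sup norms.\<close>

lemma Lp_norm_convolution:
  fixes K u :: "real^'n::finite \<Rightarrow> complex"
  assumes [measurable]: "K \<in> borel_measurable borel" "u \<in> borel_measurable borel"
    and A: "A > 0" "(\<integral>\<^sup>+x. ennreal (norm (K x)) \<partial>lborel) \<le> ennreal A"
    and B: "B > 0" "\<And>x. norm (K x) \<le> B"
    and pq: "1 < q" "q \<le> p" "q \<noteq> \<top>"
  defines "\<theta> \<equiv> enn2real (1/q) - enn2real (1/p)"
  shows "Lp_norm p (\<lambda>x. LINT y|lborel. K (x - y) * u y) \<le> ennreal (A powr (1 - \<theta>) * B powr \<theta>) * Lp_norm q u"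
proof (cases "Lp_norm q u = \<top>")
  case True
  then show ?thesis using A B by (simp add: ennreal_mult_top)
next
  case False
  let ?v = "\<lambda>x. LINT y|lborel. K (x - y) * u y"
  obtain M where M: "Lp_norm q u = ennreal M" "M \<ge> 0" using False by (cases "Lp_norm q u") auto
  obtain r where r: "q = ennreal r" "r \<ge> 0" using pq by (cases q) auto
  have r1: "r > 1" using pq r by (simp add: ennreal_1[symmetric] ennreal_less_iff del: ennreal_1)
  have iq: "enn2real (1/q) = 1 / r"
    using r1 unfolding r by (simp add: ennreal_1[symmetric] divide_ennreal del: ennreal_1)
  let ?J = "\<lambda>x. \<integral>\<^sup>+y. ennreal (norm (K (x - y))) * ennreal (norm (u y) powr r) \<partial>lborel"
  have iu: "(\<integral>\<^sup>+x. ennreal (norm (u x) powr r) \<partial>lborel) \<le> ennreal (M powr r)"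
    using Lp_norm_le_iff[of r M u] M r r1 by auto
  \<comment> \<open>Jensen with respect to |K(x - y)| dy, a measure of mass at most A for every
    x.\<close>
  have pt: "ennreal (norm (?v x) powr r) \<le> ennreal (A powr (r - 1)) * ?J x" for x
  proof -
    have "ennreal (norm (?v x) powr r) \<le> ennreal (A powr (r - 1)) * (\<integral>\<^sup>+y. ennreal (norm (K (x - y)) * norm (u y) powr r) \<partial>lborel)"
    proof (rule jensen_powr)
      show "(\<integral>\<^sup>+y. ennreal (norm (K (x - y))) \<partial>lborel) \<le> ennreal A"
        using A nn_integral_reflect[of "\<lambda>y. ennreal (norm (K y))" x] by simp
      show "ennreal (norm (?v x)) \<le> (\<integral>\<^sup>+y. ennreal (norm (K (x - y)) * norm (u y)) \<partial>lborel)"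
        using norm_integral_le_nn_integral[of lborel "\<lambda>y. K (x - y) * u y"] by (simp add: norm_mult)
    qed (use A r1 in auto)
    then show ?thesis by (simp add: ennreal_mult)
  qed
  \<comment> \<open>The endpoint p = \<infinity>: bounding the remaining kernel by B leaves the norm
    of u.\<close>
  have sup: "norm (?v x) \<le> (A powr (r - 1) * B) powr (1 / r) * M" for x
  proof -
    have "?J x \<le> (\<integral>\<^sup>+y. ennreal B * ennreal (norm (u y) powr r) \<partial>lborel)"
      by (intro nn_integral_mono mult_right_mono ennreal_leI B) auto
    also have "\<dots> \<le> ennreal B * ennreal (M powr r)"
      using iu by (subst nn_integral_cmult) (auto intro!: mult_left_mono)
    finally have "ennreal (norm (?v x) powr r) \<le> ennreal (A powr (r - 1)) * (ennreal B * ennreal (M powr r))"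
      using pt[of x] by (meson dual_order.trans mult_left_mono zero_le)
    also have "\<dots> = ennreal (A powr (r - 1) * B * M powr r)" using B by (simp add: ennreal_mult mult.assoc)
    finally have "norm (?v x) powr r \<le> A powr (r - 1) * B * M powr r" using B by (subst (asm) ennreal_le_iff) auto
    then have "(norm (?v x) powr r) powr (1 / r) \<le> (A powr (r - 1) * B * M powr r) powr (1 / r)"
      using r1 by (intro powr_mono2) auto
    then show ?thesis using r1 M B by (simp add: powr_powr powr_mult)
  qed
  \<comment> \<open>The endpoint p = q: Tonelli splits off the L^1 norm of the kernel.\<close>
  have int: "(\<integral>\<^sup>+x. ennreal (norm (?v x) powr r) \<partial>lborel) \<le> ennreal (A powr r * M powr r)"
  proof -
    have "(\<integral>\<^sup>+x. ennreal (norm (?v x) powr r) \<partial>lborel) \<le> (\<integral>\<^sup>+x. ennreal (A powr (r - 1)) * ?J x \<partial>lborel)"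
      by (intro nn_integral_mono pt)
    also have "\<dots> = ennreal (A powr (r - 1)) * ((\<integral>\<^sup>+x. ennreal (norm (K x)) \<partial>lborel) * (\<integral>\<^sup>+x. ennreal (norm (u x) powr r) \<partial>lborel))"
      by (subst nn_integral_cmult, simp, subst nn_integral_convolution[of "\<lambda>x. ennreal (norm (K x))"]) auto
    also have "\<dots> \<le> ennreal (A powr (r - 1)) * (ennreal A * ennreal (M powr r))"
      by (intro mult_left_mono mult_mono A iu) auto
    also have "\<dots> = ennreal (A powr r * M powr r)"
      using A by (simp add: powr_diff flip: ennreal_mult)
    finally show ?thesis .
  qed
  show ?thesis
  proof (cases "p = \<top>")
    case True
    have th: "\<theta> = 1 / r" unfolding \<theta>_def iq True by simp
    have "(A powr (r - 1) * B) powr (1 / r) = A powr (1 - \<theta>) * B powr \<theta>"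
      using A B r1 by (simp add: th powr_mult powr_powr diff_divide_distrib)
    then show ?thesis unfolding True M using sup M
      by (subst ennreal_mult[symmetric]) (auto intro!: Lp_norm_top_le)
  next
    case False
    then obtain s where s: "p = ennreal s" "s \<ge> 0" by (cases p) auto
    have rs: "r \<le> s" using pq(2) s r by (simp add: ennreal_le_iff)
    have ip: "enn2real (1/p) = 1 / s"
      using r1 rs unfolding s by (simp add: ennreal_1[symmetric] divide_ennreal del: ennreal_1)
    have th: "\<theta> = 1 / r - 1 / s" unfolding \<theta>_def iq ip by simp
    let ?S = "(A powr (r - 1) * B) powr (1 / r) * M"
    \<comment> \<open>Between the endpoints the power s is split as (s - r) + r; the sup estimate
      takes the first part and the L^r estimate the second.\<close>
    have "(\<integral>\<^sup>+x. ennreal (norm (?v x) powr s) \<partial>lborel) \<le> (\<integral>\<^sup>+x. ennreal (?S powr (s - r)) * ennreal (norm (?v x) powr r) \<partial>lborel)"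
    proof (intro nn_integral_mono)
      fix x
      have "norm (?v x) powr s = norm (?v x) powr (s - r) * norm (?v x) powr r"
        by (simp flip: powr_add)
      also have "\<dots> \<le> ?S powr (s - r) * norm (?v x) powr r"
        by (intro mult_right_mono powr_mono2 sup) (use rs in auto)
      finally show "ennreal (norm (?v x) powr s) \<le> ennreal (?S powr (s - r)) * ennreal (norm (?v x) powr r)"
        by (simp flip: ennreal_mult)
    qed
    also have "\<dots> = ennreal (?S powr (s - r)) * (\<integral>\<^sup>+x. ennreal (norm (?v x) powr r) \<partial>lborel)"
      by (rule nn_integral_cmult) simp
    also have "\<dots> \<le> ennreal (?S powr (s - r)) * ennreal (A powr r * M powr r)"
      by (intro mult_left_mono int) auto
    also have "\<dots> = ennreal (?S powr (s - r) * (A powr r * M powr r))" by (simp flip: ennreal_mult)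
    also have "?S powr (s - r) * (A powr r * M powr r) = (A powr (1 - \<theta>) * B powr \<theta> * M) powr s"
    proof (cases "M = 0")
      case False
      \<comment> \<open>These identities turn the collected exponents of A and B into s times 1 -
        \<theta> and s times \<theta>.\<close>
      have e1: "(r - 1) / r * (s - r) + r = (1 - \<theta>) * s" and e2: "(s - r) / r = \<theta> * s"
        using r1 rs by (simp_all add: th field_simps)
      have "?S powr (s - r) * (A powr r * M powr r)
         = A powr ((r - 1) / r * (s - r) + r) * B powr ((s - r) / r) * (M powr (s - r) * M powr r)"
        using A B M r1 by (simp add: powr_mult powr_powr powr_add)
      also have "M powr (s - r) * M powr r = M powr s" by (simp flip: powr_add)
      finally show ?thesis unfolding e1 e2 using A B M by (simp add: powr_mult powr_powr)
    qed (use r1 rs in auto)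
    finally have "Lp_norm p ?v \<le> ennreal (A powr (1 - \<theta>) * B powr \<theta> * M)"
      unfolding s(1) using M r1 rs by (subst Lp_norm_le_iff) auto
    then show ?thesis unfolding M by (simp add: ennreal_mult M)
  qed
qed

section \<open>Convolution operators and weak derivatives\<close>

text \<open>A common home for the data of every finite exponent above 1: exactly what makes the
  integral against a Schwartz kernel absolutely convergent. Differentiation and weak derivatives can
  then be treated without mentioning q.\<close>

definition weighted_integrable :: "(real^'n::finite \<Rightarrow> complex) \<Rightarrow> bool" where
  "weighted_integrable u \<longleftrightarrow> u \<in> borel_measurable borel \<and> integrable lborel (\<lambda>y. norm (u y) / weight y)"

lemma weighted_integrable_measurable [measurable_dest]: "weighted_integrable u \<Longrightarrow> u \<in> borel_measurable borel"
  by (simp add: weighted_integrable_def)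

text \<open>Pointwise |f| <= |f|^r + 1; the power is integrable by assumption and the constant
  becomes integrable after division by \<open>weight\<close>.\<close>

lemma Lp_norm_finite_weighted_integrable:
  fixes f :: "real^'n::finite \<Rightarrow> real"
  assumes f[measurable]: "f \<in> borel_measurable lborel" and q: "1 < q" "q \<noteq> \<top>" and fin: "Lp_norm q f \<noteq> \<top>"
  shows "weighted_integrable (\<lambda>y. complex_of_real (f y))"
proof -
  obtain r where r: "q = ennreal r" "r \<ge> 0" using q by (cases q) auto
  have r1: "r > 1" using q r by (simp add: ennreal_1[symmetric] ennreal_less_iff del: ennreal_1)
  obtain M where M: "Lp_norm q f = ennreal M" "M \<ge> 0" using fin by (cases "Lp_norm q f") auto
  have "(\<integral>\<^sup>+x. ennreal (norm (f x) powr r) \<partial>lborel) \<le> ennreal (M powr r)"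
    using Lp_norm_le_iff[of r M f] M r r1 by auto
  then have "(\<integral>\<^sup>+x. ennreal (norm (f x) powr r) \<partial>lborel) < \<infinity>" by (simp add: order_le_less_trans)
  then have i: "integrable lborel (\<lambda>x. norm (f x) powr r)" by (intro integrableI_bounded) auto
  have "integrable lborel (\<lambda>y. norm (complex_of_real (f y)) / weight y)"
  proof (rule Bochner_Integration.integrable_bound)
    show "integrable lborel (\<lambda>y. norm (f y) powr r + 1 / weight y)"
      by (intro Bochner_Integration.integrable_add i integrable_inv_weight)
    show "AE y in lborel. norm (norm (complex_of_real (f y)) / weight y) \<le> norm (norm (f y) powr r + 1 / weight y)"
    proof (rule AE_I2)
      fix y
      have "\<bar>f y\<bar> \<le> \<bar>f y\<bar> powr r + 1"
      proof (cases "\<bar>f y\<bar> \<le> 1")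
        case False
        then have "\<bar>f y\<bar> powr 1 \<le> \<bar>f y\<bar> powr r" using r1 by (intro powr_mono) auto
        then show ?thesis using False by simp
      qed (simp add: add_increasing)
      then have "\<bar>f y\<bar> / weight y \<le> (\<bar>f y\<bar> powr r + 1) / weight y" by (intro divide_right_mono) auto
      also have "\<dots> = \<bar>f y\<bar> powr r / weight y + 1 / weight y" by (simp add: add_divide_distrib)
      also have "\<bar>f y\<bar> powr r / weight y \<le> \<bar>f y\<bar> powr r"
        using weight_ge_1[of y] by (simp add: divide_le_eq mult_left_le_one_le mult_le_cancel_left1)
      finally show "norm (norm (complex_of_real (f y)) / weight y) \<le> norm (norm (f y) powr r + 1 / weight y)" by simp
    qed
  qed simp
  then show ?thesis using f by (simp add: weighted_integrable_def)
qed

lemma integrable_schwartz_weighted_integrable: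
  assumes w: "schwartz w" and u: "weighted_integrable u" shows "integrable lborel (\<lambda>y. w y * u y)"
proof -
  have [measurable]: "w \<in> borel_measurable borel" "u \<in> borel_measurable borel"
    using w u by (auto intro: schwartz_measurable weighted_integrable_measurable)
  obtain C where C: "C > 0" "\<And>x. norm (w x) \<le> C / weight x" using schwartz_le_weight[OF w] by blast
  show ?thesis
  proof (rule Bochner_Integration.integrable_bound)
    show "integrable lborel (\<lambda>y. C * (norm (u y) / weight y))" using u by (intro integrable_mult_right) (simp add: weighted_integrable_def)
    show "AE y in lborel. norm (w y * u y) \<le> norm (C * (norm (u y) / weight y))"
    proof (rule AE_I2)
      fix y
      show "norm (w y * u y) \<le> norm (C * (norm (u y) / weight y))"
        using mult_right_mono[OF C(2)[of y], of "norm (u y)"] C(1) by (simp add: norm_mult)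
    qed
  qed simp
qed

lemma schwartz_reflect: "schwartz K \<Longrightarrow> schwartz (\<lambda>y. K (x - y))"
  using schwartz_affine[of K "-1" x] by simp

lemma integrable_convolution:
  "schwartz K \<Longrightarrow> weighted_integrable u \<Longrightarrow> integrable lborel (\<lambda>y. K (x - y) * u y)"
  by (intro integrable_schwartz_weighted_integrable schwartz_reflect)

lemma schwartz_freq: "schwartz m \<Longrightarrow> schwartz (\<lambda>\<xi>. \<i> * complex_of_real (\<xi>$k) * m \<xi>)"
  unfolding mult.assoc by (intro schwartz_cmult schwartz_coord)

lemma has_partial_conv_op:
  fixes m :: "real^'n::finite \<Rightarrow> complex"
  assumes m: "schwartz m" and u: "weighted_integrable u"
  shows "has_partial k (conv_op m u) (conv_op (\<lambda>\<xi>. \<i> * of_real (\<xi>$k) * m \<xi>) u)"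
  unfolding has_partial_def
proof
  fix x :: "real^'n"
  let ?m' = "\<lambda>\<xi>. \<i> * of_real (\<xi>$k) * m \<xi>"
  have K: "schwartz (ift m)" and K': "schwartz (ift ?m')" using m by (auto intro: schwartz_ift schwartz_freq)
  have [measurable]: "ift m \<in> borel_measurable borel" "ift ?m' \<in> borel_measurable borel" "u \<in> borel_measurable borel"
    using K K' u by (auto intro: schwartz_measurable weighted_integrable_measurable)
  obtain C where C: "C > 0" "\<And>x. norm (ift ?m' x) \<le> C / weight x" using schwartz_le_weight[OF K'] by blast
  \<comment> \<open>The first group of factors pays for a step |s| <= 1 along the axis, the second
    for moving the centre of the majorant from x to the origin.\<close>
  let ?D = "C * (2 * 2 ^ CARD('n)) * (2 ^ CARD('n) * weight x)"
  have "((\<lambda>s. LINT y|lborel. ift m (x + s *\<^sub>R axis k 1 - y) * u y) has_vector_derivative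
      (LINT y|lborel. ift ?m' (x + 0 *\<^sub>R axis k 1 - y) * u y)) (at 0)"
  proof (rule has_vector_derivative_integral[where w = "\<lambda>y. ?D * (norm (u y) / weight y)"])
    show "integrable lborel (\<lambda>y. ift m (x + s *\<^sub>R axis k 1 - y) * u y)" for s
      by (rule integrable_convolution[OF K u])
    show "integrable lborel (\<lambda>y. ?D * (norm (u y) / weight y))" using u by (intro integrable_mult_right) (simp add: weighted_integrable_def)
    show "norm (ift ?m' (x + s *\<^sub>R axis k 1 - y) * u y) \<le> ?D * (norm (u y) / weight y)" if "\<bar>s\<bar> \<le> 1" for s y
    proof -
      have "norm (ift ?m' ((x - y) + s *\<^sub>R axis k 1)) \<le> C * (2 * 2 ^ CARD('n)) * (1 / weight (x - y))"
        by (rule weight_bound_shift_axis[OF C(2)]) (use that C in auto)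
      also have "\<dots> \<le> C * (2 * 2 ^ CARD('n)) * (2 ^ CARD('n) * weight x / weight y)"
        using C by (intro mult_left_mono inv_weight_shift) auto
      finally have "norm (ift ?m' ((x - y) + s *\<^sub>R axis k 1)) * norm (u y) \<le> C * (2 * 2 ^ CARD('n)) * (2 ^ CARD('n) * weight x / weight y) * norm (u y)"
        by (rule mult_right_mono) auto
      then show ?thesis by (simp add: norm_mult algebra_simps)
    qed
    show "((\<lambda>s. ift m (x + s *\<^sub>R axis k 1 - y) * u y) has_vector_derivative ift ?m' (x + s *\<^sub>R axis k 1 - y) * u y) (at s)" for s y
      using has_vector_derivative_mult_left[OF has_partial_at[OF has_partial_ift[OF m], of "x - y" k s], of "u y"]
      by (simp add: algebra_simps)
  qed auto
  then show "((\<lambda>s. conv_op m u (x + s *\<^sub>R axis k 1)) has_vector_derivative conv_op ?m' u x) (at 0)"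
    by (simp add: conv_op_def)
qed

text \<open>The Fourier symbol of \<open>partials ks\<close>. Lists take the place of multi-indices
  and follow the recursion of \<open>partials\<close>.\<close>

fun freq_monomial :: "'n::finite list \<Rightarrow> real^'n \<Rightarrow> complex" where
  "freq_monomial [] \<xi> = 1"
| "freq_monomial (k # ks) \<xi> = \<i> * of_real (\<xi>$k) * freq_monomial ks \<xi>"

lemma schwartz_freq_monomial: "schwartz m \<Longrightarrow> schwartz (\<lambda>\<xi>. freq_monomial ks \<xi> * m \<xi>)"
proof (induction ks)
  case (Cons k ks)
  then have "schwartz (\<lambda>\<xi>. \<i> * complex_of_real (\<xi>$k) * (freq_monomial ks \<xi> * m \<xi>))" by (intro schwartz_freq) auto
  then show ?case by (simp add: mult.assoc)
qed simp

lemma freq_monomial_scaleR: "freq_monomial ks (r *\<^sub>R \<xi>) = of_real (r ^ length ks) * freq_monomial ks \<xi>"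
  by (induction ks) (auto simp: mult_ac)

lemma partials_sum_conv_op:
  assumes "\<And>i. i \<in> I \<Longrightarrow> schwartz (m i)" "\<And>i. i \<in> I \<Longrightarrow> weighted_integrable (u i)"
  shows "partials ks (\<lambda>x. \<Sum>i\<in>I. conv_op (m i) (u i) x) = (\<lambda>x. \<Sum>i\<in>I. conv_op (\<lambda>\<xi>. freq_monomial ks \<xi> * m i \<xi>) (u i) x)"
proof (induction ks)
  case (Cons k ks)
  have "has_partial k (\<lambda>x. \<Sum>i\<in>I. conv_op (\<lambda>\<xi>. freq_monomial ks \<xi> * m i \<xi>) (u i) x)
     (\<lambda>x. \<Sum>i\<in>I. conv_op (\<lambda>\<xi>. \<i> * of_real (\<xi>$k) * (freq_monomial ks \<xi> * m i \<xi>)) (u i) x)"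
    by (intro has_partial_sum has_partial_conv_op schwartz_freq_monomial assms)
  from has_partial_imp_partial[OF this] show ?case using Cons by (simp add: mult.assoc)
qed simp

lemma measurable_conv_op:
  assumes "schwartz m" "weighted_integrable u" shows "conv_op m u \<in> borel_measurable borel"
  unfolding conv_op_def[abs_def]
  by (intro measurable_convolution schwartz_measurable schwartz_ift weighted_integrable_measurable assms)

text \<open>\<open>L\<close> will be \<open>Re\<close> or \<open>Im\<close>: the test functions of
  \<open>weak_partial\<close> are real, while the kernels are complex.\<close>

lemma partials_Re_Im:
  assumes L: "bounded_linear (L :: complex \<Rightarrow> real)" and w: "schwartz w"
  shows "schwartz (partials ks w) \<and> partials ks (\<lambda>x. L (w x)) = (\<lambda>x. L (partials ks w x))"
proof (induction ks)
  case Nil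
  then show ?case using w by simp
next
  case (Cons k ks)
  then have s: "schwartz (partials ks w)" by simp
  show ?case
    using has_partial_imp_partial[OF has_partial_linear[OF L schwartz_has_partial[OF s, of k]]] Cons schwartz_partial[OF s, of k]
    by simp
qed

lemma smooth_fn_Re_Im:
  assumes L: "bounded_linear (L :: complex \<Rightarrow> real)" and w: "schwartz w"
  shows "smooth_fn (\<lambda>x. L (w x))"
  unfolding smooth_fn_def
proof (intro conjI allI)
  fix ks k x
  have s: "schwartz (partials ks w)" and e: "partials ks (\<lambda>x. L (w x)) = (\<lambda>x. L (partials ks w x))"
    using partials_Re_Im[OF assms] by auto
  show "continuous_on UNIV (partials ks (\<lambda>x. L (w x)))"
    unfolding e by (intro bounded_linear.continuous_on[OF L] schwartz_continuous s)
  show "(\<lambda>s. partials ks (\<lambda>x. L (w x)) (x + s *\<^sub>R axis k 1)) differentiable at 0"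
    using has_partial_linear[OF L schwartz_has_partial[OF s, of k]] unfolding e has_partial_def
    by (meson differentiableI_vector)
qed

text \<open>The weak derivative is tested separately with the real and the imaginary part of w, and
  the two identities are put together again.\<close>

lemma weak_partial_schwartz:
  fixes f h :: "real^'n::finite \<Rightarrow> real"
  assumes weak: "weak_partial k f h" and f: "weighted_integrable (\<lambda>y. complex_of_real (f y))" and h: "weighted_integrable (\<lambda>y. complex_of_real (h y))"
    and w: "schwartz w" and supp: "\<And>y. R < norm y \<Longrightarrow> w y = 0"
  shows "(LINT y|lborel. partial k w y * of_real (f y)) = - (LINT y|lborel. w y * of_real (h y))"
proof -
  have *: "(LINT y|lborel. f y * L (partial k w y)) = - (LINT y|lborel. h y * L (w y))"
    if L: "bounded_linear (L :: complex \<Rightarrow> real)" for L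
  proof -
    have "{x. L (w x) \<noteq> 0} \<subseteq> cball 0 R"
      using supp linear_simps(3)[OF L] by (force simp: not_less[symmetric])
    then have "bounded {x. L (w x) \<noteq> 0}" by (rule bounded_subset[OF bounded_cball])
    then have "test_fn (\<lambda>x. L (w x))" unfolding test_fn_def using smooth_fn_Re_Im[OF L w] by simp
    moreover have "partial k (\<lambda>x. L (w x)) = (\<lambda>x. L (partial k w x))"
      by (rule has_partial_imp_partial[OF has_partial_linear[OF L schwartz_has_partial[OF w]]])
    ultimately show ?thesis using weak unfolding weak_partial_def by auto
  qed
  have i1: "integrable lborel (\<lambda>y. partial k w y * of_real (f y))"
    by (rule integrable_schwartz_weighted_integrable[OF schwartz_partial[OF w] f])
  have i2: "integrable lborel (\<lambda>y. w y * of_real (h y))"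
    by (rule integrable_schwartz_weighted_integrable[OF w h])
  show ?thesis
  proof (rule complex_eqI)
    show "Re (LINT y|lborel. partial k w y * of_real (f y)) = Re (- (LINT y|lborel. w y * of_real (h y)))"
      unfolding uminus_complex.sel integral_Re[OF i1, symmetric] integral_Re[OF i2, symmetric]
      using *[OF bounded_linear_Re] by (simp add: mult.commute del: integral_Re)
    show "Im (LINT y|lborel. partial k w y * of_real (f y)) = Im (- (LINT y|lborel. w y * of_real (h y)))"
      unfolding uminus_complex.sel integral_Im[OF i1, symmetric] integral_Im[OF i2, symmetric]
      using *[OF bounded_linear_Im] by (simp add: mult.commute del: integral_Im)
  qed
qed

lemma schwartz_bounded: "schwartz u \<Longrightarrow> \<exists>B>0. \<forall>x. norm (u x) \<le> B"
  using rapid_bound[OF schwartz_rapid, of u 0] by simp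

text \<open>The test functions are K(x - y) \<phi>(y/R) with R tending to infinity.\<close>

lemma conv_op_weak_partial:
  fixes f h \<phi> :: "real^'n::finite \<Rightarrow> real"
  assumes m: "schwartz m" and weak: "weak_partial k f h"
    and f: "weighted_integrable (\<lambda>y. complex_of_real (f y))" and h: "weighted_integrable (\<lambda>y. complex_of_real (h y))"
    and \<phi>: "cutoff \<epsilon> \<phi>" and \<epsilon>: "\<epsilon> > 0"
  shows "conv_op (\<lambda>\<xi>. \<i> * of_real (\<xi>$k) * m \<xi>) (\<lambda>y. of_real (f y)) = conv_op m (\<lambda>y. of_real (h y))"
proof
  fix x :: "real^'n"
  define K where "K = ift m"
  define K' where "K' = ift (\<lambda>\<xi>. \<i> * of_real (\<xi>$k) * m \<xi>)"
  \<comment> \<open>The frequency cutoff serves here as a truncation in physical space.\<close>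
  define X where "X y = complex_of_real (\<phi> y)" for y
  \<comment> \<open>Starting at 1 keeps 1 / R n <= 1 and so yields a majorant independent of
    n.\<close>
  define R where "R n = real n + 1" for n :: nat
  have R: "R n > 0" for n by (simp add: R_def)
  have R0: "(\<lambda>n. 1 / R n) \<longlonglongrightarrow> 0"
    using LIMSEQ_inverse_real_of_nat by (simp add: R_def divide_inverse add.commute)
  have K: "schwartz K" "schwartz K'" unfolding K_def K'_def using m by (auto intro: schwartz_ift schwartz_freq)
  have KK: "has_partial k K K'" unfolding K_def K'_def by (rule has_partial_ift[OF m])
  have X: "schwartz X" unfolding X_def
    using \<phi> by (intro schwartz_test_fn[where R = "2 * \<epsilon>"]) (auto simp: cutoff_def)
  have X0: "X 0 = 1" using \<phi> \<epsilon> by (simp add: cutoff_def X_def)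
  have Xs: "X y = 0" if "2 * \<epsilon> < norm y" for y using that \<phi> by (simp add: cutoff_def X_def)
  obtain B where B: "B > 0" "\<And>y. norm (X y) \<le> B" using schwartz_bounded[OF X] by blast
  obtain D where D: "D > 0" "\<And>y. norm (partial k X y) \<le> D" using schwartz_bounded[OF schwartz_partial[OF X]] by blast
  define w where "w n y = K (x - y) * X ((1 / R n) *\<^sub>R y)" for n y
  have w: "schwartz (w n)" for n unfolding w_def
    using R[of n] by (intro schwartz_mult schwartz_reflect K schwartz_scale X) auto
  \<comment> \<open>The two terms have different fates: the derivative of the cutoff carries 1 / R
    n, while the derivative of the reflected kernel gives -K' and survives.\<close>
  have pw: "partial k (w n) = (\<lambda>y. K (x - y) * (of_real (1 / R n) * partial k X ((1 / R n) *\<^sub>R y)) - K' (x - y) * X ((1 / R n) *\<^sub>R y))" for n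
  proof -
    have 1: "has_partial k (\<lambda>y. K (x - y)) (\<lambda>y. - K' (x - y))"
      using has_partial_affine[OF KK, of x "-1"] by simp
    have 2: "has_partial k (\<lambda>y. X ((1 / R n) *\<^sub>R y)) (\<lambda>y. of_real (1 / R n) * partial k X ((1 / R n) *\<^sub>R y))"
      using has_partial_affine[OF schwartz_has_partial[OF X, of k], of 0 "1 / R n"] by (simp add: scaleR_conv_of_real)
    show ?thesis unfolding w_def using has_partial_imp_partial[OF has_partial_mult[OF 1 2]] by simp
  qed
  have wi: "(LINT y|lborel. partial k (w n) y * of_real (f y)) = - (LINT y|lborel. w n y * of_real (h y))" for n
  proof (rule weak_partial_schwartz[OF weak f h w])
    fix y :: "real^'n" assume "R n * (2 * \<epsilon>) < norm y"
    then show "w n y = 0" using R[of n] by (auto simp: w_def field_simps intro!: Xs)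
  qed
  have limX: "(\<lambda>n. X ((1 / R n) *\<^sub>R y)) \<longlonglongrightarrow> 1" for y
  proof -
    have "(\<lambda>n. X ((1 / R n) *\<^sub>R y)) \<longlonglongrightarrow> X (0 *\<^sub>R y)"
      by (rule continuous_on_tendsto_compose[OF schwartz_continuous[OF X, of UNIV]])
         (intro tendsto_intros R0, auto)
    then show ?thesis by (simp add: X0)
  qed
  have fm: "(\<lambda>y. complex_of_real (f y)) \<in> borel_measurable borel" "(\<lambda>y. complex_of_real (h y)) \<in> borel_measurable borel"
    using f h by (auto intro: weighted_integrable_measurable)
  have iK: "integrable lborel (\<lambda>y. K (x - y) * of_real (f y))" "integrable lborel (\<lambda>y. K' (x - y) * of_real (f y))"
     "integrable lborel (\<lambda>y. K (x - y) * of_real (h y))"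
    by (rule integrable_convolution[OF K(1) f] integrable_convolution[OF K(2) f] integrable_convolution[OF K(1) h])+
  have l1: "(\<lambda>n. LINT y|lborel. partial k (w n) y * of_real (f y)) \<longlonglongrightarrow> (LINT y|lborel. - (K' (x - y) * of_real (f y)))"
  proof (rule integral_dominated_convergence[where w = "\<lambda>y. D * norm (K (x - y) * of_real (f y)) + B * norm (K' (x - y) * of_real (f y))"])
    show "integrable lborel (\<lambda>y. D * norm (K (x - y) * of_real (f y)) + B * norm (K' (x - y) * of_real (f y)))"
      using iK by (intro Bochner_Integration.integrable_add integrable_mult_right integrable_norm)
    show "(\<lambda>y. - (K' (x - y) * of_real (f y))) \<in> borel_measurable lborel" using iK(2) by simp
    show "(\<lambda>y. partial k (w n) y * of_real (f y)) \<in> borel_measurable lborel" for n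
      using integrable_schwartz_weighted_integrable[OF schwartz_partial[OF w] f] by simp
    show "AE y in lborel. (\<lambda>n. partial k (w n) y * of_real (f y)) \<longlonglongrightarrow> - (K' (x - y) * of_real (f y))"
    proof (rule AE_I2)
      fix y
      \<comment> \<open>Boundedness of the derivative of X is enough here: the factor 1 / R n forces
        the limit 0.\<close>
      have "(\<lambda>n. of_real (1 / R n) * partial k X ((1 / R n) *\<^sub>R y)) \<longlonglongrightarrow> 0"
      proof (rule Lim_null_comparison[where g = "\<lambda>n. (1 / R n) * D"])
        show "\<forall>\<^sub>F n in sequentially. norm (of_real (1 / R n) * partial k X ((1 / R n) *\<^sub>R y)) \<le> 1 / R n * D"
          using R D(2) by (intro always_eventually allI) (simp add: norm_mult norm_divide abs_of_pos divide_right_mono less_imp_le)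
        show "(\<lambda>n. 1 / R n * D) \<longlonglongrightarrow> 0" using tendsto_mult_right[OF R0, of D] by simp
      qed
      then have "(\<lambda>n. (K (x - y) * (of_real (1 / R n) * partial k X ((1 / R n) *\<^sub>R y)) - K' (x - y) * X ((1 / R n) *\<^sub>R y)) * of_real (f y))
          \<longlonglongrightarrow> (K (x - y) * 0 - K' (x - y) * 1) * of_real (f y)"
        by (intro tendsto_intros limX)
      then show "(\<lambda>n. partial k (w n) y * of_real (f y)) \<longlonglongrightarrow> - (K' (x - y) * of_real (f y))" by (simp add: pw)
    qed
    show "AE y in lborel. norm (partial k (w n) y * of_real (f y)) \<le> D * norm (K (x - y) * of_real (f y)) + B * norm (K' (x - y) * of_real (f y))" for n
    proof (rule AE_I2)
      fix y
      have "norm (of_real (1 / R n) * partial k X ((1 / R n) *\<^sub>R y)) \<le> 1 * D"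
        unfolding norm_mult norm_of_real using D(2) R[of n] by (intro mult_mono) (auto simp: R_def)
      then have "norm (K (x - y) * (of_real (1 / R n) * partial k X ((1 / R n) *\<^sub>R y))) \<le> norm (K (x - y)) * D"
        unfolding norm_mult[of "K (x - y)"] by (intro mult_left_mono) auto
      moreover have "norm (K' (x - y) * X ((1 / R n) *\<^sub>R y)) \<le> norm (K' (x - y)) * B"
        unfolding norm_mult by (intro mult_left_mono B) auto
      ultimately have "norm (partial k (w n) y) \<le> norm (K (x - y)) * D + norm (K' (x - y)) * B"
        unfolding pw by (meson add_mono norm_triangle_ineq4 order_trans)
      from mult_right_mono[OF this, of "\<bar>f y\<bar>"]
      show "norm (partial k (w n) y * of_real (f y)) \<le> D * norm (K (x - y) * of_real (f y)) + B * norm (K' (x - y) * of_real (f y))"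
        by (simp add: norm_mult algebra_simps)
    qed
  qed
  have l2: "(\<lambda>n. LINT y|lborel. w n y * of_real (h y)) \<longlonglongrightarrow> (LINT y|lborel. K (x - y) * of_real (h y))"
  proof (rule integral_dominated_convergence[where w = "\<lambda>y. B * norm (K (x - y) * of_real (h y))"])
    show "integrable lborel (\<lambda>y. B * norm (K (x - y) * of_real (h y)))"
      using iK by (intro integrable_mult_right integrable_norm)
    show "(\<lambda>y. K (x - y) * of_real (h y)) \<in> borel_measurable lborel" using iK(3) by simp
    show "(\<lambda>y. w n y * of_real (h y)) \<in> borel_measurable lborel" for n
      using integrable_schwartz_weighted_integrable[OF w h] by simp
    show "AE y in lborel. (\<lambda>n. w n y * of_real (h y)) \<longlonglongrightarrow> K (x - y) * of_real (h y)"
    proof (rule AE_I2)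
      fix y
      have "(\<lambda>n. K (x - y) * X ((1 / R n) *\<^sub>R y) * of_real (h y)) \<longlonglongrightarrow> K (x - y) * 1 * of_real (h y)"
        by (intro tendsto_intros limX)
      then show "(\<lambda>n. w n y * of_real (h y)) \<longlonglongrightarrow> K (x - y) * of_real (h y)" by (simp add: w_def)
    qed
    show "AE y in lborel. norm (w n y * of_real (h y)) \<le> B * norm (K (x - y) * of_real (h y))" for n
    proof (rule AE_I2)
      fix y
      show "norm (w n y * of_real (h y)) \<le> B * norm (K (x - y) * of_real (h y))"
        using mult_right_mono[OF B(2)[of "(1 / R n) *\<^sub>R y"], of "norm (K (x - y)) * \<bar>h y\<bar>"]
        by (simp add: w_def norm_mult mult_ac)
    qed
  qed
  have "(LINT y|lborel. - (K' (x - y) * of_real (f y))) = - (LINT y|lborel. K (x - y) * of_real (h y))"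
    using LIMSEQ_unique[OF l1] tendsto_minus[OF l2] unfolding wi by blast
  then show "conv_op (\<lambda>\<xi>. \<i> * of_real (\<xi>$k) * m \<xi>) (\<lambda>y. of_real (f y)) x = conv_op m (\<lambda>y. of_real (h y)) x"
    unfolding conv_op_def K_def K'_def by simp
qed

section \<open>Kernel bounds for scaled multipliers\<close>

text \<open>The two endpoint norms of the kernel between which \<open>Lp_norm_convolution\<close>
  interpolates.\<close>

definition kernel_bound :: "(real^'n::finite \<Rightarrow> complex) \<Rightarrow> real \<Rightarrow> real \<Rightarrow> bool" where
  "kernel_bound m A B \<longleftrightarrow> (\<integral>\<^sup>+x. ennreal (norm (ift m x)) \<partial>lborel) \<le> ennreal A \<and> (\<forall>x. norm (ift m x) \<le> B)"

lemma kernel_boundI: "(\<integral>\<^sup>+x. ennreal (norm (ift m x)) \<partial>lborel) \<le> ennreal A \<Longrightarrow> (\<And>x. norm (ift m x) \<le> B) \<Longrightarrow> kernel_bound m A B"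
  by (simp add: kernel_bound_def)

lemma schwartz_ift_measurable: "schwartz m \<Longrightarrow> ift m \<in> borel_measurable borel"
  by (intro schwartz_measurable schwartz_ift)

lemma ift_add:
  assumes "schwartz m" "schwartz m'"
  shows "ift (\<lambda>\<xi>. m \<xi> + m' \<xi>) x = ift m x + ift m' x"
  unfolding ift_def distrib_left
  by (subst Bochner_Integration.integral_add) (auto intro!: schwartz_integrable schwartz_cis assms simp: distrib_left)

lemma ift_cmult: "ift (\<lambda>\<xi>. c * m \<xi>) x = c * ift m x"
proof -
  have "(LINT \<xi>|lborel. cis (x \<bullet> \<xi>) * (c * m \<xi>)) = (LINT \<xi>|lborel. c * (cis (x \<bullet> \<xi>) * m \<xi>))"
    by (intro Bochner_Integration.integral_cong refl) (simp only: mult_ac)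
  also have "\<dots> = c * (LINT \<xi>|lborel. cis (x \<bullet> \<xi>) * m \<xi>)" by (rule integral_mult_right_zero)
  finally show ?thesis unfolding ift_def by (simp only: mult_ac)
qed

lemma kernel_bound_add:
  assumes "schwartz m" "schwartz m'" "kernel_bound m A B" "kernel_bound m' A' B'" "A \<ge> 0" "A' \<ge> 0"
  shows "kernel_bound (\<lambda>\<xi>. m \<xi> + m' \<xi>) (A + A') (B + B')"
proof (rule kernel_boundI)
  have [measurable]: "ift m \<in> borel_measurable borel" "ift m' \<in> borel_measurable borel"
    using assms by (auto intro: schwartz_ift_measurable)
  have "(\<integral>\<^sup>+x. ennreal (norm (ift (\<lambda>\<xi>. m \<xi> + m' \<xi>) x)) \<partial>lborel) \<le> (\<integral>\<^sup>+x. ennreal (norm (ift m x)) + ennreal (norm (ift m' x)) \<partial>lborel)"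
    unfolding ift_add[OF assms(1,2)]
    by (intro nn_integral_mono) (simp add: norm_triangle_ineq flip: ennreal_plus)
  also have "\<dots> \<le> ennreal A + ennreal A'"
    using assms by (subst nn_integral_add) (auto simp: kernel_bound_def intro!: add_mono)
  finally show "(\<integral>\<^sup>+x. ennreal (norm (ift (\<lambda>\<xi>. m \<xi> + m' \<xi>) x)) \<partial>lborel) \<le> ennreal (A + A')"
    using assms by simp
  show "norm (ift (\<lambda>\<xi>. m \<xi> + m' \<xi>) x) \<le> B + B'" for x
    unfolding ift_add[OF assms(1,2)] using assms(3,4) unfolding kernel_bound_def by (meson add_mono norm_triangle_ineq order_trans)
qed

lemma kernel_bound_cmult:
  assumes "schwartz m" "kernel_bound m A B"
  shows "kernel_bound (\<lambda>\<xi>. c * m \<xi>) (norm c * A) (norm c * B)"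
proof (rule kernel_boundI)
  have [measurable]: "ift m \<in> borel_measurable borel"
    using assms by (auto intro: schwartz_ift_measurable)
  have "(\<integral>\<^sup>+x. ennreal (norm (ift (\<lambda>\<xi>. c * m \<xi>) x)) \<partial>lborel) = ennreal (norm c) * (\<integral>\<^sup>+x. ennreal (norm (ift m x)) \<partial>lborel)"
    unfolding ift_cmult norm_mult by (simp add: ennreal_mult nn_integral_cmult)
  also have "\<dots> \<le> ennreal (norm c) * ennreal A"
    using assms by (intro mult_left_mono) (auto simp: kernel_bound_def)
  finally show "(\<integral>\<^sup>+x. ennreal (norm (ift (\<lambda>\<xi>. c * m \<xi>) x)) \<partial>lborel) \<le> ennreal (norm c * A)"
    by (simp add: ennreal_mult')
  show "norm (ift (\<lambda>\<xi>. c * m \<xi>) x) \<le> norm c * B" for x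
    unfolding ift_cmult norm_mult using assms by (auto simp: kernel_bound_def intro!: mult_left_mono)
qed

lemma kernel_bound_mono: "kernel_bound m A B \<Longrightarrow> A \<le> A' \<Longrightarrow> B \<le> B' \<Longrightarrow> kernel_bound m A' B'"
  unfolding kernel_bound_def by (meson ennreal_leI order_trans)

lemma schwartz_nn_integral: "schwartz u \<Longrightarrow> \<exists>C>0. (\<integral>\<^sup>+x. ennreal (norm (u x)) \<partial>lborel) \<le> ennreal C"
proof -
  assume "schwartz u"
  then have "(\<integral>\<^sup>+x. ennreal (norm (u x)) \<partial>lborel) < \<infinity>"
    using schwartz_integrable[of u] by (simp add: integrable_iff_bounded)
  then obtain c where c: "(\<integral>\<^sup>+x. ennreal (norm (u x)) \<partial>lborel) = ennreal c" "c \<ge> 0"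
    by (cases "(\<integral>\<^sup>+x. ennreal (norm (u x)) \<partial>lborel)") auto
  then show ?thesis by (intro exI[of _ "c + 1"]) (auto intro: ennreal_leI)
qed

section \<open>Parabolic rescaling of kernels\<close>

lemma ift_scale_sqrt:
  fixes M :: "real^'n::finite \<Rightarrow> complex"
  assumes "schwartz M" "t > 0"
  shows "ift (\<lambda>\<xi>. M (sqrt t *\<^sub>R \<xi>)) x = of_real (t powr (- (real CARD('n) / 2))) * ift M ((1 / sqrt t) *\<^sub>R x)"
proof -
  have "1 / sqrt t ^ CARD('n) = t powr (- (real CARD('n) / 2))"
    using \<open>t > 0\<close> by (simp add: powr_minus_divide powr_half_sqrt[symmetric] powr_realpow[symmetric] powr_powr)
  then show ?thesis using assms ift_scale[of M "sqrt t" x] schwartz_measurable[of M] by simp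
qed

lemma nn_integral_scale_sqrt:
  fixes f :: "real^'n::finite \<Rightarrow> ennreal"
  assumes [measurable]: "f \<in> borel_measurable borel" and "t > 0"
  shows "(\<integral>\<^sup>+x. ennreal (t powr (- (real CARD('n) / 2))) * f ((1 / sqrt t) *\<^sub>R x) \<partial>lborel) = (\<integral>\<^sup>+x. f x \<partial>lborel)"
proof -
  have "\<bar>1 / sqrt t\<bar> ^ DIM(real^'n) = t powr (- (real CARD('n) / 2))"
    using \<open>t > 0\<close> by (simp add: power_divide powr_minus_divide powr_half_sqrt[symmetric] powr_realpow[symmetric] powr_powr)
  then show ?thesis
    using nn_integral_affine[of f "1 / sqrt t" 0] \<open>t > 0\<close> by (simp add: nn_integral_cmult)
qed

text \<open>The kernel is t^(-N/2) times a dilation of a fixed function: its L^1 norm does not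
  change with t and its sup norm carries the prefactor. The sum of the two fixed norms serves as a
  constant for both.\<close>

lemma kernel_bound_scaled:
  fixes M :: "real^'n::finite \<Rightarrow> complex"
  assumes M: "schwartz M"
  shows "\<exists>C>0. \<forall>t>0. kernel_bound (\<lambda>\<xi>. M (sqrt t *\<^sub>R \<xi>)) C (C * t powr (- (real CARD('n) / 2)))"
proof -
  have [measurable]: "ift M \<in> borel_measurable borel" using M by (rule schwartz_ift_measurable)
  obtain C where C: "C > 0" "(\<integral>\<^sup>+x. ennreal (norm (ift M x)) \<partial>lborel) \<le> ennreal C"
    using schwartz_nn_integral[OF schwartz_ift[OF M]] by blast
  obtain B where B: "B > 0" "\<And>x. norm (ift M x) \<le> B" using schwartz_bounded[OF schwartz_ift[OF M]] by blast
  have "kernel_bound (\<lambda>\<xi>. M (sqrt t *\<^sub>R \<xi>)) (C + B) ((C + B) * t powr (- (real CARD('n) / 2)))" if t: "t > 0" for t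
  proof (rule kernel_boundI)
    have "(\<integral>\<^sup>+x. ennreal (norm (ift (\<lambda>\<xi>. M (sqrt t *\<^sub>R \<xi>)) x)) \<partial>lborel)
      = (\<integral>\<^sup>+x. ennreal (t powr (- (real CARD('n) / 2))) * ennreal (norm (ift M ((1 / sqrt t) *\<^sub>R x))) \<partial>lborel)"
      by (intro nn_integral_cong) (simp add: ift_scale_sqrt[OF M t] norm_mult ennreal_mult)
    also have "\<dots> = (\<integral>\<^sup>+x. ennreal (norm (ift M x)) \<partial>lborel)"
      by (rule nn_integral_scale_sqrt[of "\<lambda>x. ennreal (norm (ift M x))"]) (use t in auto)
    also have "\<dots> \<le> ennreal (C + B)" using C B by (meson ennreal_leI less_add_same_cancel1 less_imp_le order_trans)
    finally show "(\<integral>\<^sup>+x. ennreal (norm (ift (\<lambda>\<xi>. M (sqrt t *\<^sub>R \<xi>)) x)) \<partial>lborel) \<le> ennreal (C + B)" .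
    have "norm (ift M y) \<le> C + B" for y using B(2)[of y] C(1) by linarith
    then show "norm (ift (\<lambda>\<xi>. M (sqrt t *\<^sub>R \<xi>)) x) \<le> (C + B) * t powr (- (real CARD('n) / 2))" for x
      by (simp add: ift_scale_sqrt[OF M t] norm_mult mult.commute[of "t powr _"] mult_right_mono)
  qed
  then show ?thesis using C B by (intro exI[of _ "C + B"]) auto
qed

text \<open>Minkowski's integral inequality in L^1. The bound h may depend on y: it is constant for
  products of symbols and linear in |y| for differences of translates.\<close>

lemma nn_integral_convolution_le:
  fixes F :: "real^'n::finite \<Rightarrow> real^'n \<Rightarrow> complex"
  assumes [measurable]: "case_prod F \<in> borel_measurable (borel \<Otimes>\<^sub>M borel)" "a \<in> borel_measurable borel"
    and bd: "\<And>y. (\<integral>\<^sup>+x. ennreal (norm (F x y)) \<partial>lborel) \<le> ennreal (h y)"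
  shows "(\<integral>\<^sup>+x. ennreal (norm (LINT y|lborel. a y * F x y)) \<partial>lborel) \<le> (\<integral>\<^sup>+y. ennreal (norm (a y)) * ennreal (h y) \<partial>lborel)"
proof -
  have "(\<integral>\<^sup>+x. ennreal (norm (LINT y|lborel. a y * F x y)) \<partial>lborel)
     \<le> (\<integral>\<^sup>+x. (\<integral>\<^sup>+y. ennreal (norm (a y)) * ennreal (norm (F x y)) \<partial>lborel) \<partial>lborel)"
  proof (intro nn_integral_mono)
    fix x
    show "ennreal (norm (LINT y|lborel. a y * F x y)) \<le> (\<integral>\<^sup>+y. ennreal (norm (a y)) * ennreal (norm (F x y)) \<partial>lborel)"
      using norm_integral_le_nn_integral[of lborel "\<lambda>y. a y * F x y"] by (simp add: norm_mult ennreal_mult)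
  qed
  also have "\<dots> = (\<integral>\<^sup>+y. (\<integral>\<^sup>+x. ennreal (norm (a y)) * ennreal (norm (F x y)) \<partial>lborel) \<partial>lborel)"
    using lborel_pair.Fubini[of "\<lambda>(x, y). ennreal (norm (a y)) * ennreal (norm (F x y))"] by simp
  also have "\<dots> = (\<integral>\<^sup>+y. ennreal (norm (a y)) * (\<integral>\<^sup>+x. ennreal (norm (F x y)) \<partial>lborel) \<partial>lborel)"
    by (intro nn_integral_cong nn_integral_cmult) simp
  also have "\<dots> \<le> (\<integral>\<^sup>+y. ennreal (norm (a y)) * ennreal (h y) \<partial>lborel)"
    by (intro nn_integral_mono mult_left_mono bd) auto
  finally show ?thesis .
qed

text \<open>By \<open>ift_mult\<close> the kernel is a convolution with \<open>ift a\<close>, so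
  both norms grow by at most the L^1 norm of \<open>ift a\<close>. The factor L is fixed before m,
  hence is uniform over families such as M(sqrt t \<xi>).\<close>

lemma kernel_bound_mult:
  fixes a :: "real^'n::finite \<Rightarrow> complex"
  assumes a: "schwartz a"
  shows "\<exists>L>0. \<forall>m A B. schwartz m \<longrightarrow> kernel_bound m A B \<longrightarrow> A \<ge> 0 \<longrightarrow> B \<ge> 0 \<longrightarrow> kernel_bound (\<lambda>\<xi>. a \<xi> * m \<xi>) (L * A) (L * B)"
proof -
  have [measurable]: "ift a \<in> borel_measurable borel" using a by (rule schwartz_ift_measurable)
  obtain L where L: "L > 0" "(\<integral>\<^sup>+x. ennreal (norm (ift a x)) \<partial>lborel) \<le> ennreal L"
    using schwartz_nn_integral[OF schwartz_ift[OF a]] by blast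
  have "kernel_bound (\<lambda>\<xi>. a \<xi> * m \<xi>) (L * A) (L * B)" if m: "schwartz m" "kernel_bound m A B" and AB: "A \<ge> 0" "B \<ge> 0" for m A B
  proof (rule kernel_boundI)
    have [measurable]: "ift m \<in> borel_measurable borel" using m by (intro schwartz_ift_measurable)
    have "(\<integral>\<^sup>+x. ennreal (norm (ift (\<lambda>\<xi>. a \<xi> * m \<xi>) x)) \<partial>lborel) \<le> (\<integral>\<^sup>+y. ennreal (norm (ift a y)) * ennreal A \<partial>lborel)"
      unfolding ift_mult[OF a m(1)]
    proof (rule nn_integral_convolution_le)
      show "(\<integral>\<^sup>+x. ennreal (norm (ift m (x - y))) \<partial>lborel) \<le> ennreal A" for y
        using m(2) nn_integral_shift[of "\<lambda>x. ennreal (norm (ift m x))" y] by (simp add: kernel_bound_def)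
    qed auto
    also have "\<dots> = (\<integral>\<^sup>+y. ennreal (norm (ift a y)) \<partial>lborel) * ennreal A" by (simp add: nn_integral_multc)
    also have "\<dots> \<le> ennreal L * ennreal A" by (intro mult_right_mono L) auto
    finally show "(\<integral>\<^sup>+x. ennreal (norm (ift (\<lambda>\<xi>. a \<xi> * m \<xi>) x)) \<partial>lborel) \<le> ennreal (L * A)"
      using AB L by (simp add: ennreal_mult)
    fix x
    have "ennreal (norm (LINT y|lborel. ift a y * ift m (x - y))) \<le> (\<integral>\<^sup>+y. ennreal (norm (ift a y * ift m (x - y))) \<partial>lborel)"
      by (rule norm_integral_le_nn_integral)
    also have "\<dots> \<le> (\<integral>\<^sup>+y. ennreal (norm (ift a y)) * ennreal B \<partial>lborel)"
      using m(2) AB by (intro nn_integral_mono) (auto simp: norm_mult kernel_bound_def intro!: ennreal_leI mult_left_mono simp flip: ennreal_mult)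
    also have "\<dots> \<le> ennreal L * ennreal B" by (subst nn_integral_multc) (auto intro!: mult_right_mono L)
    also have "\<dots> = ennreal (L * B)" using AB L by (simp add: ennreal_mult)
    finally show "norm (ift (\<lambda>\<xi>. a \<xi> * m \<xi>) x) \<le> L * B"
      unfolding ift_mult[OF a m(1)] using AB L by (subst (asm) ennreal_le_iff) auto
  qed
  then show ?thesis using L(1) by blast
qed

text \<open>The sup bound is the mean value inequality. For the L^1 bound with |s| <= 1 it is
  combined with the weighted decay of the derivative; for |s| > 1 the triangle inequality suffices,
  since 2 L <= 2 L |s|. Growth that is linear for all s can be absorbed by a first moment.\<close>

lemma translation_axis:
  fixes K :: "real^'n::finite \<Rightarrow> complex"
  assumes K: "schwartz K"
  shows "\<exists>C>0. \<forall>s. (\<integral>\<^sup>+x. ennreal (norm (K x - K (x - s *\<^sub>R axis k 1))) \<partial>lborel) \<le> ennreal (C * \<bar>s\<bar>)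
     \<and> (\<forall>x. norm (K x - K (x - s *\<^sub>R axis k 1)) \<le> C * \<bar>s\<bar>)"
proof -
  have [measurable]: "K \<in> borel_measurable borel" using K by (rule schwartz_measurable)
  have K': "schwartz (partial k K)" using K by (rule schwartz_partial)
  obtain C where C: "C > 0" "\<And>x. norm (partial k K x) \<le> C / weight x" using schwartz_le_weight[OF K'] by blast
  obtain B where B: "B > 0" "\<And>x. norm (partial k K x) \<le> B" using schwartz_bounded[OF K'] by blast
  obtain L where L: "L > 0" "(\<integral>\<^sup>+x. ennreal (norm (K x)) \<partial>lborel) \<le> ennreal L"
    using schwartz_nn_integral[OF K] by blast
  define W where "W = (LINT x|lborel. 1 / weight (x::real^'n))"
  have W: "(\<integral>\<^sup>+(x::real^'n). ennreal (1 / weight x) \<partial>lborel) = ennreal W" "W \<ge> 0"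
    unfolding W_def by (auto intro!: nn_integral_eq_integral integrable_inv_weight)
  let ?D = "C * (2 * 2 ^ CARD('n))"
  have fwd: "norm (K x - K (x - s *\<^sub>R axis k 1)) \<le> E * \<bar>s\<bar>"
    if "\<And>r. \<bar>r\<bar> \<le> \<bar>s\<bar> \<Longrightarrow> norm (partial k K (x + r *\<^sub>R axis k 1)) \<le> E" for x s E
  proof -
    have "norm (K (x + 0 *\<^sub>R axis k 1) - K (x + (- s) *\<^sub>R axis k 1)) \<le> E * \<bar>0 - (- s)\<bar>"
      by (rule vector_derivative_bound[OF has_partial_at[OF schwartz_has_partial[OF K]]])
         (auto intro!: that simp: closed_segment_eq_real_ivl split: if_splits)
    then show ?thesis by simp
  qed
  have "(\<integral>\<^sup>+x. ennreal (norm (K x - K (x - s *\<^sub>R axis k 1))) \<partial>lborel) \<le> ennreal ((?D * W + 2 * L) * \<bar>s\<bar>)" for s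
  proof (cases "\<bar>s\<bar> \<le> 1")
    case True
    have "(\<integral>\<^sup>+x. ennreal (norm (K x - K (x - s *\<^sub>R axis k 1))) \<partial>lborel) \<le> (\<integral>\<^sup>+(x::real^'n). ennreal (?D * \<bar>s\<bar>) * ennreal (1 / weight x) \<partial>lborel)"
    proof (intro nn_integral_mono)
      fix x
      have "norm (K x - K (x - s *\<^sub>R axis k 1)) \<le> ?D * (1 / weight x) * \<bar>s\<bar>"
        by (rule fwd, rule weight_bound_shift_axis[OF C(2)]) (use True C in auto)
      then show "ennreal (norm (K x - K (x - s *\<^sub>R axis k 1))) \<le> ennreal (?D * \<bar>s\<bar>) * ennreal (1 / weight x)"
        using C by (simp add: mult_ac ennreal_leI flip: ennreal_mult)
    qed
    also have "\<dots> = ennreal (?D * \<bar>s\<bar>) * ennreal W" by (simp add: nn_integral_cmult W)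
    also have "\<dots> = ennreal (?D * W * \<bar>s\<bar>)" using C W by (simp add: mult_ac flip: ennreal_mult)
    also have "\<dots> \<le> ennreal ((?D * W + 2 * L) * \<bar>s\<bar>)" using L by (intro ennreal_leI mult_right_mono) auto
    finally show ?thesis .
  next
    case False
    have "(\<integral>\<^sup>+x. ennreal (norm (K x - K (x - s *\<^sub>R axis k 1))) \<partial>lborel)
        \<le> (\<integral>\<^sup>+x. ennreal (norm (K x)) + ennreal (norm (K (x - s *\<^sub>R axis k 1))) \<partial>lborel)"
      by (intro nn_integral_mono) (simp add: norm_triangle_ineq4 flip: ennreal_plus)
    also have "\<dots> = (\<integral>\<^sup>+x. ennreal (norm (K x)) \<partial>lborel) + (\<integral>\<^sup>+x. ennreal (norm (K x)) \<partial>lborel)"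
      by (subst nn_integral_add) (auto simp: nn_integral_shift[of "\<lambda>x. ennreal (norm (K x))"])
    also have "\<dots> \<le> ennreal L + ennreal L" by (intro add_mono L)
    also have "\<dots> = ennreal (2 * L * 1)" using L by (simp flip: ennreal_plus)
    also have "\<dots> \<le> ennreal ((?D * W + 2 * L) * \<bar>s\<bar>)"
      using False L C W by (intro ennreal_leI mult_mono) auto
    finally show ?thesis .
  qed
  then have 1: "(\<integral>\<^sup>+x. ennreal (norm (K x - K (x - s *\<^sub>R axis k 1))) \<partial>lborel) \<le> ennreal ((?D * W + 2 * L + B) * \<bar>s\<bar>)" for s
    by (rule order_trans) (use B in \<open>auto intro!: ennreal_leI mult_right_mono\<close>)
  have "norm (K x - K (x - s *\<^sub>R axis k 1)) \<le> B * \<bar>s\<bar>" for s x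
    by (rule fwd) (rule B)
  then have 2: "norm (K x - K (x - s *\<^sub>R axis k 1)) \<le> (?D * W + 2 * L + B) * \<bar>s\<bar>" for s x
    by (rule order_trans) (use C W L in \<open>auto intro!: mult_right_mono\<close>)
  have "?D * W + 2 * L + B > 0" using C W L B by (auto intro!: add_nonneg_pos)
  then show ?thesis using 1 2 by blast
qed

text \<open>A translation by y is a chain of translations along the axes, and both norms are
  translation invariant, so the bounds for the axes add up.\<close>

lemma translation_bound:
  fixes K :: "real^'n::finite \<Rightarrow> complex"
  assumes K: "schwartz K"
  shows "\<exists>C>0. \<forall>y. (\<integral>\<^sup>+x. ennreal (norm (K x - K (x - y))) \<partial>lborel) \<le> ennreal (C * (\<Sum>k\<in>UNIV. \<bar>y$k\<bar>))
     \<and> (\<forall>x. norm (K x - K (x - y)) \<le> C * (\<Sum>k\<in>UNIV. \<bar>y$k\<bar>))"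
proof -
  have [measurable]: "K \<in> borel_measurable borel" using K by (rule schwartz_measurable)
  have "\<forall>k. \<exists>C>0. \<forall>s. (\<integral>\<^sup>+x. ennreal (norm (K x - K (x - s *\<^sub>R axis k 1))) \<partial>lborel) \<le> ennreal (C * \<bar>s\<bar>)
     \<and> (\<forall>x. norm (K x - K (x - s *\<^sub>R axis k 1)) \<le> C * \<bar>s\<bar>)"
    using translation_axis[OF K] by (rule allI)
  from choice[OF this] obtain c where c': "\<forall>k. c k > 0 \<and> (\<forall>s. (\<integral>\<^sup>+x. ennreal (norm (K x - K (x - s *\<^sub>R axis k 1))) \<partial>lborel) \<le> ennreal (c k * \<bar>s\<bar>)
     \<and> (\<forall>x. norm (K x - K (x - s *\<^sub>R axis k 1)) \<le> c k * \<bar>s\<bar>))" ..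
  have c: "c k > 0"
    "(\<integral>\<^sup>+x. ennreal (norm (K x - K (x - s *\<^sub>R axis k 1))) \<partial>lborel) \<le> ennreal (c k * \<bar>s\<bar>)"
    "norm (K x - K (x - s *\<^sub>R axis k 1)) \<le> c k * \<bar>s\<bar>" for k s x
    using c' by blast+
  define C where "C = (\<Sum>k\<in>UNIV. c k)"
  have cC: "c k \<le> C" for k unfolding C_def using c(1) by (intro member_le_sum) (auto intro: less_imp_le)
  have C: "C > 0" unfolding C_def using c(1) by (intro sum_pos) auto
  have S: "(\<integral>\<^sup>+x. ennreal (norm (K x - K (x - (\<Sum>k\<in>S. y$k *\<^sub>R axis k 1)))) \<partial>lborel) \<le> ennreal (C * (\<Sum>k\<in>S. \<bar>y$k\<bar>))
     \<and> (\<forall>x. norm (K x - K (x - (\<Sum>k\<in>S. y$k *\<^sub>R axis k 1))) \<le> C * (\<Sum>k\<in>S. \<bar>y$k\<bar>))" if "finite S" for S y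
    using that
  proof induction
    case empty
    then show ?case by simp
  next
    case (insert k S)
    let ?z = "\<Sum>k\<in>S. y$k *\<^sub>R axis k 1" and ?e = "y$k *\<^sub>R axis k 1 :: real^'n"
    have tri: "norm (K x - K (x - (?e + ?z))) \<le> norm (K x - K (x - ?z)) + norm (K (x - ?z) - K ((x - ?z) - ?e))" for x
      using norm_triangle_ineq[of "K x - K (x - ?z)" "K (x - ?z) - K ((x - ?z) - ?e)"] by (simp add: algebra_simps)
    have "(\<integral>\<^sup>+x. ennreal (norm (K x - K (x - (?e + ?z)))) \<partial>lborel)
      \<le> (\<integral>\<^sup>+x. ennreal (norm (K x - K (x - ?z))) + ennreal (norm (K (x - ?z) - K ((x - ?z) - ?e))) \<partial>lborel)"
      using tri by (intro nn_integral_mono) (simp flip: ennreal_plus)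
    also have "\<dots> = (\<integral>\<^sup>+x. ennreal (norm (K x - K (x - ?z))) \<partial>lborel) + (\<integral>\<^sup>+x. ennreal (norm (K x - K (x - ?e))) \<partial>lborel)"
      by (subst nn_integral_add) (auto simp: nn_integral_shift[of "\<lambda>x. ennreal (norm (K x - K (x - ?e)))"])
    also have "\<dots> \<le> ennreal (C * (\<Sum>k\<in>S. \<bar>y$k\<bar>)) + ennreal (C * \<bar>y$k\<bar>)"
    proof (rule add_mono)
      show "(\<integral>\<^sup>+x. ennreal (norm (K x - K (x - ?e))) \<partial>lborel) \<le> ennreal (C * \<bar>y$k\<bar>)"
        by (rule order_trans[OF c(2) ennreal_leI[OF mult_right_mono[OF cC]]]) simp
    qed (rule insert.IH[THEN conjunct1])
    also have "\<dots> = ennreal (C * (\<Sum>k\<in>insert k S. \<bar>y$k\<bar>))"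
      using insert C by (simp add: sum_nonneg distrib_left add.commute flip: ennreal_plus)
    finally have 1: "(\<integral>\<^sup>+x. ennreal (norm (K x - K (x - (?e + ?z)))) \<partial>lborel) \<le> ennreal (C * (\<Sum>k\<in>insert k S. \<bar>y$k\<bar>))" .
    have 2: "norm (K x - K (x - (?e + ?z))) \<le> C * (\<Sum>k\<in>insert k S. \<bar>y$k\<bar>)" for x
    proof -
      have "norm (K (x - ?z) - K ((x - ?z) - ?e)) \<le> C * \<bar>y$k\<bar>"
        using c(3)[of "x - ?z" "y$k" k] mult_right_mono[OF cC[of k], of "\<bar>y$k\<bar>"] by linarith
      moreover have "norm (K x - K (x - ?z)) \<le> C * (\<Sum>k\<in>S. \<bar>y$k\<bar>)" using insert.IH by blast
      ultimately have "norm (K x - K (x - (?e + ?z))) \<le> C * (\<Sum>k\<in>S. \<bar>y$k\<bar>) + C * \<bar>y$k\<bar>"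
        by (intro order_trans[OF tri add_mono])
      then show ?thesis using insert.hyps by (simp add: distrib_left add.commute)
    qed
    show ?case using insert.hyps 1 2 by simp
  qed
  have "(\<Sum>k\<in>UNIV. y$k *\<^sub>R axis k 1) = y" for y :: "real^'n"
    using basis_expansion[of y] by (simp add: scalar_mult_eq_scaleR)
  then show ?thesis using C S[of UNIV] by auto
qed

text \<open>The factor sqrt t is compensated by \<phi>(0) = 1: the kernel of (1 - \<phi>) M(sqrt t \<xi>) is the average
  of k(x) - k(x - y) against the integrable weight ift \<phi>(y) of total mass 1.\<close>

lemma kernel_bound_high:
  fixes M \<phi> :: "real^'n::finite \<Rightarrow> complex"
  assumes M: "schwartz M" and \<phi>: "schwartz \<phi>" and \<phi>0: "\<phi> 0 = 1"
  shows "\<exists>C>0. \<forall>t>0. kernel_bound (\<lambda>\<xi>. (1 - \<phi> \<xi>) * (of_real (sqrt t) * M (sqrt t *\<^sub>R \<xi>))) C (C * t powr (- (real CARD('n) / 2)))"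
proof -
  let ?N = "real CARD('n) / 2"
  define K where "K = ift M"
  define P where "P = ift \<phi>"
  have K: "schwartz K" unfolding K_def using M by (rule schwartz_ift)
  have P: "schwartz P" unfolding P_def using \<phi> by (rule schwartz_ift)
  have [measurable]: "K \<in> borel_measurable borel" "P \<in> borel_measurable borel" using K P by (auto intro: schwartz_measurable)
  obtain C where C: "C > 0" "\<And>y. (\<integral>\<^sup>+x. ennreal (norm (K x - K (x - y))) \<partial>lborel) \<le> ennreal (C * (\<Sum>k\<in>UNIV. \<bar>y$k\<bar>))"
     "\<And>x y. norm (K x - K (x - y)) \<le> C * (\<Sum>k\<in>UNIV. \<bar>y$k\<bar>)"
    using translation_bound[OF K] by blast
  \<comment> \<open>The first moment of the averaging kernel, finite because \<open>P\<close> is a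
    Schwartz function.\<close>
  define L where "L = (LINT y|lborel. norm (P y) * (\<Sum>k\<in>UNIV. \<bar>y$k\<bar>))"
  have iL: "integrable lborel (\<lambda>y. norm (P y) * (\<Sum>k\<in>UNIV. \<bar>y$k\<bar>))"
  proof -
    have "integrable lborel (\<lambda>y. \<Sum>k\<in>UNIV. norm (complex_of_real (y$k) * P y))"
      by (intro Bochner_Integration.integrable_sum integrable_norm schwartz_integrable schwartz_coord P)
    then show ?thesis by (simp add: norm_mult sum_distrib_left mult.commute)
  qed
  have L: "(\<integral>\<^sup>+y. ennreal (norm (P y)) * ennreal (\<Sum>k\<in>UNIV. \<bar>y$k\<bar>) \<partial>lborel) = ennreal L" "L \<ge> 0"
    using nn_integral_eq_integral[OF iL] unfolding L_def by (auto simp: sum_nonneg ennreal_mult)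
  \<comment> \<open>The inversion formula at frequency 0 turns \<open>\<phi> 0 = 1\<close> into
    total mass one.\<close>
  have P1: "(LINT y|lborel. P y) = 1"
    using fourier_inversion[OF \<phi>, of 0] \<phi>0 by (simp add: P_def)
  \<comment> \<open>The summand 1 keeps the constant positive, as L is only known to be
    nonnegative.\<close>
  have "kernel_bound (\<lambda>\<xi>. (1 - \<phi> \<xi>) * (of_real (sqrt t) * M (sqrt t *\<^sub>R \<xi>))) (C * L + 1) ((C * L + 1) * t powr - ?N)" if t: "t > 0" for t
  proof -
    define Mt where "Mt \<xi> = complex_of_real (sqrt t) * M (sqrt t *\<^sub>R \<xi>)" for \<xi>
    have sM: "schwartz (\<lambda>\<xi>. M (sqrt t *\<^sub>R \<xi>))" by (rule schwartz_scale[OF M]) (use t in auto)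
    then have Mt: "schwartz Mt" unfolding Mt_def by (rule schwartz_cmult)
    define k where "k = ift Mt"
    have kK: "k x = of_real (sqrt t * t powr - ?N) * K ((1 / sqrt t) *\<^sub>R x)" for x
      unfolding k_def Mt_def K_def by (simp add: ift_cmult ift_scale_sqrt[OF M t])
    have [measurable]: "k \<in> borel_measurable borel" unfolding k_def by (rule schwartz_ift_measurable[OF Mt])
    have k: "schwartz k" unfolding k_def by (rule schwartz_ift[OF Mt])
    have diff: "k x - k (x - y) = of_real (sqrt t * t powr - ?N) * (K ((1 / sqrt t) *\<^sub>R x) - K ((1 / sqrt t) *\<^sub>R x - (1 / sqrt t) *\<^sub>R y))" for x y
      unfolding kK by (simp add: scaleR_diff_right right_diff_distrib)
    \<comment> \<open>The dilated kernel sees the translation y / sqrt t, and this denominator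
      cancels the factor sqrt t.\<close>
    have kint: "(\<integral>\<^sup>+x. ennreal (norm (k x - k (x - y))) \<partial>lborel) \<le> ennreal (C * (\<Sum>l\<in>UNIV. \<bar>y$l\<bar>))" for y
    proof -
      have "(\<integral>\<^sup>+x. ennreal (norm (k x - k (x - y))) \<partial>lborel)
         = (\<integral>\<^sup>+x. ennreal (sqrt t) * (ennreal (t powr - ?N) * ennreal (norm (K ((1 / sqrt t) *\<^sub>R x) - K ((1 / sqrt t) *\<^sub>R x - (1 / sqrt t) *\<^sub>R y)))) \<partial>lborel)"
        unfolding diff using t by (intro nn_integral_cong) (simp add: norm_mult ennreal_mult mult.assoc)
      also have "\<dots> = ennreal (sqrt t) * (\<integral>\<^sup>+x. ennreal (norm (K x - K (x - (1 / sqrt t) *\<^sub>R y))) \<partial>lborel)"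
        by (subst nn_integral_cmult, simp, subst nn_integral_scale_sqrt[of "\<lambda>x. ennreal (norm (K x - K (x - (1 / sqrt t) *\<^sub>R y)))", OF _ t]) auto
      also have "\<dots> \<le> ennreal (sqrt t) * ennreal (C * (\<Sum>l\<in>UNIV. \<bar>((1 / sqrt t) *\<^sub>R y)$l\<bar>))"
        by (intro mult_left_mono C) auto
      also have "\<dots> = ennreal (sqrt t * (C * (\<Sum>l\<in>UNIV. \<bar>((1 / sqrt t) *\<^sub>R y)$l\<bar>)))"
        using C t by (simp add: ennreal_mult sum_nonneg)
      also have "sqrt t * (C * (\<Sum>l\<in>UNIV. \<bar>((1 / sqrt t) *\<^sub>R y)$l\<bar>)) = C * (\<Sum>l\<in>UNIV. \<bar>y$l\<bar>)"
        using t by (simp add: abs_mult sum_divide_distrib[symmetric])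
      finally show ?thesis .
    qed
    have ksup: "norm (k x - k (x - y)) \<le> t powr - ?N * (C * (\<Sum>l\<in>UNIV. \<bar>y$l\<bar>))" for x y
    proof -
      have "norm (k x - k (x - y)) \<le> sqrt t * t powr - ?N * (C * (\<Sum>l\<in>UNIV. \<bar>((1 / sqrt t) *\<^sub>R y)$l\<bar>))"
      proof -
        have "norm (complex_of_real (sqrt t * t powr - ?N)) = sqrt t * t powr - ?N"
          unfolding norm_of_real using t by (simp add: abs_mult)
        then show ?thesis unfolding diff norm_mult[of "of_real _"] using t
          by (simp only:) (rule mult_left_mono[OF C(3)], simp)
      qed
      also have "\<dots> = t powr - ?N * (C * (\<Sum>l\<in>UNIV. \<bar>y$l\<bar>))"
        using t by (simp add: abs_mult sum_divide_distrib[symmetric])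
      finally show ?thesis .
    qed
    have iPk: "integrable lborel (\<lambda>y. P y * k x)" "integrable lborel (\<lambda>y. P y * k (x - y))" for x
      using schwartz_integrable[OF P] schwartz_integrable[OF schwartz_mult[OF P schwartz_reflect[OF k]]] by simp_all
    \<comment> \<open>The term k x is written as the average of a constant, which is possible
      because \<open>P\<close> has mass one; the difference then sits under one integral.\<close>
    have rep: "ift (\<lambda>\<xi>. (1 - \<phi> \<xi>) * Mt \<xi>) x = (LINT y|lborel. P y * (k x - k (x - y)))" for x
    proof -
      have "ift (\<lambda>\<xi>. (1 - \<phi> \<xi>) * Mt \<xi>) x = ift (\<lambda>\<xi>. Mt \<xi> + (-1) * (\<phi> \<xi> * Mt \<xi>)) x"
        by (simp add: algebra_simps)
      also have "\<dots> = k x - (LINT y|lborel. P y * k (x - y))"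
        unfolding ift_add[OF Mt schwartz_cmult[OF schwartz_mult[OF \<phi> Mt]]] ift_cmult ift_mult[OF \<phi> Mt] k_def P_def
        by simp
      also have "\<dots> = (LINT y|lborel. P y * k x) - (LINT y|lborel. P y * k (x - y))" by (simp add: P1)
      also have "\<dots> = (LINT y|lborel. P y * (k x - k (x - y)))"
        unfolding right_diff_distrib
        by (rule Bochner_Integration.integral_diff[symmetric, OF iPk])
      finally show ?thesis .
    qed
    have "kernel_bound (\<lambda>\<xi>. (1 - \<phi> \<xi>) * Mt \<xi>) (C * L + 1) ((C * L + 1) * t powr - ?N)"
    proof (rule kernel_boundI)
      have "(\<integral>\<^sup>+x. ennreal (norm (ift (\<lambda>\<xi>. (1 - \<phi> \<xi>) * Mt \<xi>) x)) \<partial>lborel)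
         \<le> (\<integral>\<^sup>+y. ennreal (norm (P y)) * ennreal (C * (\<Sum>l\<in>UNIV. \<bar>y$l\<bar>)) \<partial>lborel)"
        unfolding rep by (rule nn_integral_convolution_le) (use kint in auto)
      also have "\<dots> = (\<integral>\<^sup>+y. ennreal C * (ennreal (norm (P y)) * ennreal (\<Sum>l\<in>UNIV. \<bar>y$l\<bar>)) \<partial>lborel)"
        using C by (intro nn_integral_cong) (simp add: ennreal_mult sum_nonneg mult_ac)
      also have "\<dots> = ennreal C * ennreal L" using L by (simp add: nn_integral_cmult)
      also have "\<dots> \<le> ennreal (C * L + 1)" using C L by (simp add: ennreal_leI flip: ennreal_mult)
      finally show "(\<integral>\<^sup>+x. ennreal (norm (ift (\<lambda>\<xi>. (1 - \<phi> \<xi>) * Mt \<xi>) x)) \<partial>lborel) \<le> ennreal (C * L + 1)" .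
      fix x
      have "norm (LINT y|lborel. P y * (k x - k (x - y))) \<le> (LINT y|lborel. (t powr - ?N * C) * (norm (P y) * (\<Sum>l\<in>UNIV. \<bar>y$l\<bar>)))"
      proof (rule order_trans[OF integral_norm_bound], rule integral_mono)
        show "integrable lborel (\<lambda>y. norm (P y * (k x - k (x - y))))"
          unfolding right_diff_distrib by (rule integrable_norm[OF Bochner_Integration.integrable_diff[OF iPk]])
        show "integrable lborel (\<lambda>y. (t powr - ?N * C) * (norm (P y) * (\<Sum>l\<in>UNIV. \<bar>y$l\<bar>)))"
          using iL by (rule integrable_mult_right)
        show "norm (P y * (k x - k (x - y))) \<le> (t powr - ?N * C) * (norm (P y) * (\<Sum>l\<in>UNIV. \<bar>y$l\<bar>))" for y
          using mult_left_mono[OF ksup[of x y], of "norm (P y)"] by (simp add: norm_mult mult_ac)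
      qed
      also have "\<dots> = (t powr - ?N * C) * L" unfolding L_def by (rule integral_mult_right_zero)
      also have "\<dots> \<le> (C * L + 1) * t powr - ?N" by (simp add: algebra_simps)
      finally show "norm (ift (\<lambda>\<xi>. (1 - \<phi> \<xi>) * Mt \<xi>) x) \<le> (C * L + 1) * t powr - ?N" unfolding rep .
    qed
    then show ?thesis unfolding Mt_def .
  qed
  moreover have "C * L + 1 > 0" using C L by (simp add: add_nonneg_pos)
  ultimately show ?thesis by blast
qed

text \<open>Records what the kernel of M(sqrt t \<xi>) satisfies: each derivative costs t^(-1/2) in
  both norms, and the sup norm costs a further t^(-N/2). One constant per list of derivatives is
  valid for all t > 0.\<close>

definition scale_decay :: "(real \<Rightarrow> real^'n::finite \<Rightarrow> complex) \<Rightarrow> bool" where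
  "scale_decay m \<longleftrightarrow> (\<forall>t>0. schwartz (m t)) \<and> (\<forall>ks. \<exists>C>0. \<forall>t>0.
     kernel_bound (\<lambda>\<xi>. freq_monomial ks \<xi> * m t \<xi>) (C * t powr (- (real (length ks) / 2)))
       (C * t powr (- (real (length ks) / 2)) * t powr (- (real CARD('n) / 2))))"

lemma scale_decay_schwartz: "scale_decay m \<Longrightarrow> t > 0 \<Longrightarrow> schwartz (m t)"
  by (simp add: scale_decay_def)

lemma scale_decay_add:
  fixes m m' :: "real \<Rightarrow> real^'n::finite \<Rightarrow> complex"
  assumes "scale_decay m" "scale_decay m'" shows "scale_decay (\<lambda>t \<xi>. m t \<xi> + m' t \<xi>)"
  unfolding scale_decay_def
proof safe
  show "schwartz (\<lambda>\<xi>. m t \<xi> + m' t \<xi>)" if "t > 0" for t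
    using assms that by (auto intro: schwartz_add scale_decay_schwartz)
  fix ks :: "'n list"
  let ?J = "\<lambda>t. t powr (- (real (length ks) / 2))" and ?N = "\<lambda>t. t powr (- (real CARD('n) / 2))"
  obtain C where C: "C > 0" "\<And>t. t > 0 \<Longrightarrow> kernel_bound (\<lambda>\<xi>. freq_monomial ks \<xi> * m t \<xi>) (C * ?J t) (C * ?J t * ?N t)"
    using assms(1) unfolding scale_decay_def by meson
  obtain D where D: "D > 0" "\<And>t. t > 0 \<Longrightarrow> kernel_bound (\<lambda>\<xi>. freq_monomial ks \<xi> * m' t \<xi>) (D * ?J t) (D * ?J t * ?N t)"
    using assms(2) unfolding scale_decay_def by meson
  have "kernel_bound (\<lambda>\<xi>. freq_monomial ks \<xi> * (m t \<xi> + m' t \<xi>)) ((C + D) * ?J t) ((C + D) * ?J t * ?N t)" if t: "t > 0" for t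
    using kernel_bound_add[OF _ _ C(2)[OF t] D(2)[OF t]] assms t C(1) D(1)
    by (simp add: schwartz_freq_monomial scale_decay_schwartz distrib_left distrib_right)
  then show "\<exists>C>0. \<forall>t>0. kernel_bound (\<lambda>\<xi>. freq_monomial ks \<xi> * (m t \<xi> + m' t \<xi>)) (C * ?J t) (C * ?J t * ?N t)"
    using C(1) D(1) by (intro exI[of _ "C + D"]) auto
qed

lemma scale_decay_cmult:
  fixes m :: "real \<Rightarrow> real^'n::finite \<Rightarrow> complex"
  assumes "scale_decay m" shows "scale_decay (\<lambda>t \<xi>. c * m t \<xi>)"
  unfolding scale_decay_def
proof safe
  show "schwartz (\<lambda>\<xi>. c * m t \<xi>)" if "t > 0" for t
    using assms that by (auto intro: schwartz_cmult scale_decay_schwartz)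
  fix ks :: "'n list"
  let ?J = "\<lambda>t. t powr (- (real (length ks) / 2))" and ?N = "\<lambda>t. t powr (- (real CARD('n) / 2))"
  obtain C where C: "C > 0" "\<And>t. t > 0 \<Longrightarrow> kernel_bound (\<lambda>\<xi>. freq_monomial ks \<xi> * m t \<xi>) (C * ?J t) (C * ?J t * ?N t)"
    using assms(1) unfolding scale_decay_def by meson
  have "kernel_bound (\<lambda>\<xi>. freq_monomial ks \<xi> * (c * m t \<xi>)) (((norm c + 1) * C) * ?J t) (((norm c + 1) * C) * ?J t * ?N t)" if t: "t > 0" for t
  proof -
    have "kernel_bound (\<lambda>\<xi>. c * (freq_monomial ks \<xi> * m t \<xi>)) (norm c * (C * ?J t)) (norm c * (C * ?J t * ?N t))"
      by (intro kernel_bound_cmult C t schwartz_freq_monomial scale_decay_schwartz assms)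
    then have "kernel_bound (\<lambda>\<xi>. c * (freq_monomial ks \<xi> * m t \<xi>)) (((norm c + 1) * C) * ?J t) (((norm c + 1) * C) * ?J t * ?N t)"
      by (rule kernel_bound_mono) (use C(1) in \<open>auto simp: algebra_simps\<close>)
    then show ?thesis by (simp add: mult.left_commute)
  qed
  moreover have "(norm c + 1) * C > 0" using C(1) by (simp add: add_nonneg_pos)
  ultimately show "\<exists>C>0. \<forall>t>0. kernel_bound (\<lambda>\<xi>. freq_monomial ks \<xi> * (c * m t \<xi>)) (C * ?J t) (C * ?J t * ?N t)"
    by blast
qed

lemma freq_monomial_mult_scaled:
  fixes M :: "real^'n::finite \<Rightarrow> complex"
  assumes "t > 0"
  shows "freq_monomial ks \<xi> * M (sqrt t *\<^sub>R \<xi>) = of_real (t powr (- (real (length ks) / 2))) * (freq_monomial ks (sqrt t *\<^sub>R \<xi>) * M (sqrt t *\<^sub>R \<xi>))"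
proof -
  have "t powr (- (real (length ks) / 2)) * sqrt t ^ length ks = 1"
    using assms by (simp add: powr_minus_divide powr_half_sqrt[symmetric] powr_realpow[symmetric] powr_powr)
  then have "complex_of_real (t powr (- (real (length ks) / 2))) * of_real (sqrt t ^ length ks) = 1"
    by (metis of_real_1 of_real_mult)
  then show ?thesis by (simp add: freq_monomial_scaleR mult.assoc[symmetric] del: of_real_power)
qed

text \<open>A frequency monomial is t^(-j/2) times the same monomial in sqrt t \<xi>, and the latter
  can be absorbed into M. A bound without derivatives, valid for every Schwartz function M,
  therefore yields all derivatives.\<close>

lemma scale_decay_multiplier:
  fixes A :: "real \<Rightarrow> real^'n::finite \<Rightarrow> complex"
  assumes sch: "\<And>M t. schwartz M \<Longrightarrow> t > 0 \<Longrightarrow> schwartz (\<lambda>\<xi>. A t \<xi> * M (sqrt t *\<^sub>R \<xi>))"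
    and bd: "\<And>M. schwartz M \<Longrightarrow> \<exists>C>0. \<forall>t>0. kernel_bound (\<lambda>\<xi>. A t \<xi> * M (sqrt t *\<^sub>R \<xi>)) C (C * t powr (- (real CARD('n) / 2)))"
    and M: "schwartz M"
  shows "scale_decay (\<lambda>t \<xi>. A t \<xi> * M (sqrt t *\<^sub>R \<xi>))"
  unfolding scale_decay_def
proof safe
  show "schwartz (\<lambda>\<xi>. A t \<xi> * M (sqrt t *\<^sub>R \<xi>))" if "t > 0" for t by (rule sch[OF M that])
  fix ks :: "'n list"
  let ?J = "\<lambda>t. t powr (- (real (length ks) / 2))" and ?N = "\<lambda>t. t powr (- (real CARD('n) / 2))"
  have M': "schwartz (\<lambda>\<xi>. freq_monomial ks \<xi> * M \<xi>)" using M by (rule schwartz_freq_monomial)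
  obtain C where C: "C > 0" "\<And>t. t > 0 \<Longrightarrow> kernel_bound (\<lambda>\<xi>. A t \<xi> * (freq_monomial ks (sqrt t *\<^sub>R \<xi>) * M (sqrt t *\<^sub>R \<xi>))) C (C * ?N t)"
    using bd[OF M'] by blast
  have "kernel_bound (\<lambda>\<xi>. freq_monomial ks \<xi> * (A t \<xi> * M (sqrt t *\<^sub>R \<xi>))) (C * ?J t) (C * ?J t * ?N t)" if t: "t > 0" for t
  proof -
    have eq: "freq_monomial ks \<xi> * (A t \<xi> * M (sqrt t *\<^sub>R \<xi>)) = of_real (?J t) * (A t \<xi> * (freq_monomial ks (sqrt t *\<^sub>R \<xi>) * M (sqrt t *\<^sub>R \<xi>)))" for \<xi>
    proof -
      have "freq_monomial ks \<xi> * (A t \<xi> * M (sqrt t *\<^sub>R \<xi>)) = A t \<xi> * (freq_monomial ks \<xi> * M (sqrt t *\<^sub>R \<xi>))"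
        by (simp only: mult_ac)
      then show ?thesis unfolding freq_monomial_mult_scaled[OF t, of ks \<xi> M] by (simp only: mult_ac)
    qed
    have n: "norm (complex_of_real (?J t)) = ?J t" by simp
    have "kernel_bound (\<lambda>\<xi>. of_real (?J t) * (A t \<xi> * (freq_monomial ks (sqrt t *\<^sub>R \<xi>) * M (sqrt t *\<^sub>R \<xi>))))
       (norm (complex_of_real (?J t)) * C) (norm (complex_of_real (?J t)) * (C * ?N t))"
      by (rule kernel_bound_cmult[OF sch[OF M' t] C(2)[OF t]])
    then show ?thesis unfolding eq n by (simp only: mult_ac)
  qed
  then show "\<exists>C>0. \<forall>t>0. kernel_bound (\<lambda>\<xi>. freq_monomial ks \<xi> * (A t \<xi> * M (sqrt t *\<^sub>R \<xi>))) (C * ?J t) (C * ?J t * ?N t)"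
    using C(1) by blast
qed

lemma schwartz_scale_sqrt: "schwartz M \<Longrightarrow> t > 0 \<Longrightarrow> schwartz (\<lambda>\<xi>. M (sqrt t *\<^sub>R \<xi>))"
  by (rule schwartz_scale) auto

lemma scale_decay_scaled:
  fixes M :: "real^'n::finite \<Rightarrow> complex"
  assumes M: "schwartz M" shows "scale_decay (\<lambda>t \<xi>. M (sqrt t *\<^sub>R \<xi>))"
proof -
  have "scale_decay (\<lambda>t \<xi>. 1 * M (sqrt t *\<^sub>R \<xi>))"
    unfolding mult_1_left[of "M _"]
    by (rule scale_decay_multiplier[of "\<lambda>t \<xi>. 1", OF _ _ M, unfolded mult_1_left]) (rule schwartz_scale_sqrt kernel_bound_scaled, assumption+)+
  then show ?thesis by simp
qed

lemma scale_decay_mult: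
  fixes a :: "real^'n::finite \<Rightarrow> complex"
  assumes a: "schwartz a" and M: "schwartz M" shows "scale_decay (\<lambda>t \<xi>. a \<xi> * M (sqrt t *\<^sub>R \<xi>))"
proof (rule scale_decay_multiplier[OF _ _ M])
  show "schwartz (\<lambda>\<xi>. a \<xi> * M (sqrt t *\<^sub>R \<xi>))" if "schwartz M" "t > 0" for M t
    using that by (intro schwartz_mult a schwartz_scale_sqrt)
  obtain L where L: "L > 0" "\<And>m A B. schwartz m \<Longrightarrow> kernel_bound m A B \<Longrightarrow> A \<ge> 0 \<Longrightarrow> B \<ge> 0 \<Longrightarrow> kernel_bound (\<lambda>\<xi>. a \<xi> * m \<xi>) (L * A) (L * B)"
    using kernel_bound_mult[OF a] by blast
  show "\<exists>C>0. \<forall>t>0. kernel_bound (\<lambda>\<xi>. a \<xi> * M (sqrt t *\<^sub>R \<xi>)) C (C * t powr (- (real CARD('n) / 2)))" if M: "schwartz M" for M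
  proof -
    obtain C where C: "C > 0" "\<And>t. t > 0 \<Longrightarrow> kernel_bound (\<lambda>\<xi>. M (sqrt t *\<^sub>R \<xi>)) C (C * t powr (- (real CARD('n) / 2)))"
      using kernel_bound_scaled[OF M] by blast
    have "kernel_bound (\<lambda>\<xi>. a \<xi> * M (sqrt t *\<^sub>R \<xi>)) (L * C) ((L * C) * t powr (- (real CARD('n) / 2)))" if t: "t > 0" for t
      using L(2)[OF schwartz_scale_sqrt[OF M t] C(2)[OF t]] C(1) by (simp add: mult.assoc)
    then show ?thesis using L(1) C(1) by (intro exI[of _ "L * C"]) auto
  qed
qed

text \<open>The factor \<open>1 - \<phi>\<close> is not a Schwartz function, so the two terms of the
  difference are estimated one by one.\<close>

lemma scale_decay_high:
  fixes \<phi> :: "real^'n::finite \<Rightarrow> complex"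
  assumes \<phi>: "schwartz \<phi>" and M: "schwartz M" shows "scale_decay (\<lambda>t \<xi>. (1 - \<phi> \<xi>) * M (sqrt t *\<^sub>R \<xi>))"
  using scale_decay_add[OF scale_decay_scaled[OF M] scale_decay_cmult[OF scale_decay_mult[OF \<phi> M], of "-1"]]
  by (simp add: left_diff_distrib)

text \<open>The factor sqrt t is counted with the cutoff, so that M stays independent of t;
  splitting the difference as in \<open>scale_decay_high\<close> would lose the cancellation behind
  \<open>kernel_bound_high\<close>.\<close>

lemma scale_decay_high_sqrt:
  fixes \<phi> :: "real^'n::finite \<Rightarrow> complex"
  assumes \<phi>: "schwartz \<phi>" "\<phi> 0 = 1" and M: "schwartz M"
  shows "scale_decay (\<lambda>t \<xi>. ((1 - \<phi> \<xi>) * of_real (sqrt t)) * M (sqrt t *\<^sub>R \<xi>))"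
proof (rule scale_decay_multiplier[OF _ _ M])
  show "schwartz (\<lambda>\<xi>. (1 - \<phi> \<xi>) * of_real (sqrt t) * M (sqrt t *\<^sub>R \<xi>))" if "schwartz M" "t > 0" for M t
  proof -
    have s: "schwartz (\<lambda>\<xi>. complex_of_real (sqrt t) * M (sqrt t *\<^sub>R \<xi>))"
      using that by (intro schwartz_cmult schwartz_scale_sqrt)
    show ?thesis using schwartz_diff[OF s schwartz_mult[OF \<phi>(1) s]] by (simp add: algebra_simps)
  qed
  show "\<exists>C>0. \<forall>t>0. kernel_bound (\<lambda>\<xi>. (1 - \<phi> \<xi>) * of_real (sqrt t) * M (sqrt t *\<^sub>R \<xi>)) C (C * t powr (- (real CARD('n) / 2)))"
    if "schwartz M" for M
    using kernel_bound_high[OF that \<phi>] by (simp add: mult.assoc)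
qed

lemma scale_decay_Lp:
  fixes m :: "real \<Rightarrow> real^'n::finite \<Rightarrow> complex"
  assumes "scale_decay m"
  shows "\<exists>C>0. \<forall>t>0. \<forall>p q u. 1 < q \<longrightarrow> q \<le> p \<longrightarrow> q \<noteq> \<top> \<longrightarrow> weighted_integrable u \<longrightarrow>
     Lp_norm p (conv_op (\<lambda>\<xi>. freq_monomial ks \<xi> * m t \<xi>) u)
       \<le> ennreal (C * t powr (- (real CARD('n) / 2 * (enn2real (1/q) - enn2real (1/p)) + real (length ks) / 2))) * Lp_norm q u"
proof -
  let ?J = "\<lambda>t. t powr (- (real (length ks) / 2))" and ?N = "\<lambda>t. t powr (- (real CARD('n) / 2))"
  obtain C where C: "C > 0" "\<And>t. t > 0 \<Longrightarrow> kernel_bound (\<lambda>\<xi>. freq_monomial ks \<xi> * m t \<xi>) (C * ?J t) (C * ?J t * ?N t)"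
    using assms unfolding scale_decay_def by meson
  have "Lp_norm p (conv_op (\<lambda>\<xi>. freq_monomial ks \<xi> * m t \<xi>) u)
       \<le> ennreal (C * t powr (- (real CARD('n) / 2 * (enn2real (1/q) - enn2real (1/p)) + real (length ks) / 2))) * Lp_norm q u"
    if t: "t > 0" and pq: "1 < q" "q \<le> p" "q \<noteq> \<top>" and u: "weighted_integrable u" for t p q u
  proof -
    define \<theta> where "\<theta> = enn2real (1/q) - enn2real (1/p)"
    let ?m = "\<lambda>\<xi>. freq_monomial ks \<xi> * m t \<xi>"
    have m: "schwartz ?m" using assms t by (intro schwartz_freq_monomial scale_decay_schwartz)
    have "Lp_norm p (\<lambda>x. LINT y|lborel. ift ?m (x - y) * u y)
       \<le> ennreal ((C * ?J t) powr (1 - \<theta>) * (C * ?J t * ?N t) powr \<theta>) * Lp_norm q u"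
      unfolding \<theta>_def
      by (rule Lp_norm_convolution) (use C t pq u in \<open>auto simp: kernel_bound_def intro: schwartz_ift_measurable[OF m] weighted_integrable_measurable\<close>)
    \<comment> \<open>The derivative factor occurs in both endpoint bounds and thus survives the
      interpolation unchanged; only t^(-N/2) is raised to the power \<theta>.\<close>
    also have "(C * ?J t) powr (1 - \<theta>) * (C * ?J t * ?N t) powr \<theta> = ((C * ?J t) powr (1 - \<theta>) * (C * ?J t) powr \<theta>) * (?N t) powr \<theta>"
      by (simp add: powr_mult mult_ac)
    also have "(C * ?J t) powr (1 - \<theta>) * (C * ?J t) powr \<theta> = C * ?J t" using C(1) t by (simp flip: powr_add)
    also have "C * ?J t * (?N t) powr \<theta> = C * t powr (- (real (length ks) / 2) + - (real CARD('n) / 2) * \<theta>)"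
      by (simp only: powr_powr powr_add mult.assoc)
    also have "- (real (length ks) / 2) + - (real CARD('n) / 2) * \<theta> = - (real CARD('n) / 2 * \<theta> + real (length ks) / 2)"
      by simp
    finally show ?thesis unfolding conv_op_def[abs_def] \<theta>_def .
  qed
  then show ?thesis using C(1) by blast
qed

section \<open>The explicit solution of the Fourier-transformed system\<close>

text \<open>The weight w makes the family closed under derivatives in s: each of them multiplies w
  by b + \<tau> (a - b).\<close>

definition div_diff_weighted :: "complex \<Rightarrow> complex \<Rightarrow> (real \<Rightarrow> complex) \<Rightarrow> real \<Rightarrow> complex" where
  "div_diff_weighted a b w s = integral {0..1} (\<lambda>\<tau>. w \<tau> * exp (of_real s * (b + of_real \<tau> * (a - b))))"

text \<open>The divided difference (exp(sa) - exp(sb)) / (s (a - b)), written as an integral so that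
  a = b and s = 0 need no separate treatment.\<close>

definition div_diff :: "complex \<Rightarrow> complex \<Rightarrow> real \<Rightarrow> complex" where
  "div_diff a b = div_diff_weighted a b (\<lambda>_. 1)"

lemma div_diff_weighted_integrable:
  fixes w :: "real \<Rightarrow> complex"
  assumes "continuous_on {0..1} w"
  shows "(\<lambda>\<tau>. w \<tau> * exp (of_real s * (b + of_real \<tau> * (a - b)))) integrable_on {0..1}"
  using assms by (intro integrable_continuous_real continuous_intros)

lemma div_diff_weighted_deriv:
  assumes w: "continuous_on {0..1} w"
  shows "(div_diff_weighted a b w has_vector_derivative div_diff_weighted a b (\<lambda>\<tau>. w \<tau> * (b + of_real \<tau> * (a - b))) s) (at s)"
proof -
  have "((\<lambda>s. integral (cbox 0 1) (\<lambda>\<tau>. w \<tau> * exp (of_real s * (b + of_real \<tau> * (a - b))))) has_vector_derivative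
     integral (cbox 0 1) (\<lambda>\<tau>. (w \<tau> * (b + of_real \<tau> * (a - b))) * exp (of_real s * (b + of_real \<tau> * (a - b))))) (at s within UNIV)"
  proof (rule leibniz_rule_vector_derivative)
    show "((\<lambda>s. w \<tau> * exp (of_real s * (b + of_real \<tau> * (a - b)))) has_vector_derivative
       (w \<tau> * (b + of_real \<tau> * (a - b))) * exp (of_real s * (b + of_real \<tau> * (a - b)))) (at s within UNIV)" for s \<tau>
      unfolding mult.assoc by (intro has_vector_derivative_mult_right has_vector_derivative_exp_of_real)
    show "(\<lambda>\<tau>. w \<tau> * exp (of_real s * (b + of_real \<tau> * (a - b)))) integrable_on cbox 0 1" for s
      using div_diff_weighted_integrable[OF w] by simp
    have "continuous_on (UNIV \<times> cbox 0 1) (\<lambda>p::real\<times>real. w (snd p))"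
      by (rule continuous_on_compose2[OF w]) (auto intro!: continuous_intros)
    then show "continuous_on (UNIV \<times> cbox 0 1) (\<lambda>(s, \<tau>). (w \<tau> * (b + of_real \<tau> * (a - b))) * exp (of_real s * (b + of_real \<tau> * (a - b))))"
      unfolding case_prod_beta' by (intro continuous_intros)
  qed auto
  then show ?thesis unfolding div_diff_weighted_def[abs_def] by simp
qed

text \<open>The exponents b + \<tau> (a - b) run through the segment from b to a, so by convexity
  their real parts are at most -c; the continuous weight is bounded on the unit interval.\<close>

lemma div_diff_weighted_bound:
  assumes w: "continuous_on {0..1} w" and c: "Re a \<le> - c" "Re b \<le> - c"
  shows "\<exists>B. \<forall>s\<ge>0. norm (div_diff_weighted a b w s) \<le> B * exp (- c * s)"
proof -
  have "bounded (w ` {0..1})" by (intro compact_imp_bounded compact_continuous_image w) auto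
  then obtain B where B: "\<And>\<tau>. \<tau> \<in> {0..1} \<Longrightarrow> norm (w \<tau>) \<le> B" unfolding bounded_iff by blast
  have "norm (div_diff_weighted a b w s) \<le> B * exp (- c * s)" if s: "s \<ge> 0" for s
  proof -
    have "norm (div_diff_weighted a b w s) \<le> (B * exp (- c * s)) * (1 - 0)"
      unfolding div_diff_weighted_def
    proof (rule integral_bound)
      show "continuous_on {0..1} (\<lambda>\<tau>. w \<tau> * exp (of_real s * (b + of_real \<tau> * (a - b))))"
        using w by (intro continuous_intros)
      fix \<tau> :: real assume t: "\<tau> \<in> {0..1}"
      have "Re (b + of_real \<tau> * (a - b)) = (1 - \<tau>) * Re b + \<tau> * Re a" by (simp add: algebra_simps)
      also have "\<dots> \<le> (1 - \<tau>) * (- c) + \<tau> * (- c)" using t c by (intro add_mono mult_left_mono) auto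
      finally have "s * Re (b + of_real \<tau> * (a - b)) \<le> s * (- c)" using s by (intro mult_left_mono) (auto simp: algebra_simps)
      then have "norm (exp (of_real s * (b + of_real \<tau> * (a - b)))) \<le> exp (- c * s)"
        by (simp add: mult.commute)
      then show "norm (w \<tau> * exp (of_real s * (b + of_real \<tau> * (a - b)))) \<le> B * exp (- c * s)"
        unfolding norm_mult by (intro mult_mono B t) (auto intro: order_trans[OF norm_ge_zero B[OF t]])
    qed simp
    then show ?thesis by simp
  qed
  then show ?thesis by blast
qed

lemma radial_profile_div_diff:
  assumes "Re a < 0" "Re b < 0" shows "radial_profile (div_diff a b)"
proof (rule radial_profile_closedI[where X = "\<lambda>h. \<exists>w. h = div_diff_weighted a b w \<and> continuous_on {0..1} w"])
  show "\<exists>w. div_diff a b = div_diff_weighted a b w \<and> continuous_on {0..1} w" unfolding div_diff_def by (intro exI[of _ "\<lambda>_. 1"]) auto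
  fix h assume "\<exists>w. h = div_diff_weighted a b w \<and> continuous_on {0..1} w"
  then obtain w where h: "h = div_diff_weighted a b w" and w: "continuous_on {0..1} w" by blast
  define c where "c = min (- Re a) (- Re b)"
  have c: "c > 0" "Re a \<le> - c" "Re b \<le> - c" using assms by (auto simp: c_def)
  obtain B where B: "\<And>s. s \<ge> 0 \<Longrightarrow> norm (h s) \<le> B * exp (- c * s)"
    using div_diff_weighted_bound[OF w c(2,3)] unfolding h by blast
  show "\<exists>C. \<forall>s\<ge>0. s ^ n * norm (h s) \<le> C" for n by (rule radial_profile_bound_exp[OF c(1) B])
  have "\<forall>s. (h has_vector_derivative div_diff_weighted a b (\<lambda>\<tau>. w \<tau> * (b + of_real \<tau> * (a - b))) s) (at s)"
    unfolding h using div_diff_weighted_deriv[OF w] by blast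
  moreover have "continuous_on {0..1} (\<lambda>\<tau>. w \<tau> * (b + of_real \<tau> * (a - b)))" using w by (intro continuous_intros)
  ultimately show "\<exists>h'. (\<forall>s. (h has_vector_derivative h' s) (at s)) \<and> (\<exists>w. h' = div_diff_weighted a b w \<and> continuous_on {0..1} w)"
    by blast
qed

text \<open>The fundamental theorem of calculus in \<tau>. In product form the identity also covers
  a = b and s = 0.\<close>

lemma div_diff_eq: "of_real s * (a - b) * div_diff a b s = exp (of_real s * a) - exp (of_real s * b)"
proof -
  have e: "((\<lambda>\<tau>. (of_real s * (a - b)) * (1 * exp (of_real s * (b + of_real \<tau> * (a - b))))) has_integral
     (exp (of_real s * (b + of_real 1 * (a - b))) - exp (of_real s * (b + of_real 0 * (a - b))))) {0..1}"
  proof (rule fundamental_theorem_of_calculus)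
    fix \<tau> :: real
    have "((\<lambda>z. exp (of_real s * (b + z * (a - b)))) has_field_derivative (of_real s * (a - b)) * (1 * exp (of_real s * (b + of_real \<tau> * (a - b))))) (at (of_real \<tau>))"
      by (auto intro!: derivative_eq_intros)
    from has_vector_derivative_at_within[OF has_vector_derivative_real_field[OF this]]
    show "((\<lambda>\<tau>. exp (of_real s * (b + of_real \<tau> * (a - b)))) has_vector_derivative (of_real s * (a - b)) * (1 * exp (of_real s * (b + of_real \<tau> * (a - b))))) (at \<tau> within {0..1})" .
  qed simp
  have R: "exp (of_real s * (b + of_real 1 * (a - b))) - exp (of_real s * (b + of_real 0 * (a - b))) = exp (of_real s * a) - exp (of_real s * b)"
    by simp
  show ?thesis using integral_unique[OF e] unfolding R integral_mult_right div_diff_def div_diff_weighted_def .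
qed

text \<open>The second property is the product rule for s times \<open>div_diff\<close>, free of
  division. It is obtained by integrating over [0, 1] the \<tau>-derivative of \<tau> exp(s (b +
  \<tau> (a - b))).\<close>

lemma div_diff_deriv:
  obtains d where "\<And>s. (div_diff a b has_vector_derivative d s) (at s)"
    and "\<And>s. div_diff a b s + of_real s * d s = exp (of_real s * a) + b * (of_real s * div_diff a b s)"
proof
  define d where "d = div_diff_weighted a b (\<lambda>\<tau>. 1 * (b + of_real \<tau> * (a - b)))"
  show "(div_diff a b has_vector_derivative d s) (at s)" for s
    unfolding div_diff_def d_def by (rule div_diff_weighted_deriv) simp
  fix s
  let ?e = "\<lambda>\<tau>. exp (of_real s * (b + of_real \<tau> * (a - b)))"
  have "((\<lambda>\<tau>. (1 * ?e \<tau> + of_real s * ((1 * (b + of_real \<tau> * (a - b))) * ?e \<tau>)) - (b * of_real s) * (1 * ?e \<tau>)) has_integral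
     (of_real 1 * ?e 1 - of_real 0 * ?e 0)) {0..1}"
  proof (rule fundamental_theorem_of_calculus)
    fix \<tau> :: real
    have "((\<lambda>z. z * exp (of_real s * (b + z * (a - b)))) has_field_derivative
        ((1 * ?e \<tau> + of_real s * ((1 * (b + of_real \<tau> * (a - b))) * ?e \<tau>)) - (b * of_real s) * (1 * ?e \<tau>))) (at (of_real \<tau>))"
      by (auto intro!: derivative_eq_intros simp: algebra_simps)
    from has_vector_derivative_at_within[OF has_vector_derivative_real_field[OF this]]
    show "((\<lambda>\<tau>. of_real \<tau> * ?e \<tau>) has_vector_derivative ((1 * ?e \<tau> + of_real s * ((1 * (b + of_real \<tau> * (a - b))) * ?e \<tau>)) - (b * of_real s) * (1 * ?e \<tau>))) (at \<tau> within {0..1})" .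
  qed simp
  then have "integral {0..1} (\<lambda>\<tau>. (1 * ?e \<tau> + of_real s * ((1 * (b + of_real \<tau> * (a - b))) * ?e \<tau>)) - (b * of_real s) * (1 * ?e \<tau>)) = exp (of_real s * a)"
    by (simp add: integral_unique)
  also have "integral {0..1} (\<lambda>\<tau>. (1 * ?e \<tau> + of_real s * ((1 * (b + of_real \<tau> * (a - b))) * ?e \<tau>)) - (b * of_real s) * (1 * ?e \<tau>))
     = (div_diff a b s + of_real s * d s) - (b * of_real s) * div_diff a b s"
  proof -
    have i: "(\<lambda>\<tau>. 1 * ?e \<tau>) integrable_on {0..1}" by (rule div_diff_weighted_integrable) simp
    have j: "(\<lambda>\<tau>. (1 * (b + of_real \<tau> * (a - b))) * ?e \<tau>) integrable_on {0..1}"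
      by (rule div_diff_weighted_integrable) (intro continuous_intros)
    show ?thesis
      unfolding div_diff_def d_def div_diff_weighted_def integral_mult_right[symmetric]
      by (subst Henstock_Kurzweil_Integration.integral_diff, intro integrable_add integrable_on_mult_right i j, intro integrable_on_mult_right i,
          subst Henstock_Kurzweil_Integration.integral_add, rule i, intro integrable_on_mult_right j) (rule refl)
  qed
  finally show "div_diff a b s + of_real s * d s = exp (of_real s * a) + b * (of_real s * div_diff a b s)"
    by (simp add: algebra_simps)
qed

text \<open>Gronwall's argument: with L bounding A, exp(-2 L s) |v|^2 is nonincreasing and starts at
  0.\<close>

lemma linear_ode_zero_nonneg:
  fixes A :: "'a::real_inner \<Rightarrow> 'a"
  assumes A: "bounded_linear A" and v: "\<And>s. (v has_vector_derivative A (v s)) (at s)" and v0: "v 0 = 0" and "s \<ge> 0"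
  shows "v s = 0"
proof -
  obtain L where L: "\<And>x. norm (A x) \<le> norm x * L" using bounded_linear.bounded[OF A] by blast
  define f where "f s = exp (- 2 * L * s) * (v s \<bullet> v s)" for s
  have "f s \<le> f 0"
  proof (rule DERIV_nonpos_imp_nonincreasing[OF \<open>s \<ge> 0\<close>])
    fix x
    have "((\<lambda>s. v s \<bullet> v s) has_vector_derivative (v x \<bullet> A (v x) + A (v x) \<bullet> v x)) (at x)"
      using bounded_bilinear.has_vector_derivative[OF bounded_bilinear_inner v v] .
    then have "((\<lambda>s. v s \<bullet> v s) has_real_derivative 2 * (v x \<bullet> A (v x))) (at x)"
      by (simp add: has_real_derivative_iff_has_vector_derivative inner_commute)
    then have D: "(f has_real_derivative (- 2 * L * exp (- 2 * L * x)) * (v x \<bullet> v x) + exp (- 2 * L * x) * (2 * (v x \<bullet> A (v x)))) (at x)"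
      unfolding f_def by (auto intro!: derivative_eq_intros)
    have "v x \<bullet> A (v x) \<le> norm (v x) * (norm (v x) * L)"
      by (rule order_trans[OF norm_cauchy_schwarz]) (intro mult_left_mono L, simp)
    also have "\<dots> = L * (v x \<bullet> v x)" by (simp add: power2_norm_eq_inner[symmetric] power2_eq_square)
    finally have "exp (- 2 * L * x) * (2 * (v x \<bullet> A (v x))) \<le> exp (- 2 * L * x) * (2 * (L * (v x \<bullet> v x)))"
      by (intro mult_left_mono) auto
    then have "(- 2 * L * exp (- 2 * L * x)) * (v x \<bullet> v x) + exp (- 2 * L * x) * (2 * (v x \<bullet> A (v x))) \<le> 0"
      by (simp add: algebra_simps)
    with D show "\<exists>y. (f has_real_derivative y) (at x) \<and> y \<le> 0" by blast
  qed
  then have "v s \<bullet> v s \<le> 0" by (simp add: f_def v0 mult_le_0_iff)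
  then show ?thesis by (metis inner_gt_zero_iff not_le)
qed

text \<open>Negative times follow by reversing time, which replaces A by -A; \<open>sol_hat\<close>
  describes a solution on the whole line.\<close>

lemma linear_ode_zero:
  fixes A :: "'a::real_inner \<Rightarrow> 'a"
  assumes A: "bounded_linear A" and v: "\<And>s. (v has_vector_derivative A (v s)) (at s)" and v0: "v 0 = 0"
  shows "v s = 0"
proof (cases "s \<ge> 0")
  case True
  then show ?thesis by (rule linear_ode_zero_nonneg[OF assms])
next
  case False
  have "((\<lambda>s. v (- s)) has_vector_derivative - A (v (- s))) (at s)" for s
  proof -
    have "(uminus has_vector_derivative (- 1 :: real)) (at s)" by (auto intro!: derivative_eq_intros)
    from vector_diff_chain_at[where g = v, OF this, of "A (v (- s))"] v[of "- s"] show ?thesis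
      by (simp add: comp_def)
  qed
  then have "v (- (- s)) = 0"
    by (rule linear_ode_zero_nonneg[OF bounded_linear_minus[OF A], of "\<lambda>s. v (- s)"]) (use False v0 in auto)
  then show ?thesis by simp
qed

lemma bounded_linear_symb: "bounded_linear (symb \<alpha> \<beta> \<kappa> \<rho> \<xi>)"
  unfolding linear_conv_bounded_linear[symmetric]
proof (rule linearI)
  fix U V :: "complex^('a option)"
  show "symb \<alpha> \<beta> \<kappa> \<rho> \<xi> (U + V) = symb \<alpha> \<beta> \<kappa> \<rho> \<xi> U + symb \<alpha> \<beta> \<kappa> \<rho> \<xi> V"
    unfolding symb_def by (simp add: vec_eq_iff algebra_simps sum.distrib split: option.split)
  show "symb \<alpha> \<beta> \<kappa> \<rho> \<xi> (c *\<^sub>R U) = c *\<^sub>R symb \<alpha> \<beta> \<kappa> \<rho> \<xi> U" for c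
    unfolding symb_def
    by (simp add: vec_eq_iff algebra_simps scaleR_conv_of_real[where 'a = complex] sum_distrib_left split: option.split)
qed

lemma has_vector_derivative_vecI:
  fixes u :: "real \<Rightarrow> complex^'i::finite"
  assumes "\<And>i. ((\<lambda>s. u s $ i) has_vector_derivative d $ i) (at s)"
  shows "(u has_vector_derivative d) (at s)"
proof -
  have ax: "bounded_linear (axis i :: complex \<Rightarrow> complex^'i)" for i
    unfolding linear_conv_bounded_linear[symmetric]
    by (rule linearI) (auto simp: vec_eq_iff axis_def)
  have eq: "(\<Sum>i\<in>UNIV. axis i (v $ i)) = v" for v :: "complex^'i"
    by (simp add: vec_eq_iff axis_def)
  have "((\<lambda>s. \<Sum>i\<in>UNIV. axis i (u s $ i)) has_vector_derivative (\<Sum>i\<in>UNIV. axis i (d $ i))) (at s)"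
    by (rule has_vector_derivative_sum) (rule bounded_linear.has_vector_derivative[OF ax assms])
  then show ?thesis unfolding eq .
qed

text \<open>The description in \<open>sol_hat\<close> denotes a solution only once existence and
  uniqueness are known. Existence is the given u, uniqueness is \<open>linear_ode_zero\<close> for
  the difference of two solutions.\<close>

lemma sol_hat_eqI:
  assumes "u 0 = U0" "\<And>s. (u has_vector_derivative symb \<alpha> \<beta> \<kappa> \<rho> \<xi> (u s)) (at s)"
  shows "sol_hat \<alpha> \<beta> \<kappa> \<rho> \<xi> t U0 = u t"
proof -
  have "(THE u. u 0 = U0 \<and> (\<forall>s. (u has_vector_derivative symb \<alpha> \<beta> \<kappa> \<rho> \<xi> (u s)) (at s))) = u"
  proof (rule the_equality)
    fix v assume v: "v 0 = U0 \<and> (\<forall>s. (v has_vector_derivative symb \<alpha> \<beta> \<kappa> \<rho> \<xi> (v s)) (at s))"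
    interpret bounded_linear "symb \<alpha> \<beta> \<kappa> \<rho> \<xi>" by (rule bounded_linear_symb)
    have "v s - u s = 0" for s
    proof (rule linear_ode_zero[OF bounded_linear_symb, of "\<lambda>s. v s - u s"])
      show "((\<lambda>s. v s - u s) has_vector_derivative symb \<alpha> \<beta> \<kappa> \<rho> \<xi> (v s - u s)) (at s)" for s
        unfolding diff using v assms(2) by (intro has_vector_derivative_diff) auto
    qed (use v assms(1) in auto)
    then show "v = u" by (intro ext) simp
  qed (use assms in auto)
  then show ?thesis unfolding sol_hat_def by simp
qed

text \<open>The roots are (-g + w) / 2 and (-g - w) / 2 with w^2 = g^2 - 4 c. Either w is real and
  smaller than g in modulus, because c > 0, or it is purely imaginary.\<close>

lemma damped_roots:
  fixes g c :: real
  assumes "g > 0" "c > 0"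
  obtains a b :: complex where "a + b = - of_real g" "a * b = of_real c" "Re a < 0" "Re b < 0"
proof -
  define w where "w = csqrt (of_real (g\<^sup>2 - 4 * c))"
  have w2: "w\<^sup>2 = of_real (g\<^sup>2 - 4 * c)" by (simp add: w_def)
  have Rew: "Re w < g \<and> - g < Re w"
  proof (cases "g\<^sup>2 - 4 * c \<ge> 0")
    case True
    then have w: "w = of_real (sqrt (g\<^sup>2 - 4 * c))" 
      unfolding w_def by (intro csqrt_of_real)
    have "sqrt (g\<^sup>2 - 4 * c) < sqrt (g\<^sup>2)" using assms by (intro real_sqrt_less_mono) simp
    moreover have "0 \<le> sqrt (g\<^sup>2 - 4 * c)" using True by simp
    moreover from this have "- g < sqrt (g\<^sup>2 - 4 * c)" using assms by linarith
    ultimately show ?thesis using assms unfolding w by simp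
  next
    case False
    have "Im (w\<^sup>2) = 0" "Re (w\<^sup>2) < 0" unfolding w2 using False by auto
    \<comment> \<open>A vanishing imaginary part of w^2 makes Re w or Im w zero, and a negative real
      part excludes Im w = 0.\<close>
    then have "Re w = 0" by (auto simp: power2_eq_square mult_le_0_iff not_le) 
    then show ?thesis using assms by simp
  qed
  show thesis
  proof
    show "(- of_real g + w) / 2 + (- of_real g - w) / 2 = - of_real g" by (simp add: field_simps)
    have "(- of_real g + w) / 2 * ((- of_real g - w) / 2) = ((of_real g)\<^sup>2 - w\<^sup>2) / 4"
      by (simp add: field_simps power2_eq_square)
    then show "(- of_real g + w) / 2 * ((- of_real g - w) / 2) = of_real c" by (simp add: w2)
  qed (use Rew in auto)
qed

text \<open>In the variable s = t |\<xi>|^2, \<open>P\<close> propagates theta,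
  \<open>div_diff a b\<close> couples theta with the divergence, the exponential of rate -\<alpha>
  is the heat flow of the divergence-free part, and \<open>H\<close> corrects that flow in the
  direction of \<xi>. The formula is verified by inserting it into the system.\<close>

lemma sol_hat_formula:
  fixes \<xi> :: "real^'n::finite" and \<alpha> \<beta> \<kappa> \<rho> :: real and a b :: complex
  assumes ab: "a + b = - of_real (\<alpha> + \<beta>)" "a * b = of_real (\<kappa> * \<rho>)"
  defines "P \<equiv> \<lambda>s. exp (of_real s * a) - a * (of_real s * div_diff a b s)"
    and "H \<equiv> \<lambda>s. (a + of_real \<alpha>) * div_diff a (- of_real \<alpha>) s + b * div_diff a b s"
  shows "sol_hat \<alpha> \<beta> \<kappa> \<rho> \<xi> t U0 = (\<chi> i. case i of
      None \<Rightarrow> P (t * (norm \<xi>)\<^sup>2) * U0$None - \<i> * (of_real t * div_diff a b (t * (norm \<xi>)\<^sup>2)) * (\<Sum>l\<in>UNIV. of_real (\<xi>$l) * U0$(Some l))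
    | Some k \<Rightarrow> - \<i> * of_real (\<kappa> * \<rho>) * of_real (\<xi>$k) * (of_real (t * (norm \<xi>)\<^sup>2) * div_diff a b (t * (norm \<xi>)\<^sup>2)) * U0$None
        + exp (of_real (t * (norm \<xi>)\<^sup>2) * (- of_real \<alpha>)) * U0$(Some k)
        + of_real (\<xi>$k) * (of_real t * H (t * (norm \<xi>)\<^sup>2)) * (\<Sum>l\<in>UNIV. of_real (\<xi>$l) * U0$(Some l)))"
proof -
  define r where "r = (norm \<xi>)\<^sup>2"
  define c where "c = complex_of_real (\<kappa> * \<rho>)"
  define d0 where "d0 = (\<Sum>l\<in>UNIV. of_real (\<xi>$l) * U0$(Some l))"
  define D where "D s = of_real s * div_diff a b s" for s
  \<comment> \<open>The derivative of \<open>D\<close>, written without dividing by a - b.\<close>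
  define D1 where "D1 s = exp (of_real s * a) + b * D s" for s
  define E where "E s = exp (of_real s * (- complex_of_real \<alpha>))" for s
  define u where "u t = (\<chi> i. case i of
      None \<Rightarrow> P (t * r) * U0$None - \<i> * (of_real t * div_diff a b (t * r)) * d0
    | Some k \<Rightarrow> - \<i> * c * of_real (\<xi>$k) * D (t * r) * U0$None + E (t * r) * U0$(Some k)
        + of_real (\<xi>$k) * (of_real t * H (t * r)) * d0)" for t
  have PD: "P s = exp (of_real s * a) - a * D s" for s by (simp add: P_def D_def)
  obtain F' where F': "\<And>s. (div_diff a b has_vector_derivative F' s) (at s)"
    and F'D: "\<And>s. div_diff a b s + of_real s * F' s = D1 s" using div_diff_deriv[of a b] unfolding D1_def D_def by metis
  obtain G' where G': "\<And>s. (div_diff a (- of_real \<alpha>) has_vector_derivative G' s) (at s)"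
    and G'D: "\<And>s. div_diff a (- of_real \<alpha>) s + of_real s * G' s = exp (of_real s * a) + (- of_real \<alpha>) * (of_real s * div_diff a (- of_real \<alpha>) s)"
    using div_diff_deriv[of a "- of_real \<alpha>"] by metis
  have chain: "((\<lambda>t. h (t * r)) has_vector_derivative of_real r * h' (t * r)) (at t)"
    if "\<And>s. (h has_vector_derivative h' s) (at s)" for h h' :: "real \<Rightarrow> complex" and t
  proof -
    have "((\<lambda>t. t * r) has_vector_derivative r) (at t)"
      by (auto intro!: derivative_eq_intros simp: has_real_derivative_iff_has_vector_derivative[symmetric])
    from vector_diff_chain_at[OF this that[of "t * r"]] show ?thesis
      by (simp add: comp_def scaleR_conv_of_real)
  qed
  have tchain: "((\<lambda>t. of_real t * h (t * r)) has_vector_derivative h (t * r) + of_real (t * r) * h' (t * r)) (at t)"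
    if "\<And>s. (h has_vector_derivative h' s) (at s)" for h h' :: "real \<Rightarrow> complex" and t
    using has_vector_derivative_mult[OF bounded_linear.has_vector_derivative[OF bounded_linear_of_real, of "\<lambda>t. t" 1 "at t"] chain[OF that, of t]]
    by (simp add: add.commute mult_ac)
  have D: "(D has_vector_derivative D1 s) (at s)" for s
    using has_vector_derivative_mult[OF bounded_linear.has_vector_derivative[OF bounded_linear_of_real, of "\<lambda>t. t" 1 "at s"] F'[of s]] F'D[of s]
    unfolding D_def[abs_def] by (simp add: add.commute)
  have D': "((\<lambda>t. D (t * r)) has_vector_derivative of_real r * D1 (t * r)) (at t)" for t
    by (rule chain[OF D])
  have E': "((\<lambda>t. E (t * r)) has_vector_derivative of_real r * (- of_real \<alpha> * E (t * r))) (at t)" for t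
    unfolding E_def by (rule chain[OF has_vector_derivative_exp_of_real])
  have P0: "(P has_vector_derivative a * exp (of_real s * a) - a * D1 s) (at s)" for s
    unfolding PD[abs_def]
    by (intro has_vector_derivative_diff has_vector_derivative_mult_right has_vector_derivative_exp_of_real D)
  have "a * exp (of_real s * a) - a * D1 s = - c * D s" for s
    using ab(2) by (simp add: D1_def c_def algebra_simps)
  with P0 have P1: "(P has_vector_derivative - c * D s) (at s)" for s by metis
  have P: "((\<lambda>t. P (t * r)) has_vector_derivative of_real r * (- c * D (t * r))) (at t)" for t
    by (rule chain[OF P1])
  have F: "((\<lambda>t. of_real t * div_diff a b (t * r)) has_vector_derivative D1 (t * r)) (at t)" for t
    using tchain[OF F', of t] F'D[of "t * r"] by simp
  have sG: "of_real s * (a + of_real \<alpha>) * div_diff a (- of_real \<alpha>) s = exp (of_real s * a) - E s" for s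
    using div_diff_eq[of s a "- of_real \<alpha>"] by (simp add: E_def)
  \<comment> \<open>\<open>H\<close> hides the projection \<xi>$k \<xi>$l / |\<xi>|^2 applied to the
    difference of the propagators \<open>D1\<close> (along \<xi>) and \<open>E\<close> (across
    \<xi>). Both equal 1 at s = 0, which is why the quotient by s is regular.\<close>
  have sH: "of_real s * H s = D1 s - E s" for s
    using sG[of s] by (simp add: H_def D1_def D_def algebra_simps)
  have H0: "(H has_vector_derivative ((a + of_real \<alpha>) * G' s + b * F' s)) (at s)" for s
    unfolding H_def by (intro has_vector_derivative_add has_vector_derivative_mult_right G' F')
  have H: "((\<lambda>t. of_real t * H (t * r)) has_vector_derivative a * exp (of_real (t * r) * a) + b * D1 (t * r) + of_real \<alpha> * E (t * r)) (at t)" for t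
  proof -
    let ?s = "t * r"
    have "H ?s + of_real ?s * ((a + of_real \<alpha>) * G' ?s + b * F' ?s)
        = (a + of_real \<alpha>) * (div_diff a (- of_real \<alpha>) ?s + of_real ?s * G' ?s) + b * (div_diff a b ?s + of_real ?s * F' ?s)"
      by (simp add: H_def algebra_simps)
    also have "\<dots> = (a + of_real \<alpha>) * exp (of_real ?s * a) - of_real \<alpha> * (of_real ?s * (a + of_real \<alpha>) * div_diff a (- of_real \<alpha>) ?s) + b * D1 ?s"
      unfolding G'D F'D by (simp add: algebra_simps)
    also have "\<dots> = a * exp (of_real ?s * a) + b * D1 ?s + of_real \<alpha> * E ?s"
      unfolding sG by (simp add: algebra_simps)
    finally show ?thesis using tchain[OF H0, of t] by simp
  qed
  have e: "complex_of_real \<alpha> + of_real \<beta> = - (a + b)" unfolding ab(1) by simp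
  have "complex_of_real \<beta> = (complex_of_real \<alpha> + of_real \<beta>) - of_real \<alpha>" by simp
  \<comment> \<open>With \<beta> expressed through a, b and \<alpha>, the remaining identities
    become polynomial and need no case distinction on the roots.\<close>
  then have gam: "complex_of_real \<beta> = - a - b - of_real \<alpha>" unfolding e by simp
  \<comment> \<open>This is the equation z'' + (\<alpha> + \<beta>) z' + c z = 0 for
    \<open>D\<close>.\<close>
  have D2: "a * exp (of_real s * a) + b * D1 s = - (of_real \<alpha> + of_real \<beta>) * D1 s - c * D s" for s
    unfolding gam c_def ab(2)[symmetric] D1_def by (simp add: algebra_simps)
  have norm2: "(\<Sum>l\<in>UNIV. complex_of_real (\<xi>$l) * of_real (\<xi>$l)) = of_real r"
    by (simp add: r_def norm_vec_def L2_set_def sum_nonneg power2_eq_square)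
  \<comment> \<open>Contraction with \<xi> turns \<open>H\<close> back into \<open>D1 - E\<close>;
    the heat parts cancel and only \<open>D\<close> and \<open>D1\<close> remain.\<close>
  have div: "(\<Sum>l\<in>UNIV. of_real (\<xi>$l) * u t $ Some l) = - \<i> * c * of_real r * D (t * r) * U0$None + D1 (t * r) * d0" for t
  proof -
    have "(\<Sum>l\<in>UNIV. of_real (\<xi>$l) * u t $ Some l)
      = (\<Sum>l\<in>UNIV. (of_real (\<xi>$l) * of_real (\<xi>$l)) * (- \<i> * c * D (t * r) * U0$None + (of_real t * H (t * r)) * d0)
          + E (t * r) * (of_real (\<xi>$l) * U0$Some l))"
      by (intro sum.cong) (auto simp: u_def algebra_simps)
    also have "\<dots> = of_real r * (- \<i> * c * D (t * r) * U0$None + (of_real t * H (t * r)) * d0) + E (t * r) * d0"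
      by (simp only: sum.distrib sum_distrib_right[symmetric] sum_distrib_left[symmetric] norm2 d0_def)
    also have "\<dots> = - \<i> * c * of_real r * D (t * r) * U0$None + (of_real (t * r) * H (t * r) + E (t * r)) * d0"
      by (simp add: algebra_simps)
    finally show ?thesis unfolding sH by simp
  qed
  have "sol_hat \<alpha> \<beta> \<kappa> \<rho> \<xi> t U0 = u t"
  proof (rule sol_hat_eqI)
    show "u 0 = U0"
      by (auto simp: u_def vec_eq_iff P_def D_def E_def split: option.split)
    fix t
    show "(u has_vector_derivative symb \<alpha> \<beta> \<kappa> \<rho> \<xi> (u t)) (at t)"
    proof (rule has_vector_derivative_vecI)
      fix i :: "'n option"
      show "((\<lambda>s. u s $ i) has_vector_derivative symb \<alpha> \<beta> \<kappa> \<rho> \<xi> (u t) $ i) (at t)"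
      proof (cases i)
        case None
        have "((\<lambda>t. P (t * r) * U0$None - \<i> * (of_real t * div_diff a b (t * r)) * d0) has_vector_derivative
           (of_real r * (- c * D (t * r))) * U0$None - \<i> * D1 (t * r) * d0) (at t)"
          by (intro has_vector_derivative_diff has_vector_derivative_mult_left has_vector_derivative_mult_right P F)
        moreover have "symb \<alpha> \<beta> \<kappa> \<rho> \<xi> (u t) $ None = (of_real r * (- c * D (t * r))) * U0$None - \<i> * D1 (t * r) * d0"
          unfolding symb_def by (simp add: div algebra_simps)
        ultimately show ?thesis unfolding None by (simp add: u_def)
      next
        case (Some k)
        have "((\<lambda>t. - \<i> * c * of_real (\<xi>$k) * D (t * r) * U0$None + E (t * r) * U0$(Some k)
            + of_real (\<xi>$k) * (of_real t * H (t * r)) * d0) has_vector_derivative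
           - \<i> * c * of_real (\<xi>$k) * (of_real r * D1 (t * r)) * U0$None + (of_real r * (- of_real \<alpha> * E (t * r))) * U0$(Some k)
            + of_real (\<xi>$k) * (a * exp (of_real (t * r) * a) + b * D1 (t * r) + of_real \<alpha> * E (t * r)) * d0) (at t)"
          by (intro has_vector_derivative_add has_vector_derivative_mult_left has_vector_derivative_mult_right D' E' H)
        moreover have "symb \<alpha> \<beta> \<kappa> \<rho> \<xi> (u t) $ Some k =
           - \<i> * c * of_real (\<xi>$k) * (of_real r * D1 (t * r)) * U0$None + (of_real r * (- of_real \<alpha> * E (t * r))) * U0$(Some k)
            + of_real (\<xi>$k) * (a * exp (of_real (t * r) * a) + b * D1 (t * r) + of_real \<alpha> * E (t * r)) * d0"
        proof -
          have 1: "symb \<alpha> \<beta> \<kappa> \<rho> \<xi> (u t) $ Some k = - (of_real \<alpha> * of_real r) * u t $ Some k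
             - of_real \<beta> * of_real (\<xi>$k) * (- \<i> * c * of_real r * D (t * r) * U0$None + D1 (t * r) * d0)
             - \<i> * (c * of_real r * of_real (\<xi>$k)) * u t $ None"
            unfolding symb_def by (simp add: div r_def c_def)
          \<comment> \<open>The factor r coming from the system is multiplied in, never divided out,
            so \<xi> = 0 is covered.\<close>
          have 2: "of_real r * (of_real t * H (t * r)) = D1 (t * r) - E (t * r)"
            using sH[of "t * r"] by (simp add: mult_ac)
          have 3: "of_real r * (of_real t * div_diff a b (t * r)) = D (t * r)" by (simp add: D_def mult_ac)
          have uS: "of_real r * u t $ Some k = of_real r * (- \<i> * c * of_real (\<xi>$k) * D (t * r) * U0$None + E (t * r) * U0$(Some k))
             + of_real (\<xi>$k) * (D1 (t * r) - E (t * r)) * d0"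
            unfolding 2[symmetric] by (simp add: u_def algebra_simps)
          have uN: "of_real r * u t $ None = of_real r * P (t * r) * U0$None - \<i> * D (t * r) * d0"
            unfolding 3[symmetric] by (simp add: u_def algebra_simps)
          have P1: "P s = D1 s - (a + b) * D s" for s by (simp add: PD D1_def algebra_simps)
          have "symb \<alpha> \<beta> \<kappa> \<rho> \<xi> (u t) $ Some k = - of_real \<alpha> * (of_real r * u t $ Some k)
             - of_real \<beta> * of_real (\<xi>$k) * (- \<i> * c * of_real r * D (t * r) * U0$None + D1 (t * r) * d0)
             - \<i> * c * of_real (\<xi>$k) * (of_real r * u t $ None)"
            unfolding 1 by (simp only: mult_ac minus_mult_left)
          also have "\<dots> = - \<i> * c * of_real (\<xi>$k) * (of_real r * D1 (t * r)) * U0$None + (of_real r * (- of_real \<alpha> * E (t * r))) * U0$(Some k)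
            + of_real (\<xi>$k) * ((- (of_real \<alpha> + of_real \<beta>) * D1 (t * r) - c * D (t * r)) + of_real \<alpha> * E (t * r)) * d0"
            unfolding uS uN P1 gam by (simp add: algebra_simps)
          finally show ?thesis unfolding D2 .
        qed
        ultimately show ?thesis unfolding Some by (simp add: u_def)
      qed
    qed
  qed
  then show ?thesis unfolding u_def r_def c_def D_def E_def d0_def .
qed

section \<open>Low and high frequency estimates\<close>

text \<open>The variable z bundles the time with the data. Since C precedes z, estimates can be
  summed without tracking constants while uniformity in time and data is kept.\<close>

definition bounded_by :: "('z \<Rightarrow> bool) \<Rightarrow> ('z \<Rightarrow> real) \<Rightarrow> ('z \<Rightarrow> ennreal) \<Rightarrow> ('z \<Rightarrow> ennreal) \<Rightarrow> bool" where
  "bounded_by R T X F \<longleftrightarrow> (\<exists>C>0. \<forall>z. R z \<longrightarrow> F z \<le> ennreal (C * T z) * X z)"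

lemma bounded_by_add:
  assumes "bounded_by R T X F" "bounded_by R T X G" and T: "\<And>z. R z \<Longrightarrow> T z \<ge> 0"
  shows "bounded_by R T X (\<lambda>z. F z + G z)"
proof -
  obtain C where C: "C > 0" "\<And>z. R z \<Longrightarrow> F z \<le> ennreal (C * T z) * X z" using assms(1) unfolding bounded_by_def by blast
  obtain D where D: "D > 0" "\<And>z. R z \<Longrightarrow> G z \<le> ennreal (D * T z) * X z" using assms(2) unfolding bounded_by_def by blast
  have "F z + G z \<le> ennreal ((C + D) * T z) * X z" if "R z" for z
  proof -
    have "F z + G z \<le> ennreal (C * T z) * X z + ennreal (D * T z) * X z"
      by (intro add_mono C D that)
    also have "\<dots> = ennreal ((C + D) * T z) * X z"
      using C(1) D(1) T[OF that] by (simp add: distrib_right ennreal_plus)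
    finally show ?thesis .
  qed
  then show ?thesis unfolding bounded_by_def using C(1) D(1) by (intro exI[of _ "C + D"]) auto
qed

lemma bounded_by_sum:
  assumes "finite I" "\<And>i. i \<in> I \<Longrightarrow> bounded_by R T X (F i)" and T: "\<And>z. R z \<Longrightarrow> T z \<ge> 0"
  shows "bounded_by R T X (\<lambda>z. \<Sum>i\<in>I. F i z)"
  using assms(1,2)
proof (induction I rule: finite_induct)
  case empty
  then show ?case unfolding bounded_by_def by (intro exI[of _ 1]) auto
next
  case (insert i I)
  then have "bounded_by R T X (\<lambda>z. F i z + (\<Sum>i\<in>I. F i z))" by (intro bounded_by_add T) auto
  then show ?case using insert.hyps by simp
qed

lemma bounded_by_mono:
  assumes "bounded_by R' T X' F'" "\<And>z. R z \<Longrightarrow> R' z" "\<And>z. R z \<Longrightarrow> X' z \<le> X z" "\<And>z. R z \<Longrightarrow> F z \<le> F' z"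
  shows "bounded_by R T X F"
  using assms unfolding bounded_by_def by (meson mult_left_mono order_trans zero_le)

text \<open>For infinite data norm X the right-hand side is infinite, because C and T are positive.
  Hence the data may be assumed to have finite norm.\<close>

lemma bounded_by_finiteI:
  assumes "bounded_by (\<lambda>z. R z \<and> X z \<noteq> \<top>) T X F" and T: "\<And>z. R z \<Longrightarrow> T z > 0"
  shows "bounded_by R T X F"
proof -
  obtain C where C: "C > 0" "\<And>z. R z \<Longrightarrow> X z \<noteq> \<top> \<Longrightarrow> F z \<le> ennreal (C * T z) * X z"
    using assms(1) unfolding bounded_by_def by blast
  have "F z \<le> ennreal (C * T z) * X z" if "R z" for z
    using C T[OF that] that by (cases "X z = \<top>") (auto simp: ennreal_mult_top)
  then show ?thesis unfolding bounded_by_def using C(1) by blast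
qed

text \<open>All components decay with the same power of t, so a finite sum of convolutions obeys one
  bound against the total norm of the data. The index i runs over the components of the
  data.\<close>

lemma bounded_by_conv_sum:
  fixes m :: "'i::finite \<Rightarrow> real \<Rightarrow> real^'n::finite \<Rightarrow> complex"
  assumes m: "\<And>i. scale_decay (m i)"
    and R: "\<And>z. R z \<Longrightarrow> 0 < \<tau> z \<and> 1 < q \<and> q \<le> p \<and> q \<noteq> \<top> \<and> (\<forall>i. weighted_integrable (u z i))"
  shows "bounded_by R (\<lambda>z. \<tau> z powr (- (real CARD('n) / 2 * (enn2real (1/q) - enn2real (1/p)) + real (length ks) / 2)))
     (\<lambda>z. \<Sum>i\<in>UNIV. Lp_norm q (u z i))
     (\<lambda>z. Lp_norm p (\<lambda>x. \<Sum>i\<in>UNIV. conv_op (\<lambda>\<xi>. freq_monomial ks \<xi> * m i (\<tau> z) \<xi>) (u z i) x))"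
proof -
  let ?T = "\<lambda>z. \<tau> z powr (- (real CARD('n) / 2 * (enn2real (1/q) - enn2real (1/p)) + real (length ks) / 2))"
  let ?X = "\<lambda>z. \<Sum>i\<in>UNIV. Lp_norm q (u z i)"
  have "bounded_by R ?T ?X (\<lambda>z. Lp_norm p (conv_op (\<lambda>\<xi>. freq_monomial ks \<xi> * m i (\<tau> z) \<xi>) (u z i)))" for i
  proof -
    obtain C where C: "C > 0" "\<And>t p q u. t > 0 \<Longrightarrow> 1 < q \<Longrightarrow> q \<le> p \<Longrightarrow> q \<noteq> \<top> \<Longrightarrow> weighted_integrable u \<Longrightarrow>
       Lp_norm p (conv_op (\<lambda>\<xi>. freq_monomial ks \<xi> * m i t \<xi>) u)
       \<le> ennreal (C * t powr (- (real CARD('n) / 2 * (enn2real (1/q) - enn2real (1/p)) + real (length ks) / 2))) * Lp_norm q u"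
      using scale_decay_Lp[OF m[of i], of ks] by blast
    have "Lp_norm p (conv_op (\<lambda>\<xi>. freq_monomial ks \<xi> * m i (\<tau> z) \<xi>) (u z i)) \<le> ennreal (C * ?T z) * ?X z" if "R z" for z
    proof -
      have "Lp_norm p (conv_op (\<lambda>\<xi>. freq_monomial ks \<xi> * m i (\<tau> z) \<xi>) (u z i)) \<le> ennreal (C * ?T z) * Lp_norm q (u z i)"
        using R[OF that] by (intro C) auto
      also have "\<dots> \<le> ennreal (C * ?T z) * ?X z" by (intro mult_left_mono member_le_sum) auto
      finally show ?thesis .
    qed
    then show ?thesis unfolding bounded_by_def using C(1) by blast
  qed
  then have "bounded_by R ?T ?X (\<lambda>z. \<Sum>i\<in>UNIV. Lp_norm p (conv_op (\<lambda>\<xi>. freq_monomial ks \<xi> * m i (\<tau> z) \<xi>) (u z i)))"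
    by (intro bounded_by_sum) auto
  then obtain C where C: "C > 0" "\<And>z. R z \<Longrightarrow> (\<Sum>i\<in>UNIV. Lp_norm p (conv_op (\<lambda>\<xi>. freq_monomial ks \<xi> * m i (\<tau> z) \<xi>) (u z i))) \<le> ennreal (C * ?T z) * ?X z"
    unfolding bounded_by_def by blast
  have "Lp_norm p (\<lambda>x. \<Sum>i\<in>UNIV. conv_op (\<lambda>\<xi>. freq_monomial ks \<xi> * m i (\<tau> z) \<xi>) (u z i) x) \<le> ennreal ((2 ^ CARD('i) * C) * ?T z) * ?X z" if z: "R z" for z
  proof -
    have "Lp_norm p (\<lambda>x. \<Sum>i\<in>UNIV. conv_op (\<lambda>\<xi>. freq_monomial ks \<xi> * m i (\<tau> z) \<xi>) (u z i) x)
       \<le> 2 ^ CARD('i) * (\<Sum>i\<in>UNIV. Lp_norm p (conv_op (\<lambda>\<xi>. freq_monomial ks \<xi> * m i (\<tau> z) \<xi>) (u z i)))"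
    proof (rule Lp_norm_sum)
      show "conv_op (\<lambda>\<xi>. freq_monomial ks \<xi> * m i (\<tau> z) \<xi>) (u z i) \<in> borel_measurable borel" for i
        using R[OF z] m by (intro measurable_conv_op schwartz_freq_monomial scale_decay_schwartz) auto
      show "p \<ge> 1" using R[OF z] by (meson dual_order.strict_trans1 less_imp_le order_trans)
    qed simp
    also have "\<dots> \<le> 2 ^ CARD('i) * (ennreal (C * ?T z) * ?X z)" by (intro mult_left_mono C z) auto
    also have "\<dots> = ennreal (2 ^ CARD('i) * (C * ?T z)) * ?X z"
      using C(1) by (simp add: ennreal_mult mult.assoc flip: ennreal_numeral ennreal_power)
    finally show ?thesis by (simp add: mult.assoc)
  qed
  then show ?thesis unfolding bounded_by_def using C(1) by (intro exI[of _ "2 ^ CARD('i) * C"]) auto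
qed

lemma sum_option_UNIV: "(\<Sum>i\<in>UNIV. h i) = h None + (\<Sum>k\<in>UNIV. h (Some k))"
  for h :: "'k::finite option \<Rightarrow> 'b::comm_monoid_add"
  unfolding UNIV_option_conv by (subst sum.insert) (auto simp: sum.reindex)

lemma sum_pair_UNIV: "(\<Sum>k\<in>UNIV. \<Sum>l\<in>UNIV. h (k, l)) = (\<Sum>kl\<in>UNIV. h kl)"
  for h :: "'k::finite \<times> 'l::finite \<Rightarrow> 'b::comm_monoid_add"
  by (simp add: sum.cartesian_product)

text \<open>The roots are parameters subject only to their sum, product and real parts, so that
  real, complex and double roots share one set of symbols.\<close>

locale low_high =
  fixes \<alpha> \<beta> \<kappa> \<rho> :: real and a b :: complex and \<epsilon> :: real and \<phi> :: "real^'n::finite \<Rightarrow> real"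
  assumes \<alpha>: "\<alpha> > 0" and ab: "a + b = - of_real (\<alpha> + \<beta>)" "a * b = of_real (\<kappa> * \<rho>)"
    and Re: "Re a < 0" "Re b < 0" and \<epsilon>: "\<epsilon> > 0" and \<phi>: "cutoff \<epsilon> \<phi>"
begin

section \<open>Scaled symbols of the solution operator\<close>

definition \<phi>c :: "real^'n \<Rightarrow> complex" where "\<phi>c \<xi> = of_real (\<phi> \<xi>)"
definition MF :: "real^'n \<Rightarrow> complex" where "MF \<eta> = div_diff a b ((norm \<eta>)\<^sup>2)"
text \<open>This is |\<eta>|^2 \<open>MF \<eta>\<close>, written with coordinate factors so that
  \<open>schwartz_coord\<close> applies.\<close>

definition MD :: "real^'n \<Rightarrow> complex" where "MD \<eta> = (\<Sum>k\<in>UNIV. of_real (\<eta>$k) * (of_real (\<eta>$k) * MF \<eta>))"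
definition MP :: "real^'n \<Rightarrow> complex" where "MP \<eta> = exp (of_real ((norm \<eta>)\<^sup>2) * a) - a * MD \<eta>"
definition ME :: "real^'n \<Rightarrow> complex" where "ME \<eta> = exp (of_real ((norm \<eta>)\<^sup>2) * (- of_real \<alpha>))"
definition MH :: "real^'n \<Rightarrow> complex" where "MH \<eta> = (a + of_real \<alpha>) * div_diff a (- of_real \<alpha>) ((norm \<eta>)\<^sup>2) + b * MF \<eta>"

lemma schwartz_symbols: "schwartz \<phi>c" "schwartz MF" "schwartz MD" "schwartz MP" "schwartz ME" "schwartz MH"
proof -
  show "schwartz \<phi>c" unfolding \<phi>c_def[abs_def]
    using \<phi> by (intro schwartz_test_fn[where R = "2 * \<epsilon>"]) (auto simp: cutoff_def)
  show F: "schwartz MF" unfolding MF_def[abs_def] by (rule schwartz_radial_profile[OF radial_profile_div_diff]) (use Re in auto)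
  show D: "schwartz MD" unfolding MD_def[abs_def] by (rule schwartz_sum) (rule schwartz_coord[OF schwartz_coord[OF F]])
  show "schwartz MP" unfolding MP_def[abs_def]
    by (rule schwartz_diff[OF schwartz_radial_profile[OF radial_profile_exp[OF Re(1)]] schwartz_cmult[OF D]])
  show "schwartz ME" unfolding ME_def[abs_def] by (rule schwartz_radial_profile[OF radial_profile_exp]) (use \<alpha> in simp)
  have "schwartz (\<lambda>\<eta>::real^'n. div_diff a (- of_real \<alpha>) ((norm \<eta>)\<^sup>2))"
    by (rule schwartz_radial_profile[OF radial_profile_div_diff]) (use Re \<alpha> in auto)
  then show "schwartz MH" unfolding MH_def[abs_def] by (rule schwartz_add[OF schwartz_cmult schwartz_cmult[OF F]])
qed

lemma \<phi>c_0: "\<phi>c 0 = 1"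
  using \<phi> \<epsilon> by (simp add: \<phi>c_def cutoff_def)

lemma MD_eq: "MD \<eta> = of_real ((norm \<eta>)\<^sup>2) * div_diff a b ((norm \<eta>)\<^sup>2)"
proof -
  have "(\<Sum>k\<in>UNIV. complex_of_real (\<eta>$k) * of_real (\<eta>$k)) = of_real ((norm \<eta>)\<^sup>2)"
    by (simp add: norm_vec_def L2_set_def sum_nonneg power2_eq_square)
  then show ?thesis unfolding MD_def MF_def by (simp add: mult.assoc[symmetric] sum_distrib_right[symmetric])
qed

abbreviation "sol \<xi> t \<equiv> sol_hat \<alpha> \<beta> \<kappa> \<rho> \<xi> t"

text \<open>The columns of the solution matrix in terms of fixed functions of sqrt t \<xi>. What
  stays outside, powers of t and coordinates of \<xi>, is the imbalance that the two frequency
  regimes have to repair.\<close>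

lemma sol_axis:
  assumes t: "t > 0"
  shows "sol \<xi> t (axis None 1) $ None = MP (sqrt t *\<^sub>R \<xi>)"
    and "sol \<xi> t (axis None 1) $ Some k = - \<i> * of_real (\<kappa> * \<rho>) * of_real (\<xi>$k) * MD (sqrt t *\<^sub>R \<xi>)"
    and "sol \<xi> t (axis (Some l) 1) $ None = - \<i> * (of_real t * MF (sqrt t *\<^sub>R \<xi>)) * of_real (\<xi>$l)"
    and "sol \<xi> t (axis (Some l) 1) $ Some k = (if k = l then ME (sqrt t *\<^sub>R \<xi>) else 0)
       + of_real (\<xi>$k) * (of_real t * MH (sqrt t *\<^sub>R \<xi>)) * of_real (\<xi>$l)"
proof -
  have n: "(norm (sqrt t *\<^sub>R \<xi>))\<^sup>2 = t * (norm \<xi>)\<^sup>2" using t by (simp add: power_mult_distrib)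
  have s0: "(\<Sum>k\<in>UNIV. complex_of_real (\<xi>$k) * axis None 1 $ Some k) = 0" by (simp add: axis_def)
  have s1: "(\<Sum>k\<in>UNIV. complex_of_real (\<xi>$k) * axis (Some l) 1 $ Some k) = of_real (\<xi>$l)"
    by (simp add: axis_def if_distrib cong: if_cong)
  show "sol \<xi> t (axis None 1) $ None = MP (sqrt t *\<^sub>R \<xi>)"
    unfolding sol_hat_formula[OF ab] MP_def MD_eq n s0 by (simp add: axis_def)
  show "sol \<xi> t (axis None 1) $ Some k = - \<i> * of_real (\<kappa> * \<rho>) * of_real (\<xi>$k) * MD (sqrt t *\<^sub>R \<xi>)"
    unfolding sol_hat_formula[OF ab] MD_eq n s0 by (simp add: axis_def)
  show "sol \<xi> t (axis (Some l) 1) $ None = - \<i> * (of_real t * MF (sqrt t *\<^sub>R \<xi>)) * of_real (\<xi>$l)"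
    unfolding sol_hat_formula[OF ab] MF_def n s1 by (simp add: axis_def)
  show "sol \<xi> t (axis (Some l) 1) $ Some k = (if k = l then ME (sqrt t *\<^sub>R \<xi>) else 0)
       + of_real (\<xi>$k) * (of_real t * MH (sqrt t *\<^sub>R \<xi>)) * of_real (\<xi>$l)"
    unfolding sol_hat_formula[OF ab] MH_def ME_def MF_def n s1 by (simp add: axis_def)
qed

text \<open>A factor t is used up by exactly two coordinates, each taking sqrt t.\<close>

lemma sqrt_comp:
  assumes "t > 0"
  shows "complex_of_real ((sqrt t *\<^sub>R \<xi>)$k) * (of_real ((sqrt t *\<^sub>R \<xi>)$l) * z) = of_real (\<xi>$k) * (of_real (\<xi>$l) * (of_real t * z))"
proof -
  have "complex_of_real (sqrt t) * of_real (sqrt t) = of_real t" using assms by (simp flip: of_real_mult)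
  moreover have "complex_of_real ((sqrt t *\<^sub>R \<xi>)$k) * (of_real ((sqrt t *\<^sub>R \<xi>)$l) * z)
    = (complex_of_real (sqrt t) * of_real (sqrt t)) * (of_real (\<xi>$k) * (of_real (\<xi>$l) * z))"
    by (simp add: mult_ac)
  ultimately show ?thesis by (simp add: mult_ac)
qed

text \<open>Together with the factor i \<xi>$l from Div, the entry of theta for \<open>G\<close> has
  two coordinates for its factor t and is balanced. The entries of m have one coordinate too many;
  it joins \<open>\<phi>c\<close>, and the product is again a fixed Schwartz function.\<close>

fun low :: "'n option \<Rightarrow> ('n \<times> 'n) option \<Rightarrow> real \<Rightarrow> real^'n \<Rightarrow> complex" where
  "low None None t \<xi> = \<phi>c \<xi> * MP (sqrt t *\<^sub>R \<xi>)"
| "low (Some m) None t \<xi> = (- \<i> * of_real (\<kappa> * \<rho>)) * ((of_real (\<xi>$m) * \<phi>c \<xi>) * MD (sqrt t *\<^sub>R \<xi>))"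
| "low None (Some (k, l)) t \<xi> = \<phi>c \<xi> * (of_real ((sqrt t *\<^sub>R \<xi>)$l) * (of_real ((sqrt t *\<^sub>R \<xi>)$k) * MF (sqrt t *\<^sub>R \<xi>)))"
| "low (Some m) (Some (k, l)) t \<xi> = (if m = k then \<i> else 0) * ((of_real (\<xi>$l) * \<phi>c \<xi>) * ME (sqrt t *\<^sub>R \<xi>))
     + \<i> * ((of_real (\<xi>$l) * \<phi>c \<xi>) * (of_real ((sqrt t *\<^sub>R \<xi>)$m) * (of_real ((sqrt t *\<^sub>R \<xi>)$k) * MH (sqrt t *\<^sub>R \<xi>))))"

lemma scale_decay_low: "scale_decay (low A i)"
proof -
  note s = schwartz_symbols
  have c: "schwartz (\<lambda>\<xi>. complex_of_real (\<xi>$l) * \<phi>c \<xi>)" for l by (rule schwartz_coord[OF s(1)])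
  have cc: "schwartz (\<lambda>\<eta>. complex_of_real (\<eta>$k) * (of_real (\<eta>$l) * M \<eta>))" if "schwartz M" for k l M
    by (rule schwartz_coord[OF schwartz_coord[OF that]])
  consider "A = None" "i = None" | m where "A = Some m" "i = None" | k l where "A = None" "i = Some (k, l)"
    | m k l where "A = Some m" "i = Some (k, l)" by (metis not_None_eq surj_pair)
  then show ?thesis
  proof cases
    case 1
    then show ?thesis using scale_decay_mult[OF s(1) s(4)] by (simp only: low.simps[symmetric])
  next
    case (2 m)
    then show ?thesis using scale_decay_cmult[OF scale_decay_mult[OF c[of m] s(3)], of "- \<i> * of_real (\<kappa> * \<rho>)"] by (simp only: low.simps[symmetric])
  next
    case (3 k l)
    then show ?thesis using scale_decay_mult[OF s(1) cc[OF s(2), of l k]] by (simp only: low.simps[symmetric])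
  next
    case (4 m k l)
    then show ?thesis
      using scale_decay_add[OF scale_decay_cmult[OF scale_decay_mult[OF c[of l] s(5)], of "if m = k then \<i> else 0"]
          scale_decay_cmult[OF scale_decay_mult[OF c[of l] cc[OF s(6), of m k]], of \<i>]]
      by (simp only: low.simps[symmetric])
  qed
qed

lemma low_eq:
  assumes t: "t > 0"
  shows "of_real (\<phi> \<xi>) * sol \<xi> t (axis None 1) $ A = low A None t \<xi>"
    and "of_real (\<phi> \<xi>) * \<i> * of_real (\<xi>$l) * sol \<xi> t (axis (Some k) 1) $ A = low A (Some (k, l)) t \<xi>"
proof -
  show "of_real (\<phi> \<xi>) * sol \<xi> t (axis None 1) $ A = low A None t \<xi>"
    by (cases A; simp only: low.simps sol_axis[OF t] \<phi>c_def mult_ac)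
  show "of_real (\<phi> \<xi>) * \<i> * of_real (\<xi>$l) * sol \<xi> t (axis (Some k) 1) $ A = low A (Some (k, l)) t \<xi>"
  proof (cases A)
    case None
    show ?thesis unfolding None low.simps sol_axis[OF t] sqrt_comp[OF t] \<phi>c_def by (simp add: algebra_simps)
  next
    case (Some m)
    show ?thesis unfolding Some low.simps sol_axis[OF t] sqrt_comp[OF t] \<phi>c_def by (simp add: algebra_simps)
  qed
qed

text \<open>A single index type for f and the entries of \<open>G\<close> turns the nested sums of
  \<open>S_cut_Div\<close> into one sum over a finite type, as \<open>bounded_by_conv_sum\<close>
  expects.\<close>

definition data_Div :: "(real^'n \<Rightarrow> real) \<Rightarrow> (real^'n \<Rightarrow> real^'n^'n) \<Rightarrow> ('n \<times> 'n) option \<Rightarrow> real^'n \<Rightarrow> complex" where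
  "data_Div f G i y = (case i of None \<Rightarrow> of_real (f y) | Some (k, l) \<Rightarrow> of_real (G y $ k $ l))"

lemma data_Div_simps:
  "data_Div f G None = (\<lambda>y. of_real (f y))" "data_Div f G (Some (k, l)) = (\<lambda>y. of_real (G y $ k $ l))"
  by (auto simp: data_Div_def)

lemma S_cut_Div_eq:
  assumes t: "t > 0"
  shows "S_cut_Div \<alpha> \<beta> \<kappa> \<rho> \<phi> t f G A = (\<lambda>x. \<Sum>i\<in>UNIV. conv_op (low A i t) (data_Div f G i) x)"
proof
  fix x
  have "S_cut_Div \<alpha> \<beta> \<kappa> \<rho> \<phi> t f G A x = conv_op (low A None t) (data_Div f G None) x
     + (\<Sum>k\<in>UNIV. \<Sum>l\<in>UNIV. conv_op (low A (Some (k, l)) t) (data_Div f G (Some (k, l))) x)"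
    unfolding S_cut_Div_def low_eq[OF t] data_Div_simps ..
  also have "\<dots> = (\<Sum>i\<in>UNIV. conv_op (low A i t) (data_Div f G i) x)"
    unfolding sum_option_UNIV sum_pair_UNIV[of "\<lambda>kl. conv_op (low A (Some kl) t) (data_Div f G (Some kl)) x"] ..
  finally show "S_cut_Div \<alpha> \<beta> \<kappa> \<rho> \<phi> t f G A x = (\<Sum>i\<in>UNIV. conv_op (low A i t) (data_Div f G i) x)" .
qed

lemma sum_data_Div: "(\<Sum>i\<in>UNIV. Lp_norm q (data_Div f G i)) = Lp_norm q f + (\<Sum>k\<in>UNIV. \<Sum>l\<in>UNIV. Lp_norm q (\<lambda>x. G x $ k $ l))"
  unfolding sum_option_UNIV sum_pair_UNIV[of "\<lambda>kl. Lp_norm q (data_Div f G (Some kl))", symmetric] data_Div_simps by simp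

lemma low_frequency_estimate:
  "\<exists>C>0. \<forall>(t::real) (f::real^'n \<Rightarrow> real) (G::real^'n \<Rightarrow> real^'n^'n).
         0 < t \<and> 1 < q \<and> q \<le> p \<and> q \<noteq> \<top> \<and>
         f \<in> borel_measurable lborel \<and> (\<forall>k l. (\<lambda>x. G x $ k $ l) \<in> borel_measurable lborel) \<longrightarrow>
         (\<Sum>A\<in>UNIV. deriv_Lp p j (S_cut_Div \<alpha> \<beta> \<kappa> \<rho> \<phi> t f G A))
           \<le> ennreal (C * t powr (- (real CARD('n) / 2 * (enn2real (1/q) - enn2real (1/p)) + real j / 2)))
             * (Lp_norm q f + (\<Sum>k\<in>UNIV. \<Sum>l\<in>UNIV. Lp_norm q (\<lambda>x. G x $ k $ l)))"
proof -
  define R where "R = (\<lambda>(t, f, G). (0::real) < t \<and> 1 < q \<and> q \<le> p \<and> q \<noteq> \<top> \<and>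
         (f::real^'n \<Rightarrow> real) \<in> borel_measurable lborel \<and> (\<forall>k l. (\<lambda>x::real^'n. (G x :: real^'n^'n) $ k $ l) \<in> borel_measurable lborel))"
  define X where "X = (\<lambda>(t::real, f, G). \<Sum>i\<in>UNIV. Lp_norm q (data_Div f G i))"
  define T where "T = (\<lambda>(t, f::real^'n \<Rightarrow> real, G::real^'n \<Rightarrow> real^'n^'n). t powr (- (real CARD('n) / 2 * (enn2real (1/q) - enn2real (1/p)) + real j / 2)))"
  have "bounded_by R T X (\<lambda>(t, f, G). \<Sum>A\<in>UNIV. deriv_Lp p j (S_cut_Div \<alpha> \<beta> \<kappa> \<rho> \<phi> t f G A))"
  \<comment> \<open>With finite norms every component of the data is weighted integrable, and
    derivatives may be moved into the symbols.\<close>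
  proof (rule bounded_by_finiteI)
    define R' where "R' = (\<lambda>z. R z \<and> X z \<noteq> \<top>)"
    have w: "weighted_integrable (data_Div f G i)" if z: "R' (t, f, G)" for t f G i
    proof -
      have "Lp_norm q f + (\<Sum>k\<in>UNIV. \<Sum>l\<in>UNIV. Lp_norm q (\<lambda>x. G x $ k $ l)) \<noteq> \<top>"
        using z unfolding R'_def X_def sum_data_Div by simp
      then have "Lp_norm q f \<noteq> \<top>" "\<And>k l. Lp_norm q (\<lambda>x. G x $ k $ l) \<noteq> \<top>" by auto
      then have "weighted_integrable (\<lambda>y. of_real (f y))" "\<And>k l. weighted_integrable (\<lambda>y. of_real (G y $ k $ l))"
        using z unfolding R'_def R_def by (auto intro!: Lp_norm_finite_weighted_integrable)
      then show ?thesis by (cases i) (auto simp: data_Div_simps)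
    qed
    have "bounded_by R' T X (\<lambda>(t, f, G). Lp_norm p (partials ks (S_cut_Div \<alpha> \<beta> \<kappa> \<rho> \<phi> t f G A)))"
      if ks: "length ks = j" for ks A
    proof -
      have "bounded_by R' (\<lambda>z. fst z powr (- (real CARD('n) / 2 * (enn2real (1/q) - enn2real (1/p)) + real (length ks) / 2)))
        (\<lambda>z. \<Sum>i\<in>UNIV. Lp_norm q (data_Div (fst (snd z)) (snd (snd z)) i))
        (\<lambda>z. Lp_norm p (\<lambda>x. \<Sum>i\<in>UNIV. conv_op (\<lambda>\<xi>. freq_monomial ks \<xi> * low A i (fst z) \<xi>) (data_Div (fst (snd z)) (snd (snd z)) i) x))"
        by (rule bounded_by_conv_sum[OF scale_decay_low]) (use w in \<open>auto simp: R'_def R_def\<close>)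
      moreover have "partials ks (S_cut_Div \<alpha> \<beta> \<kappa> \<rho> \<phi> t f G A) = (\<lambda>x. \<Sum>i\<in>UNIV. conv_op (\<lambda>\<xi>. freq_monomial ks \<xi> * low A i t \<xi>) (data_Div f G i) x)"
        if "R' (t, f, G)" for t f G
      proof -
        have t: "t > 0" using that by (simp add: R'_def R_def)
        show ?thesis unfolding S_cut_Div_eq[OF t]
          by (intro partials_sum_conv_op scale_decay_schwartz[OF scale_decay_low t] w[OF that])
      qed
      ultimately show ?thesis unfolding bounded_by_def T_def X_def ks case_prod_beta' by auto
    qed
    then show "bounded_by (\<lambda>z. R z \<and> X z \<noteq> \<top>) T X (\<lambda>(t, f, G). \<Sum>A\<in>UNIV. deriv_Lp p j (S_cut_Div \<alpha> \<beta> \<kappa> \<rho> \<phi> t f G A))"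
      unfolding deriv_Lp_def case_prod_beta' R'_def[symmetric]
      by (intro bounded_by_sum) (auto simp: T_def finite_lists_length_eq[of UNIV, simplified])
  qed (auto simp: T_def R_def)
  then show ?thesis unfolding bounded_by_def R_def X_def T_def sum_data_Div by auto
qed

text \<open>For data g the factor t \<xi>$k is split as sqrt t times the coordinate of sqrt t \<xi>.
  The remaining sqrt t stays beside \<open>1 - \<phi>c\<close>, in the form required by
  \<open>scale_decay_high_sqrt\<close>.\<close>

fun high_\<theta> :: "'n option \<Rightarrow> real \<Rightarrow> real^'n \<Rightarrow> complex" where
  "high_\<theta> None t \<xi> = (1 - \<phi>c \<xi>) * MP (sqrt t *\<^sub>R \<xi>)"
| "high_\<theta> (Some k) t \<xi> = - \<i> * (((1 - \<phi>c \<xi>) * of_real (sqrt t)) * (of_real ((sqrt t *\<^sub>R \<xi>)$k) * MF (sqrt t *\<^sub>R \<xi>)))"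

text \<open>Both high_D\<theta> l and high_m m act on f through its l-th, respectively m-th, weak derivative:
  one factor \<i> \<xi>$l of their entry for f has been moved to the data.\<close>

fun high_D\<theta> :: "'n \<Rightarrow> 'n option \<Rightarrow> real \<Rightarrow> real^'n \<Rightarrow> complex" where
  "high_D\<theta> l None t \<xi> = (1 - \<phi>c \<xi>) * MP (sqrt t *\<^sub>R \<xi>)"
| "high_D\<theta> l (Some k) t \<xi> = (1 - \<phi>c \<xi>) * (of_real ((sqrt t *\<^sub>R \<xi>)$l) * (of_real ((sqrt t *\<^sub>R \<xi>)$k) * MF (sqrt t *\<^sub>R \<xi>)))"

fun high_m :: "'n \<Rightarrow> 'n option \<Rightarrow> real \<Rightarrow> real^'n \<Rightarrow> complex" where
  "high_m m None t \<xi> = (- of_real (\<kappa> * \<rho>)) * ((1 - \<phi>c \<xi>) * MD (sqrt t *\<^sub>R \<xi>))"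
| "high_m m (Some k) t \<xi> = (if m = k then 1 else 0) * ((1 - \<phi>c \<xi>) * ME (sqrt t *\<^sub>R \<xi>))
     + (1 - \<phi>c \<xi>) * (of_real ((sqrt t *\<^sub>R \<xi>)$m) * (of_real ((sqrt t *\<^sub>R \<xi>)$k) * MH (sqrt t *\<^sub>R \<xi>)))"

lemma scale_decay_high_symbols: "scale_decay (high_\<theta> i)" "scale_decay (high_D\<theta> l i)" "scale_decay (high_m m i)"
proof -
  note s = schwartz_symbols
  have c: "schwartz (\<lambda>\<xi>. complex_of_real (\<xi>$l) * M \<xi>)" if "schwartz M" for l M by (rule schwartz_coord[OF that])
  have cc: "schwartz (\<lambda>\<eta>. complex_of_real (\<eta>$k) * (of_real (\<eta>$l) * M \<eta>))" if "schwartz M" for k l M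
    by (rule schwartz_coord[OF schwartz_coord[OF that]])
  show "scale_decay (high_\<theta> i)"
  proof (cases i)
    case None
    then show ?thesis using scale_decay_high[OF s(1) s(4)] by (simp only: high_\<theta>.simps[symmetric])
  next
    case (Some k)
    then show ?thesis using scale_decay_cmult[OF scale_decay_high_sqrt[OF s(1) \<phi>c_0 c[OF s(2), of k]], of "- \<i>"]
      by (simp only: high_\<theta>.simps[symmetric])
  qed
  show "scale_decay (high_D\<theta> l i)"
  proof (cases i)
    case None
    have "high_D\<theta> l None = (\<lambda>t \<xi>. (1 - \<phi>c \<xi>) * MP (sqrt t *\<^sub>R \<xi>))" by (intro ext) simp
    then show ?thesis using scale_decay_high[OF s(1) s(4)] None by simp
  next
    case (Some k)
    then show ?thesis using scale_decay_high[OF s(1) cc[OF s(2), of l k]]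
      by (simp only: high_D\<theta>.simps[symmetric])
  qed
  show "scale_decay (high_m m i)"
  proof (cases i)
    case None
    have "high_m m None = (\<lambda>t \<xi>. (- of_real (\<kappa> * \<rho>)) * ((1 - \<phi>c \<xi>) * MD (sqrt t *\<^sub>R \<xi>)))" by (intro ext) simp
    then show ?thesis using scale_decay_cmult[OF scale_decay_high[OF s(1) s(3)], of "- of_real (\<kappa> * \<rho>)"] None by (simp only:)
  next
    case (Some k)
    then show ?thesis using scale_decay_add[OF scale_decay_cmult[OF scale_decay_high[OF s(1) s(5)], of "if m = k then 1 else 0"] scale_decay_high[OF s(1) cc[OF s(6), of m k]]]
      by (simp only: high_m.simps[symmetric])
  qed
qed

text \<open>The fourth identity shows why the gradient of theta is no worse than theta: the extra
  coordinate \<xi>$l takes up the remaining sqrt t, which leaves a balanced symbol.\<close>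

lemma high_eq:
  assumes t: "t > 0"
  shows "of_real (1 - \<phi> \<xi>) * sol \<xi> t (axis None 1) $ None = high_\<theta> None t \<xi>"
    and "of_real (1 - \<phi> \<xi>) * sol \<xi> t (axis (Some k) 1) $ None = high_\<theta> (Some k) t \<xi>"
    and "\<i> * of_real (\<xi>$l) * high_\<theta> None t \<xi> = \<i> * of_real (\<xi>$l) * high_D\<theta> l None t \<xi>"
    and "\<i> * of_real (\<xi>$l) * high_\<theta> (Some k) t \<xi> = high_D\<theta> l (Some k) t \<xi>"
    and "of_real (1 - \<phi> \<xi>) * sol \<xi> t (axis None 1) $ Some m = \<i> * of_real (\<xi>$m) * high_m m None t \<xi>"
    and "of_real (1 - \<phi> \<xi>) * sol \<xi> t (axis (Some k) 1) $ Some m = high_m m (Some k) t \<xi>"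
proof -
  have "complex_of_real (sqrt t) * of_real (sqrt t) = of_real t" using t by (simp flip: of_real_mult)
  then have st: "complex_of_real (sqrt t) * (of_real (sqrt t) * z) = of_real t * z" for z
    by (simp add: mult.assoc[symmetric])
  show "of_real (1 - \<phi> \<xi>) * sol \<xi> t (axis None 1) $ None = high_\<theta> None t \<xi>"
    by (simp add: sol_axis[OF t] \<phi>c_def)
  show e: "of_real (1 - \<phi> \<xi>) * sol \<xi> t (axis (Some k) 1) $ None = high_\<theta> (Some k) t \<xi>" for k
    unfolding high_\<theta>.simps sol_axis[OF t] \<phi>c_def by (simp add: mult_ac st)
  show "\<i> * of_real (\<xi>$l) * high_\<theta> None t \<xi> = \<i> * of_real (\<xi>$l) * high_D\<theta> l None t \<xi>" by simp
  show "\<i> * of_real (\<xi>$l) * high_\<theta> (Some k) t \<xi> = high_D\<theta> l (Some k) t \<xi>"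
    unfolding high_\<theta>.simps high_D\<theta>.simps sqrt_comp[OF t] by (simp add: mult_ac st)
  show "of_real (1 - \<phi> \<xi>) * sol \<xi> t (axis None 1) $ Some m = \<i> * of_real (\<xi>$m) * high_m m None t \<xi>"
    unfolding high_m.simps sol_axis[OF t] \<phi>c_def by (simp add: mult_ac)
  show "of_real (1 - \<phi> \<xi>) * sol \<xi> t (axis (Some k) 1) $ Some m = high_m m (Some k) t \<xi>"
    unfolding high_m.simps sol_axis[OF t] sqrt_comp[OF t] \<phi>c_def by (simp add: algebra_simps)
qed

section \<open>Representation and estimate at high frequencies\<close>

definition data :: "(real^'n \<Rightarrow> real) \<Rightarrow> (real^'n \<Rightarrow> real^'n) \<Rightarrow> 'n option \<Rightarrow> real^'n \<Rightarrow> complex" where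
  "data f g i y = (case i of None \<Rightarrow> of_real (f y) | Some k \<Rightarrow> of_real (g y $ k))"

lemma data_simps: "data f g None = (\<lambda>y. of_real (f y))" "data f g (Some k) = (\<lambda>y. of_real (g y $ k))"
  by (auto simp: data_def)

lemma sum_data: "(\<Sum>i\<in>UNIV. Lp_norm q (data f g i)) = Lp_norm q f + (\<Sum>k\<in>UNIV. Lp_norm q (\<lambda>x. g x $ k))"
  unfolding sum_option_UNIV data_simps by simp

abbreviation "S_high t f g \<equiv> S_cut \<alpha> \<beta> \<kappa> \<rho> (\<lambda>\<xi>. 1 - \<phi> \<xi>) t f g"

lemma S_high_\<theta>:
  assumes "t > 0"
  shows "S_high t f g None = (\<lambda>x. \<Sum>i\<in>UNIV. conv_op (high_\<theta> i t) (data f g i) x)"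
  by (rule ext) (simp only: S_cut_def high_eq[OF assms] sum_option_UNIV data_simps)

text \<open>The symbol from f to m contains a full factor i \<xi>$m, which
  \<open>conv_op_weak_partial\<close> moves onto f. This is where the W^1 norm of f enters.\<close>

lemma S_high_m:
  assumes t: "t > 0" and f: "weighted_integrable (\<lambda>y. of_real (f y))" and h: "weighted_integrable (\<lambda>y. of_real (h y))" and "weak_partial m f h"
  shows "S_high t f g (Some m) = (\<lambda>x. \<Sum>i\<in>UNIV. conv_op (high_m m i t) (data h g i) x)"
  by (rule ext) (simp only: S_cut_def high_eq[OF t] sum_option_UNIV data_simps
    conv_op_weak_partial[OF scale_decay_schwartz[OF scale_decay_high_symbols(3) t] assms(4) f h \<phi> \<epsilon>, of m None])

text \<open>The additional derivative is used up on both data: on f it becomes the weak derivative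
  h, on g it balances the surplus sqrt t. So only the list ks is left to cost powers of t.\<close>

lemma partials_S_high_D\<theta>:
  assumes t: "t > 0" and f: "weighted_integrable (\<lambda>y. of_real (f y))" and h: "weighted_integrable (\<lambda>y. of_real (h y))" and "weak_partial l f h"
    and g: "\<And>k. weighted_integrable (\<lambda>y. of_real (g y $ k))"
  shows "partials (l # ks) (S_high t f g None) = (\<lambda>x. \<Sum>i\<in>UNIV. conv_op (\<lambda>\<xi>. freq_monomial ks \<xi> * high_D\<theta> l i t \<xi>) (data h g i) x)"
proof -
  have d: "weighted_integrable (data f g i)" for i using f g unfolding data_def by (cases i) auto
  have "partials (l # ks) (S_high t f g None) = (\<lambda>x. \<Sum>i\<in>UNIV. conv_op (\<lambda>\<xi>. freq_monomial (l # ks) \<xi> * high_\<theta> i t \<xi>) (data f g i) x)"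
    unfolding S_high_\<theta>[OF t] by (intro partials_sum_conv_op scale_decay_schwartz[OF scale_decay_high_symbols(1) t] d)
  also have "\<dots> = (\<lambda>x. \<Sum>i\<in>UNIV. conv_op (\<lambda>\<xi>. freq_monomial ks \<xi> * high_D\<theta> l i t \<xi>) (data h g i) x)"
  proof -
    have "(\<lambda>\<xi>. freq_monomial (l # ks) \<xi> * high_\<theta> None t \<xi>) = (\<lambda>\<xi>. \<i> * of_real (\<xi>$l) * (freq_monomial ks \<xi> * high_D\<theta> l None t \<xi>))"
      by (simp add: mult.assoc)
    then have 1: "conv_op (\<lambda>\<xi>. freq_monomial (l # ks) \<xi> * high_\<theta> None t \<xi>) (\<lambda>y. of_real (f y)) = conv_op (\<lambda>\<xi>. freq_monomial ks \<xi> * high_D\<theta> l None t \<xi>) (\<lambda>y. of_real (h y))"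
      using conv_op_weak_partial[OF schwartz_freq_monomial[OF scale_decay_schwartz[OF scale_decay_high_symbols(2) t]] assms(4) f h \<phi> \<epsilon>, of ks l None]
      by (simp only:)
    have 2: "(\<lambda>\<xi>. freq_monomial (l # ks) \<xi> * high_\<theta> (Some k) t \<xi>) = (\<lambda>\<xi>. freq_monomial ks \<xi> * high_D\<theta> l (Some k) t \<xi>)" for k
      unfolding high_eq(4)[OF t, symmetric] freq_monomial.simps by (simp only: mult_ac)
    show ?thesis unfolding sum_option_UNIV data_simps 1 2 ..
  qed
  finally show ?thesis .
qed

text \<open>The W^(1,0) norm splits into theta, its gradient and m. Each is a sum of convolutions
  with \<open>scale_decay\<close> symbols carrying exactly j further derivatives, applied to g and
  to either f or one of its weak partial derivatives.\<close>

lemma high_frequency_estimate: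
  "\<exists>C>0. \<forall>(t::real) (f::real^'n \<Rightarrow> real) (df::'n \<Rightarrow> real^'n \<Rightarrow> real) (g::real^'n \<Rightarrow> real^'n).
         0 < t \<and> 1 < q \<and> q \<le> p \<and> q \<noteq> \<top> \<and>
         f \<in> borel_measurable lborel \<and> (\<forall>k. df k \<in> borel_measurable lborel) \<and>
         (\<forall>k. (\<lambda>x. g x $ k) \<in> borel_measurable lborel) \<and> (\<forall>k. weak_partial k f (df k)) \<longrightarrow>
         (\<Sum>ks\<in>{ks::'n list. length ks = j}.
              Lp_norm p (partials ks (S_high t f g None)) + (\<Sum>k\<in>UNIV. Lp_norm p (partials (k # ks) (S_high t f g None)))
              + (\<Sum>k\<in>UNIV. Lp_norm p (partials ks (S_high t f g (Some k)))))
           \<le> ennreal (C * t powr (- (real CARD('n) / 2 * (enn2real (1/q) - enn2real (1/p)) + real j / 2)))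
             * (Lp_norm q f + (\<Sum>k\<in>UNIV. Lp_norm q (df k)) + (\<Sum>k\<in>UNIV. Lp_norm q (\<lambda>x. g x $ k)))"
proof -
  define R where "R = (\<lambda>(t, f, df, g). (0::real) < t \<and> 1 < q \<and> q \<le> p \<and> q \<noteq> \<top> \<and>
         (f::real^'n \<Rightarrow> real) \<in> borel_measurable lborel \<and> (\<forall>k::'n. df k \<in> borel_measurable lborel) \<and>
         (\<forall>k. (\<lambda>x::real^'n. (g x :: real^'n) $ k) \<in> borel_measurable lborel) \<and> (\<forall>k. weak_partial k f (df k)))"
  define X where "X = (\<lambda>(t::real, f::real^'n \<Rightarrow> real, df::'n \<Rightarrow> real^'n \<Rightarrow> real, g::real^'n \<Rightarrow> real^'n). Lp_norm q f + (\<Sum>k\<in>UNIV. Lp_norm q (df k)) + (\<Sum>k\<in>UNIV. Lp_norm q (\<lambda>x. g x $ k)))"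
  define T where "T = (\<lambda>(t, f::real^'n \<Rightarrow> real, df::'n \<Rightarrow> real^'n \<Rightarrow> real, g::real^'n \<Rightarrow> real^'n). t powr (- (real CARD('n) / 2 * (enn2real (1/q) - enn2real (1/p)) + real j / 2)))"
  define R' where "R' = (\<lambda>z. R z \<and> X z \<noteq> \<top>)"
  have fin: "weighted_integrable (\<lambda>y. of_real (f y))" "weighted_integrable (\<lambda>y. of_real (df k y))" "weighted_integrable (\<lambda>y. of_real (g y $ k))"
    if z: "R' (t, f, df, g)" for t f df g k
  proof -
    have "Lp_norm q f \<noteq> \<top>" "\<And>k. Lp_norm q (df k) \<noteq> \<top>" "\<And>k. Lp_norm q (\<lambda>x. g x $ k) \<noteq> \<top>"
      using z unfolding R'_def X_def by auto
    then show "weighted_integrable (\<lambda>y. of_real (f y))" "weighted_integrable (\<lambda>y. of_real (df k y))" "weighted_integrable (\<lambda>y. of_real (g y $ k))"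
      using z unfolding R'_def R_def by (auto intro!: Lp_norm_finite_weighted_integrable)
  qed
  \<comment> \<open>\<open>h\<close> selects the scalar datum: f itself for theta, a weak partial
    derivative for the gradient of theta and for m. One argument then serves all three.\<close>
  have main: "bounded_by R' T X (\<lambda>(t, f, df, g). Lp_norm p (\<lambda>x. \<Sum>i\<in>UNIV. conv_op (\<lambda>\<xi>. freq_monomial ks \<xi> * m i t \<xi>) (data (h f df) g i) x))"
    if ks: "length ks = j" and m: "\<And>i. scale_decay (m i)" and h: "\<And>f df. h f df = f \<or> (\<exists>k. h f df = df k)"
    for ks and m :: "'n option \<Rightarrow> real \<Rightarrow> real^'n \<Rightarrow> complex" and h
  proof (rule bounded_by_mono)
    show "bounded_by R' T (\<lambda>z. \<Sum>i\<in>UNIV. Lp_norm q (data (h (fst (snd z)) (fst (snd (snd z)))) (snd (snd (snd z))) i))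
      (\<lambda>z. Lp_norm p (\<lambda>x. \<Sum>i\<in>UNIV. conv_op (\<lambda>\<xi>. freq_monomial ks \<xi> * m i (fst z) \<xi>) (data (h (fst (snd z)) (fst (snd (snd z)))) (snd (snd (snd z))) i) x))"
      unfolding T_def case_prod_beta' ks[symmetric]
    proof (rule bounded_by_conv_sum[OF m])
      fix z assume z: "R' z"
      obtain t f df g where z': "z = (t, f, df, g)" by (metis surj_pair)
      have "weighted_integrable (data (h f df) g i)" for i
        using fin[OF z[unfolded z']] h[of f df] unfolding data_def by (cases i) auto
      then show "0 < fst z \<and> 1 < q \<and> q \<le> p \<and> q \<noteq> \<top> \<and> (\<forall>i. weighted_integrable (data (h (fst (snd z)) (fst (snd (snd z)))) (snd (snd (snd z))) i))"
        using z unfolding z' by (auto simp: R'_def R_def)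
    qed
    fix z assume "R' z"
    obtain t f df g where z': "z = (t, f, df, g)" by (metis surj_pair)
    \<comment> \<open>Whatever \<open>h\<close> selects is one summand of the W^1 norm of f.\<close>
    have "Lp_norm q (h f df) \<le> Lp_norm q f + (\<Sum>k\<in>UNIV. Lp_norm q (df k))"
      using h[of f df]
    proof
      assume "\<exists>k. h f df = df k"
      then obtain k where "h f df = df k" by blast
      then have "Lp_norm q (h f df) \<le> (\<Sum>k\<in>UNIV. Lp_norm q (df k))"
        using member_le_sum[of k UNIV "\<lambda>k. Lp_norm q (df k)"] by simp
      then show ?thesis by (simp add: add_increasing)
    qed simp
    then show "(\<Sum>i\<in>UNIV. Lp_norm q (data (h (fst (snd z)) (fst (snd (snd z)))) (snd (snd (snd z))) i)) \<le> X z"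
      unfolding z' X_def sum_data by (simp add: add_right_mono)
  qed (auto simp: case_prod_beta')
  have b\<theta>: "bounded_by R' T X (\<lambda>(t, f, df, g). Lp_norm p (partials ks (S_high t f g None)))" if ks: "length ks = j" for ks
  proof (rule bounded_by_mono[OF main[OF ks scale_decay_high_symbols(1), of "\<lambda>f df. f"]])
    fix z assume z: "R' z"
    obtain t f df g where z': "z = (t, f, df, g)" by (metis surj_pair)
    have t: "t > 0" using z unfolding z' by (simp add: R'_def R_def)
    have d: "weighted_integrable (data f g i)" for i
      using fin[OF z[unfolded z']] unfolding data_def by (cases i) auto
    have "partials ks (S_high t f g None) = (\<lambda>x. \<Sum>i\<in>UNIV. conv_op (\<lambda>\<xi>. freq_monomial ks \<xi> * high_\<theta> i t \<xi>) (data f g i) x)"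
      unfolding S_high_\<theta>[OF t] by (intro partials_sum_conv_op scale_decay_schwartz[OF scale_decay_high_symbols(1) t] d)
    then show "(case z of (t, f, df, g) \<Rightarrow> Lp_norm p (partials ks (S_high t f g None)))
      \<le> (case z of (t, f, df, g) \<Rightarrow> Lp_norm p (\<lambda>x. \<Sum>i\<in>UNIV. conv_op (\<lambda>\<xi>. freq_monomial ks \<xi> * high_\<theta> i t \<xi>) (data f g i) x))"
      unfolding z' by simp
  qed auto
  have bD: "bounded_by R' T X (\<lambda>(t, f, df, g). Lp_norm p (partials (l # ks) (S_high t f g None)))" if ks: "length ks = j" for ks l
  proof (rule bounded_by_mono[OF main[OF ks scale_decay_high_symbols(2)[of l], of "\<lambda>f df. df l"]])
    fix z assume z: "R' z"
    obtain t f df g where z': "z = (t, f, df, g)" by (metis surj_pair)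
    have t: "t > 0" and wk: "weak_partial l f (df l)" using z unfolding z' by (auto simp: R'_def R_def)
    show "(case z of (t, f, df, g) \<Rightarrow> Lp_norm p (partials (l # ks) (S_high t f g None)))
      \<le> (case z of (t, f, df, g) \<Rightarrow> Lp_norm p (\<lambda>x. \<Sum>i\<in>UNIV. conv_op (\<lambda>\<xi>. freq_monomial ks \<xi> * high_D\<theta> l i t \<xi>) (data (df l) g i) x))"
      unfolding z' prod.case partials_S_high_D\<theta>[OF t fin(1)[OF z[unfolded z']] fin(2)[OF z[unfolded z']] wk fin(3)[OF z[unfolded z']]] by simp
  qed auto
  have bm: "bounded_by R' T X (\<lambda>(t, f, df, g). Lp_norm p (partials ks (S_high t f g (Some m))))" if ks: "length ks = j" for ks m
  proof (rule bounded_by_mono[OF main[OF ks scale_decay_high_symbols(3)[of m], of "\<lambda>f df. df m"]])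
    fix z assume z: "R' z"
    obtain t f df g where z': "z = (t, f, df, g)" by (metis surj_pair)
    have t: "t > 0" and wk: "weak_partial m f (df m)" using z unfolding z' by (auto simp: R'_def R_def)
    have d: "weighted_integrable (data (df m) g i)" for i
      using fin[OF z[unfolded z']] unfolding data_def by (cases i) auto
    have "partials ks (S_high t f g (Some m)) = (\<lambda>x. \<Sum>i\<in>UNIV. conv_op (\<lambda>\<xi>. freq_monomial ks \<xi> * high_m m i t \<xi>) (data (df m) g i) x)"
      unfolding S_high_m[OF t fin(1)[OF z[unfolded z']] fin(2)[OF z[unfolded z']] wk]
      by (intro partials_sum_conv_op scale_decay_schwartz[OF scale_decay_high_symbols(3) t] d)
    then show "(case z of (t, f, df, g) \<Rightarrow> Lp_norm p (partials ks (S_high t f g (Some m))))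
      \<le> (case z of (t, f, df, g) \<Rightarrow> Lp_norm p (\<lambda>x. \<Sum>i\<in>UNIV. conv_op (\<lambda>\<xi>. freq_monomial ks \<xi> * high_m m i t \<xi>) (data (df m) g i) x))"
      unfolding z' by simp
  qed auto
  have T0: "0 \<le> T z" for z by (simp add: T_def case_prod_beta')
  have "bounded_by R T X (\<lambda>(t, f, df, g). \<Sum>ks\<in>{ks::'n list. length ks = j}.
              Lp_norm p (partials ks (S_high t f g None)) + (\<Sum>k\<in>UNIV. Lp_norm p (partials (k # ks) (S_high t f g None)))
              + (\<Sum>k\<in>UNIV. Lp_norm p (partials ks (S_high t f g (Some k)))))"
  proof (rule bounded_by_finiteI)
    have "bounded_by R' T X (\<lambda>z. \<Sum>ks\<in>{ks::'n list. length ks = j}.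
              (case z of (t, f, df, g) \<Rightarrow> Lp_norm p (partials ks (S_high t f g None)))
              + (\<Sum>k\<in>UNIV. case z of (t, f, df, g) \<Rightarrow> Lp_norm p (partials (k # ks) (S_high t f g None)))
              + (\<Sum>k\<in>UNIV. case z of (t, f, df, g) \<Rightarrow> Lp_norm p (partials ks (S_high t f g (Some k)))))"
      by (intro bounded_by_sum bounded_by_add b\<theta> bD bm T0) (auto simp: finite_lists_length_eq[of UNIV, simplified])
    then show "bounded_by (\<lambda>z. R z \<and> X z \<noteq> \<top>) T X (\<lambda>(t, f, df, g). \<Sum>ks\<in>{ks::'n list. length ks = j}.
              Lp_norm p (partials ks (S_high t f g None)) + (\<Sum>k\<in>UNIV. Lp_norm p (partials (k # ks) (S_high t f g None)))
              + (\<Sum>k\<in>UNIV. Lp_norm p (partials ks (S_high t f g (Some k)))))"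
      unfolding R'_def case_prod_beta' .
  qed (auto simp: T_def R_def)
  then show ?thesis unfolding bounded_by_def R_def X_def T_def by auto
qed

end

section \<open>Assembling the two estimates\<close>

lemma enlarge_constant:
  fixes F X :: ennreal
  assumes "F \<le> ennreal (C * T) * X" "C \<le> C'" "T \<ge> 0"
  shows "F \<le> ennreal (C' * T) * X"
  using assms by (meson ennreal_leI mult_right_mono order_trans zero_le)

text \<open>A single constant has to serve both frequency regimes. Each estimate survives enlarging
  its constant, so the larger of the two works.\<close>

lemma ex_pos_conj_mono:
  fixes P Q :: "real \<Rightarrow> bool"
  assumes "\<exists>C>0. P C" "\<exists>C>0. Q C" "\<And>C C'. P C \<Longrightarrow> C \<le> C' \<Longrightarrow> P C'" "\<And>C C'. Q C \<Longrightarrow> C \<le> C' \<Longrightarrow> Q C'"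
  shows "\<exists>C>0. P C \<and> Q C"
  using assms by (metis linorder_le_cases)

theorem theorem2p3:
  fixes \<rho> \<mu> \<nu> \<kappa> :: real
  assumes "\<rho> > 0" and "\<mu> > 0" and "\<mu> + \<nu> > 0" and "\<kappa> > 0"
  shows "\<exists>\<epsilon>0>0. \<forall>\<epsilon>. 0 < \<epsilon> \<and> \<epsilon> \<le> \<epsilon>0 \<longrightarrow> (\<forall>\<phi>::real^'n::finite \<Rightarrow> real. cutoff \<epsilon> \<phi> \<longrightarrow>
    (\<forall>(j::nat) (p::ennreal) (q::ennreal). \<exists>C>0.
      (\<forall>(t::real) (f::real^'n \<Rightarrow> real) (G::real^'n \<Rightarrow> real^'n^'n).
         0 < t \<and> 1 < q \<and> q \<le> p \<and> \<not> (p = \<top> \<and> q = \<top>) \<and> (t \<le> 1 \<or> (q \<le> 2 \<and> 2 \<le> p)) \<and>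
         f \<in> borel_measurable lborel \<and> (\<forall>k l. (\<lambda>x. G x $ k $ l) \<in> borel_measurable lborel) \<longrightarrow>
         (\<Sum>a\<in>UNIV. deriv_Lp p j (S_cut_Div (\<mu>/\<rho>) (\<nu>/\<rho>) \<kappa> \<rho> \<phi> t f G a))
           \<le> ennreal (C * t powr (- (real CARD('n) / 2 * (enn2real (1/q) - enn2real (1/p)) + real j / 2)))
             * (Lp_norm q f + (\<Sum>k\<in>UNIV. \<Sum>l\<in>UNIV. Lp_norm q (\<lambda>x. G x $ k $ l)))) \<and>
      (\<forall>(t::real) (f::real^'n \<Rightarrow> real) (df::'n \<Rightarrow> real^'n \<Rightarrow> real) (g::real^'n \<Rightarrow> real^'n).
         0 < t \<and> 1 < q \<and> q \<le> p \<and> \<not> (p = \<top> \<and> q = \<top>) \<and>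
         f \<in> borel_measurable lborel \<and> (\<forall>k. df k \<in> borel_measurable lborel) \<and>
         (\<forall>k. (\<lambda>x. g x $ k) \<in> borel_measurable lborel) \<and> (\<forall>k. weak_partial k f (df k)) \<longrightarrow>
         (let u = S_cut (\<mu>/\<rho>) (\<nu>/\<rho>) \<kappa> \<rho> (\<lambda>\<xi>. 1 - \<phi> \<xi>) t f g in
           (\<Sum>ks\<in>{ks::'n list. length ks = j}.
              Lp_norm p (partials ks (u None)) + (\<Sum>k\<in>UNIV. Lp_norm p (partials (k # ks) (u None)))
              + (\<Sum>k\<in>UNIV. Lp_norm p (partials ks (u (Some k))))))
           \<le> ennreal (C * t powr (- (real CARD('n) / 2 * (enn2real (1/q) - enn2real (1/p)) + real j / 2)))
             * (Lp_norm q f + (\<Sum>k\<in>UNIV. Lp_norm q (df k)) + (\<Sum>k\<in>UNIV. Lp_norm q (\<lambda>x. g x $ k))))))"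
proof (rule exI[of _ 1], intro conjI allI impI, goal_cases)
  case 1
  \<comment> \<open>The bound 1 on the radius is an arbitrary choice; the radius of the cutoff
    influences only \<open>C\<close>.\<close>
  show ?case by simp
next
  case (2 \<epsilon> \<phi> j p q)
  \<comment> \<open>Damping coefficient and product of the roots; their positivity puts both roots
    in the left half plane.\<close>
  have "\<mu>/\<rho> + \<nu>/\<rho> > 0" "\<kappa> * \<rho> > 0"
    using assms by (auto simp: add_divide_distrib[symmetric])
  then obtain a b :: complex where ab: "a + b = - of_real (\<mu>/\<rho> + \<nu>/\<rho>)" "a * b = of_real (\<kappa> * \<rho>)" "Re a < 0" "Re b < 0"
    using damped_roots by blast
  interpret low_high "\<mu>/\<rho>" "\<nu>/\<rho>" \<kappa> \<rho> a b \<epsilon> \<phi>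
    by unfold_locales (use assms ab 2 in auto)
  \<comment> \<open>An infinite q would force p to be infinite as well, the excluded pair.\<close>
  have top: "q \<noteq> \<top>" if "q \<le> p" "\<not> (p = \<top> \<and> q = \<top>)" using that by (auto simp: top_unique)
  show ?case
  proof (rule ex_pos_conj_mono, goal_cases)
    case 1
    show ?case
      by (rule ex_forward[OF low_frequency_estimate[of q p j]], elim conjE, intro conjI allI impI, assumption,
          drule spec, drule spec, drule spec, erule mp) (simp add: top)
  next
    case 2
    show ?case unfolding Let_def
      by (rule ex_forward[OF high_frequency_estimate[of q p j]], elim conjE, intro conjI allI impI, assumption,
          drule spec, drule spec, drule spec, drule spec, erule mp) (simp add: top)
  next
    case (3 C C')
    show ?case
    proof (intro allI impI, goal_cases)
      case 1
      show ?case by (rule enlarge_constant[OF 3(1)[THEN spec, THEN spec, THEN spec, THEN mp, OF 1] 3(2)]) simp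
    qed
  next
    case (4 C C')
    show ?case unfolding Let_def
    proof (intro allI impI, goal_cases)
      case 1
      show ?case by (rule enlarge_constant[OF 4(1)[unfolded Let_def, THEN spec, THEN spec, THEN spec, THEN spec, THEN mp, OF 1] 4(2)]) simp
    qed
  qed
qed

end
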